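(* Under the setup in the context, there is an injective $K$-algebra homomorphism $\Phi\colon \mathcal A\to\mathfrak R_{\mathrm{rk}}$ whose restriction to $\mathcal A_\infty$ is $\pi_\infty$, and such that the sequence $\pi_\infty(\chi_{X\setminus E_n}t)$ converges in $\mathfrak R_{\mathrm{rk}}$ (for the metric $d(x,y)=\mathrm{rk}_{\mathfrak R_{\mathrm{rk}}}(x-y)$) to $\Phi(t)$, which is invertible in $\mathfrak R_{\mathrm{rk}}$. Consequently, the Sylvester matrix rank function $\mathrm{rk}_{\mathcal A}$ on $\mathcal A$ obtained by pulling back (the unique extension to matrices of) $\mathrm{rk}_{\mathfrak R_{\mathrm{rk}}}$ along $\Phi$ is faithful, its restriction $\mathrm{rk}_{\mathcal A_\infty}$ to $\mathcal A_\infty$ is faithful, and $\Phi(\mathcal A_\infty)$ (hence also $\Phi(\mathcal A)$) is dense in $\mathfrak R_{\mathrm{rk}}$; that is, the rank completions of $\mathcal A_\infty$ and of $\mathcal A$ both equal $\mathfrak R_{\mathrm{rk}}$.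
   Context: Let $X$ be an infinite, totally disconnected, compact metrizable space, $T\colon X\to X$ a homeomorphism, and $K$ a field with an involution $\lambda\mapsto\bar\lambda$ (possibly the identity). $C_K(X)$ is the $*$-algebra of locally constant functions $X\to K$ (pointwise operations, $f^*(x)=\overline{f(x)}$); $\chi_U$ denotes the characteristic function of a clopen set $U$. $\mathcal A=C_K(X)\rtimes_T\mathbb Z$ is the algebraic crossed product: finite formal sums $\sum_{i\in\mathbb Z}f_it^i$ with $f_i\in C_K(X)$, componentwise addition, multiplication determined by $tf=(f\circ T^{-1})t$ (so $t\chi_Ut^{-1}=\chi_{T(U)}$), and involution $(ft^i)^*=t^{-i}f^*$; $t$ is invertible with $t^{-1}=t^*$. Let $\mu$ be a full (every nonempty open set has positive measure), ergodic, $T$-invariant Borel probability measure on $X$. A Sylvester matrix rank function on a unital ring $R$ assigns to each matrix $M$ over $R$ a number $\mathrm{rk}(M)\ge0$ such that: $\mathrm{rk}$ of any zero matrix is $0$ and $\mathrm{rk}(1)=1$; $\mathrm{rk}(M_1M_2)\le\min(\mathrm{rk}(M_1),\mathrm{rk}(M_2))$; $\mathrm{rk}\begin{pmatrix}M_1&0\\0&M_2\end{pmatrix}=\mathrm{rk}(M_1)+\mathrm{rk}(M_2)$; $\mathrm{rk}\begin{pmatrix}M_1&M_3\\0&M_2\end{pmatrix}\ge\mathrm{rk}(M_1)+\mathrm{rk}(M_2)$. It is faithful if $\mathrm{rk}(x)=0$ implies $x=0$ for $x\in R$. On a von Neumann regular ring these are the same as pseudo-rank functions (functions $R\to[0,1]$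 with $\mathrm{rk}(0)=0,\mathrm{rk}(1)=1$, $\mathrm{rk}(xy)\le \mathrm{rk}(x),\mathrm{rk}(y)$, additive on orthogonal idempotents), which extend uniquely to matrices. Construction. Fix $y\in X$, a decreasing sequence of clopen sets $E_1\supseteq E_2\supseteq\cdots$ with $\bigcap_nE_n=\{y\}$, and for each $n$ a partition $\mathcal P_n$ of $X\setminus E_n$ (a finite family of nonempty pairwise disjoint clopen sets with union $X\setminus E_n$) such that every member of $\mathcal P_{n+1}\cup\{E_{n+1}\}$ is contained in a member of $\mathcal P_n\cup\{E_n\}$ and $\bigcup_n(\mathcal P_n\cup\{E_n\})$ generates the topology of $X$. Let $\mathcal A_n$ be the unital $*$-subalgebra of $\mathcal A$ generated by $\{\chi_Zt: Z\in\mathcal P_n\}$; then $\mathcal A_n\subseteq\mathcal A_{n+1}$, and $\mathcal A_\infty:=\bigcup_n\mathcal A_n$. Let $\mathcal V_n$ be the set of nonempty sets $W=E_n\cap T^{-1}(Z_1)\cap\cdots\cap T^{-k+1}(Z_{k-1})\cap T^{-k}(E_n)$ with $k\ge1$, $Z_i\in\mathcal P_n$, and put $|W|=k$. With $s_n=\chi_{X\setminus E_n}t$, define $e_{ij}(W)=s_n^i\chi_W(s_n^* )^j$ for $0\le i,j\le|W|-1$ and $h_W=\sum_{l=0}^{|W|-1}\chi_{T^l(W)}$; then $h_W$ is a central projection of $\mathcal A_n$ and $h_W\mathcal A_n\cong M_{|W|}(K)$ via $e_{ij}(W)\mapsto e_{ij}$ (standard matrix units, indexed from $0$; $M_m(K)$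 carries the conjugate-transpose involution). Let $\mathfrak R_n=\prod_{W\in\mathcal V_n}M_{|W|}(K)$ and $\pi_n\colon\mathcal A_n\to\mathfrak R_n$, $\pi_n(a)=(h_Wa)_W$ (an injective $*$-homomorphism). For $W\in\mathcal V_n$, $W'\in\mathcal V_{n+1}$ let $J(W,W')=\{j'\in\{0,\dots,|W'|-1\}: T^{j'}(W')\subseteq W\}$, and let $j_n\colon\mathfrak R_n\to\mathfrak R_{n+1}$ be $j_n((a_W)_W)=\big(\sum_{W}\sum_{j'\in J(W,W')}\sum_{i,j}(a_W)_{ij}\,e_{i+j',j+j'}\big)_{W'}$; these are injective $*$-homomorphisms with $j_n\pi_n=\pi_{n+1}|_{\mathcal A_n}$. Let $\mathfrak R_\infty=\varinjlim(\mathfrak R_n,j_n)$ and $\pi_\infty\colon\mathcal A_\infty\to\mathfrak R_\infty$ the induced injective map. Define the rank function $\mathrm{rk}_{\mathfrak R_n}((x_W)_W)=\sum_{W\in\mathcal V_n}\mu(W)\,\mathrm{Rk}(x_W)$ ($\mathrm{Rk}$ = usual matrix rank); the maps $j_n$ preserve these, giving a faithful rank function $\mathrm{rk}_{\mathfrak R_\infty}$ on the regular ring $\mathfrak R_\infty$. $\mathfrak R_{\mathrm{rk}}$ is the completion of $\mathfrak R_\infty$ with respect to the metric $d(x,y)=\mathrm{rk}_{\mathfrak R_\infty}(x-y)$, a regular ring with the continuous extension $\mathrm{rk}_{\mathfrak R_{\mathrm{rk}}}$ of $\mathrm{rk}_{\mathfrak R_\infty}$. *)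

theory Defs
  imports "HOL-Probability.Probability"
begin

definition Tpow :: "('x \<Rightarrow> 'x) \<Rightarrow> int \<Rightarrow> 'x \<Rightarrow> 'x" where
  "Tpow T i = (if 0 \<le> i then T ^^ nat i else inv T ^^ nat (- i))"

definition loc_const :: "('x::topological_space \<Rightarrow> 'k) \<Rightarrow> bool" where
  "loc_const f \<longleftrightarrow> (\<forall>x. \<exists>U. open U \<and> x \<in> U \<and> (\<forall>z\<in>U. f z = f x))"

text \<open>An element sum_i f_i t^i of the crossed product is represented by i |-> f_i.\<close>
type_synonym ('x,'k) cp = "int \<Rightarrow> 'x \<Rightarrow> 'k"

definition CP :: "('x::topological_space, 'k::zero) cp set" where
  "CP = {a. finite {i. a i \<noteq> (\<lambda>x. 0)} \<and> (\<forall>i. loc_const (a i))}"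

definition cp_zero :: "('x,'k::zero) cp" where "cp_zero = (\<lambda>i x. 0)"
definition cp_one :: "('x,'k::{zero,one}) cp" where
  "cp_one = (\<lambda>i x. if i = 0 then 1 else 0)"
definition cp_t :: "('x,'k::{zero,one}) cp" where
  "cp_t = (\<lambda>i x. if i = 1 then 1 else 0)"
definition cp_chi :: "'x set \<Rightarrow> ('x,'k::{zero,one}) cp" where
  "cp_chi U = (\<lambda>i x. if i = 0 \<and> x \<in> U then 1 else 0)"
definition cp_add :: "('x,'k::plus) cp \<Rightarrow> ('x,'k) cp \<Rightarrow> ('x,'k) cp" where
  "cp_add a b = (\<lambda>i x. a i x + b i x)"
definition cp_smult :: "'k::times \<Rightarrow> ('x,'k) cp \<Rightarrow> ('x,'k) cp" where
  "cp_smult c a = (\<lambda>i x. c * a i x)"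
definition cp_sum :: "('s \<Rightarrow> ('x,'k::comm_monoid_add) cp) \<Rightarrow> 's set \<Rightarrow> ('x,'k) cp" where
  "cp_sum F S = (\<lambda>i x. \<Sum>s\<in>S. F s i x)"

text \<open>(f t^i)(g t^j) = f (g o T^-i) t^(i+j), from t f = (f o T^-1) t.\<close>
definition cp_mult :: "('x \<Rightarrow> 'x) \<Rightarrow> ('x,'k::comm_semiring_0) cp \<Rightarrow> ('x,'k) cp \<Rightarrow> ('x,'k) cp" where
  "cp_mult T a b = (\<lambda>n x. \<Sum>i\<in>{i. a i \<noteq> (\<lambda>x. 0)}. a i x * b (n - i) (Tpow T (- i) x))"

text \<open>(f t^i)^* = t^-i f^* = (f^* o T^i) t^-i.\<close>
definition cp_star :: "('x \<Rightarrow> 'x) \<Rightarrow> ('k \<Rightarrow> 'k) \<Rightarrow> ('x,'k) cp \<Rightarrow> ('x,'k) cp" where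
  "cp_star T cj a = (\<lambda>n x. cj (a (- n) (Tpow T (- n) x)))"

primrec cp_pow :: "('x \<Rightarrow> 'x) \<Rightarrow> ('x,'k::comm_semiring_1) cp \<Rightarrow> nat \<Rightarrow> ('x,'k) cp" where
  "cp_pow T a 0 = cp_one"
| "cp_pow T a (Suc k) = cp_mult T (cp_pow T a k) a"

inductive_set subalg_gen :: "('x \<Rightarrow> 'x) \<Rightarrow> ('k::comm_semiring_1 \<Rightarrow> 'k) \<Rightarrow> ('x,'k) cp set \<Rightarrow> ('x,'k) cp set"
  for T cj G where
  gen: "g \<in> G \<Longrightarrow> g \<in> subalg_gen T cj G"
| one: "cp_one \<in> subalg_gen T cj G"
| add: "a \<in> subalg_gen T cj G \<Longrightarrow> b \<in> subalg_gen T cj G \<Longrightarrow> cp_add a b \<in> subalg_gen T cj G"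
| smult: "a \<in> subalg_gen T cj G \<Longrightarrow> cp_smult c a \<in> subalg_gen T cj G"
| mult: "a \<in> subalg_gen T cj G \<Longrightarrow> b \<in> subalg_gen T cj G \<Longrightarrow> cp_mult T a b \<in> subalg_gen T cj G"
| star: "a \<in> subalg_gen T cj G \<Longrightarrow> cp_star T cj a \<in> subalg_gen T cj G"

definition s_n :: "('x \<Rightarrow> 'x) \<Rightarrow> (nat \<Rightarrow> 'x set) \<Rightarrow> nat \<Rightarrow> ('x,'k::comm_semiring_1) cp" where
  "s_n T E n = cp_mult T (cp_chi (- E n)) cp_t"

definition A_n :: "('x \<Rightarrow> 'x) \<Rightarrow> ('k::comm_semiring_1 \<Rightarrow> 'k) \<Rightarrow> (nat \<Rightarrow> 'x set set) \<Rightarrow> nat \<Rightarrow> ('x,'k) cp set" where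
  "A_n T cj P n = subalg_gen T cj {cp_mult T (cp_chi Z) cp_t | Z. Z \<in> P n}"

definition A_inf :: "('x \<Rightarrow> 'x) \<Rightarrow> ('k::comm_semiring_1 \<Rightarrow> 'k) \<Rightarrow> (nat \<Rightarrow> 'x set set) \<Rightarrow> ('x,'k) cp set" where
  "A_inf T cj P = (\<Union>n. A_n T cj P n)"

section \<open>The index sets V_n (pairs (W, |W|)) and the rings R_n\<close>

definition Vset :: "('x \<Rightarrow> 'x) \<Rightarrow> (nat \<Rightarrow> 'x set) \<Rightarrow> (nat \<Rightarrow> 'x set set) \<Rightarrow> nat \<Rightarrow> ('x set \<times> nat) set" where
  "Vset T E P n = {(W, k). W \<noteq> {} \<and> 1 \<le> k \<and>
     (\<exists>Z. (\<forall>i\<in>{1..<k}. Z i \<in> P n) \<and>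
          W = E n \<inter> (\<Inter>i\<in>{1..<k}. (T ^^ i) -` Z i) \<inter> (T ^^ k) -` E n)}"

text \<open>Elements of R_n = prod_{W in V_n} M_|W|(K): v |-> (i,j) |-> entry, zero off the blocks.\<close>
type_synonym ('x,'k) RR = "'x set \<times> nat \<Rightarrow> nat \<Rightarrow> nat \<Rightarrow> 'k"

definition Rc :: "('x \<Rightarrow> 'x) \<Rightarrow> (nat \<Rightarrow> 'x set) \<Rightarrow> (nat \<Rightarrow> 'x set set) \<Rightarrow> nat \<Rightarrow> ('x,'k::zero) RR set" where
  "Rc T E P n = {a. \<forall>v i j. (v \<notin> Vset T E P n \<or> \<not> i < snd v \<or> \<not> j < snd v) \<longrightarrow> a v i j = 0}"

definition R_add :: "('x,'k::plus) RR \<Rightarrow> ('x,'k) RR \<Rightarrow> ('x,'k) RR" where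
  "R_add a b = (\<lambda>v i j. a v i j + b v i j)"
definition R_smult :: "'k::times \<Rightarrow> ('x,'k) RR \<Rightarrow> ('x,'k) RR" where
  "R_smult c a = (\<lambda>v i j. c * a v i j)"
definition R_mult :: "('x,'k::comm_semiring_0) RR \<Rightarrow> ('x,'k) RR \<Rightarrow> ('x,'k) RR" where
  "R_mult a b = (\<lambda>v i j. \<Sum>l<snd v. a v i l * b v l j)"
definition R_one :: "('x \<Rightarrow> 'x) \<Rightarrow> (nat \<Rightarrow> 'x set) \<Rightarrow> (nat \<Rightarrow> 'x set set) \<Rightarrow> nat \<Rightarrow> ('x,'k::{zero,one}) RR" where
  "R_one T E P n = (\<lambda>v i j. if v \<in> Vset T E P n \<and> i < snd v \<and> i = j then 1 else 0)"

definition mat_rank :: "nat \<Rightarrow> (nat \<Rightarrow> nat \<Rightarrow> 'k::field) \<Rightarrow> nat" where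
  "mat_rank m A = Max {card S | S. S \<subseteq> {..<m} \<and>
      (\<forall>c. (\<forall>i<m. (\<Sum>j\<in>S. c j * A i j) = 0) \<longrightarrow> (\<forall>j\<in>S. c j = 0))}"

definition rkR :: "'x measure \<Rightarrow> ('x \<Rightarrow> 'x) \<Rightarrow> (nat \<Rightarrow> 'x set) \<Rightarrow> (nat \<Rightarrow> 'x set set) \<Rightarrow> nat
    \<Rightarrow> ('x,'k::field) RR \<Rightarrow> real" where
  "rkR \<mu> T E P n a = infsum (\<lambda>v. measure \<mu> (fst v) * real (mat_rank (snd v) (a v))) (Vset T E P n)"

definition e_W :: "('x \<Rightarrow> 'x) \<Rightarrow> ('k::comm_semiring_1 \<Rightarrow> 'k) \<Rightarrow> (nat \<Rightarrow> 'x set) \<Rightarrow> nat \<Rightarrow> 'x set \<times> nat \<Rightarrow> nat \<Rightarrow> nat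
    \<Rightarrow> ('x,'k) cp" where
  "e_W T cj E n v i j = cp_mult T (cp_mult T (cp_pow T (s_n T E n) i) (cp_chi (fst v)))
                              (cp_pow T (cp_star T cj (s_n T E n)) j)"

definition h_W :: "('x \<Rightarrow> 'x) \<Rightarrow> 'x set \<times> nat \<Rightarrow> ('x,'k::comm_semiring_1) cp" where
  "h_W T v = cp_sum (\<lambda>l. cp_chi ((T ^^ l) ` fst v)) {..<snd v}"

definition pi_n :: "('x \<Rightarrow> 'x) \<Rightarrow> ('k::field \<Rightarrow> 'k) \<Rightarrow> (nat \<Rightarrow> 'x set) \<Rightarrow> (nat \<Rightarrow> 'x set set) \<Rightarrow> nat
    \<Rightarrow> ('x,'k) cp \<Rightarrow> ('x,'k) RR" where
  "pi_n T cj E P n a = (\<lambda>v i j. if v \<in> Vset T E P n then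
      (THE c. (\<forall>i j. \<not> (i < snd v \<and> j < snd v) \<longrightarrow> c i j = 0) \<and>
              cp_mult T (h_W T v) a =
                cp_sum (\<lambda>(i, j). cp_smult (c i j) (e_W T cj E n v i j)) ({..<snd v} \<times> {..<snd v})) i j
      else 0)"

definition Jset :: "('x \<Rightarrow> 'x) \<Rightarrow> 'x set \<times> nat \<Rightarrow> 'x set \<times> nat \<Rightarrow> nat set" where
  "Jset T v v' = {j'. j' < snd v' \<and> (T ^^ j') ` fst v' \<subseteq> fst v}"

definition j_n :: "('x \<Rightarrow> 'x) \<Rightarrow> (nat \<Rightarrow> 'x set) \<Rightarrow> (nat \<Rightarrow> 'x set set) \<Rightarrow> nat
    \<Rightarrow> ('x,'k::comm_monoid_add) RR \<Rightarrow> ('x,'k) RR" where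
  "j_n T E P n a = (\<lambda>v' p q. if v' \<in> Vset T E P (Suc n) \<and> p < snd v' \<and> q < snd v' then
      (\<Sum>v\<in>{v \<in> Vset T E P n. Jset T v v' \<noteq> {}}. \<Sum>j'\<in>Jset T v v'.
          if j' \<le> p \<and> j' \<le> q \<and> p - j' < snd v \<and> q - j' < snd v then a v (p - j') (q - j') else 0)
      else 0)"

primrec jup :: "('x \<Rightarrow> 'x) \<Rightarrow> (nat \<Rightarrow> 'x set) \<Rightarrow> (nat \<Rightarrow> 'x set set) \<Rightarrow> nat \<Rightarrow> nat
    \<Rightarrow> ('x,'k::comm_monoid_add) RR \<Rightarrow> ('x,'k) RR" where
  "jup T E P n 0 a = a"
| "jup T E P n (Suc k) a = j_n T E P (n + k) (jup T E P n k a)"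

section \<open>The direct limit R_inf (pairs (level, element)) and its rank completion R_rk\<close>

definition lv :: "('x \<Rightarrow> 'x) \<Rightarrow> (nat \<Rightarrow> 'x set) \<Rightarrow> (nat \<Rightarrow> 'x set set) \<Rightarrow> nat \<times> ('x,'k::comm_monoid_add) RR
    \<Rightarrow> nat \<Rightarrow> ('x,'k) RR" where
  "lv T E P z m = jup T E P (fst z) (m - fst z) (snd z)"

definition dinf :: "'x measure \<Rightarrow> ('x \<Rightarrow> 'x) \<Rightarrow> (nat \<Rightarrow> 'x set) \<Rightarrow> (nat \<Rightarrow> 'x set set)
    \<Rightarrow> nat \<times> ('x,'k::field) RR \<Rightarrow> nat \<times> ('x,'k) RR \<Rightarrow> real" where
  "dinf \<mu> T E P z w = (let m = max (fst z) (fst w) in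
      rkR \<mu> T E P m (R_add (lv T E P z m) (R_smult (- 1) (lv T E P w m))))"

definition cauchy_R :: "'x measure \<Rightarrow> ('x \<Rightarrow> 'x) \<Rightarrow> (nat \<Rightarrow> 'x set) \<Rightarrow> (nat \<Rightarrow> 'x set set)
    \<Rightarrow> (nat \<Rightarrow> nat \<times> ('x,'k::field) RR) \<Rightarrow> bool" where
  "cauchy_R \<mu> T E P s \<longleftrightarrow> (\<forall>k. snd (s k) \<in> Rc T E P (fst (s k))) \<and>
     (\<forall>\<epsilon>>0. \<exists>N. \<forall>p\<ge>N. \<forall>q\<ge>N. dinf \<mu> T E P (s p) (s q) < \<epsilon>)"

definition cls :: "'x measure \<Rightarrow> ('x \<Rightarrow> 'x) \<Rightarrow> (nat \<Rightarrow> 'x set) \<Rightarrow> (nat \<Rightarrow> 'x set set)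
    \<Rightarrow> (nat \<Rightarrow> nat \<times> ('x,'k::field) RR) \<Rightarrow> (nat \<Rightarrow> nat \<times> ('x,'k) RR) set" where
  "cls \<mu> T E P s = {s'. cauchy_R \<mu> T E P s' \<and> (\<lambda>k. dinf \<mu> T E P (s k) (s' k)) \<longlonglongrightarrow> 0}"

definition Rrk :: "'x measure \<Rightarrow> ('x \<Rightarrow> 'x) \<Rightarrow> (nat \<Rightarrow> 'x set) \<Rightarrow> (nat \<Rightarrow> 'x set set)
    \<Rightarrow> (nat \<Rightarrow> nat \<times> ('x,'k::field) RR) set set" where
  "Rrk \<mu> T E P = {cls \<mu> T E P s | s. cauchy_R \<mu> T E P s}"

definition rep :: "'a set \<Rightarrow> 'a" where "rep X = (SOME s. s \<in> X)"

definition seq_op :: "('x \<Rightarrow> 'x) \<Rightarrow> (nat \<Rightarrow> 'x set) \<Rightarrow> (nat \<Rightarrow> 'x set set)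
    \<Rightarrow> (('x,'k::comm_monoid_add) RR \<Rightarrow> ('x,'k) RR \<Rightarrow> ('x,'k) RR)
    \<Rightarrow> (nat \<Rightarrow> nat \<times> ('x,'k) RR) \<Rightarrow> (nat \<Rightarrow> nat \<times> ('x,'k) RR) \<Rightarrow> nat \<Rightarrow> nat \<times> ('x,'k) RR" where
  "seq_op T E P f s t = (\<lambda>k. let m = max (fst (s k)) (fst (t k)) in
      (m, f (lv T E P (s k) m) (lv T E P (t k) m)))"

definition Rrk_add where
  "Rrk_add \<mu> T E P X Y = cls \<mu> T E P (seq_op T E P R_add (rep X) (rep Y))"
definition Rrk_mult where
  "Rrk_mult \<mu> T E P X Y = cls \<mu> T E P (seq_op T E P R_mult (rep X) (rep Y))"
definition Rrk_smult where
  "Rrk_smult \<mu> T E P c X = cls \<mu> T E P (\<lambda>k. (fst (rep X k), R_smult c (snd (rep X k))))"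
definition Rrk_sub where
  "Rrk_sub \<mu> T E P X Y = Rrk_add \<mu> T E P X (Rrk_smult \<mu> T E P (- 1) Y)"
definition Rrk_one where
  "Rrk_one \<mu> T E P = cls \<mu> T E P (\<lambda>k. (0, R_one T E P 0))"

definition rkC :: "'x measure \<Rightarrow> ('x \<Rightarrow> 'x) \<Rightarrow> (nat \<Rightarrow> 'x set) \<Rightarrow> (nat \<Rightarrow> 'x set set)
    \<Rightarrow> (nat \<Rightarrow> nat \<times> ('x,'k::field) RR) set \<Rightarrow> real" where
  "rkC \<mu> T E P X = lim (\<lambda>k. rkR \<mu> T E P (fst (rep X k)) (snd (rep X k)))"

definition iota where
  "iota \<mu> T E P z = cls \<mu> T E P (\<lambda>k. z)"

definition pi_inf :: "'x measure \<Rightarrow> ('x \<Rightarrow> 'x) \<Rightarrow> ('k::field \<Rightarrow> 'k) \<Rightarrow> (nat \<Rightarrow> 'x set)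
    \<Rightarrow> (nat \<Rightarrow> 'x set set) \<Rightarrow> ('x,'k) cp \<Rightarrow> (nat \<Rightarrow> nat \<times> ('x,'k) RR) set" where
  "pi_inf \<mu> T cj E P a = (let n = (LEAST n. a \<in> A_n T cj P n) in iota \<mu> T E P (n, pi_n T cj E P n a))"

end

theory Submission
  imports Defs
begin

text \<open>
  The crossed product acts on each orbit by its regular representation: \<open>\<Sum> f\<^sub>i t\<^sup>i\<close> has the entry
  \<open>f\<^bsub>p-q\<^esub> (T\<^sup>p x)\<close> between \<open>T\<^sup>p x\<close> and \<open>T\<^sup>q x\<close>. Cutting orbits at their visits to \<open>E\<^sub>n\<close> truncates this matrix
  to an element of \<open>R\<^sub>n\<close>; the image of \<open>a\<close> is the class of the sequence of its truncations. If the degrees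
  of \<open>a\<close> lie in \<open>[-D, D]\<close>, cutting disturbs only the rows within distance \<open>D\<close> of a visit to \<open>E\<^sub>n\<close>, whose measure
  is at most \<open>(2 D + 1) \<mu>(E\<^sub>n)\<close>; this tends to 0 because \<open>\<mu>\<close> has no atom at \<open>y\<close>. So the truncations are Cauchy
  and multiplicative in the limit, and on \<open>A\<^sub>n\<close> they are exact from level \<open>n\<close> on. The connecting maps preserve
  the rank since, by ergodicity, almost every point lies in a tower. Faithfulness: if \<open>f\<^sub>d\<close> is the top
  coefficient, a truncation is an echelon matrix whose rank is at least the number of visits to the
  support of \<open>f\<^sub>d\<close> minus \<open>|d|\<close>, so the limit rank is at least the measure of that support. Density: finitely
  supported elements of \<open>R\<^sub>n\<close> come from \<open>A\<^sub>n\<close>.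
\<close>

text \<open>The connecting map \<open>j_n\<close> is a double sum over shifted blocks, awkward to
  handle on entries. In \<open>repr\<close> a kernel may be any function of degree and point, with
  no finiteness or local constancy, so every element of R_n has one (\<open>repr_exists\<close>). As
  \<open>j_n\<close> keeps the kernel and an element of R_n is determined by it, identities across
  levels reduce to identities of kernels. The index sets V_n may be infinite, so ranks are infinite
  sums, dominated by the tower volumes mu(W) |W|. That these total exactly 1 (Kac's formula) turns
  one-sided estimates into equalities by passing to complements, and leaves a small tail in the
  density argument. That y is no atom comes from ergodicity: an atom would make the backward orbit
  of y finite and of full measure, and its complement, nonempty and open because X is infinite,
  contradicts fullness of mu. Operations of the completion use representatives picked by choice;
  they are well defined because each is 1-Lipschitz for the rank distance.\<close>

section \<open>Rank of square matrices\<close>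

text \<open>Gaussian elimination by induction on the equations. The index sets are arbitrary finite
  sets because later factorisations are indexed by disjoint sums and dependent pairs.\<close>

lemma homogeneous_system_nontrivial:
  fixes C :: "'l \<Rightarrow> 'j \<Rightarrow> 'k::field"
  assumes "finite L" "finite S" "card L < card S"
  shows "\<exists>c. (\<exists>j\<in>S. c j \<noteq> 0) \<and> (\<forall>l\<in>L. (\<Sum>j\<in>S. C l j * c j) = 0)"
  using assms
proof (induction L arbitrary: S C rule: finite_induct)
  case empty
  then obtain j where "j \<in> S" by fastforce
  then show ?case by (intro exI[of _ "\<lambda>_. 1"]) auto
next
  case (insert l0 L)
  show ?case
  proof (cases "\<forall>j\<in>S. C l0 j = 0")
    case True
    have "card L < card S" using insert by simp
    from insert.IH[OF insert.prems(1) this, of C] obtain c where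
      "\<exists>j\<in>S. c j \<noteq> 0" "\<forall>l\<in>L. (\<Sum>j\<in>S. C l j * c j) = 0" by auto
    then show ?thesis using True by (intro exI[of _ c]) auto
  next
    case False
    then obtain j0 where j0: "j0 \<in> S" "C l0 j0 \<noteq> 0" by auto
    define S' where "S' = S - {j0}"
    \<comment> \<open>Equation \<open>l0\<close> with pivot \<open>j0\<close> is used to clear
      \<open>j0\<close> from the other equations; \<open>z\<close> below solves equation
      \<open>l0\<close> for the unknown \<open>j0\<close>.\<close>
    define C' where "C' l j = C l j - C l j0 * C l0 j / C l0 j0" for l j
    have S': "finite S'" "card L < card S'" "S = insert j0 S'" "j0 \<notin> S'"
      using insert j0 by (auto simp: S'_def)
    from insert.IH[OF S'(1,2), of C'] obtain c where
      c: "\<exists>j\<in>S'. c j \<noteq> 0" "\<forall>l\<in>L. (\<Sum>j\<in>S'. C' l j * c j) = 0" by auto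
    define z where "z = - (\<Sum>j\<in>S'. C l0 j * c j) / C l0 j0"
    define c' where "c' = c(j0 := z)"
    have sum': "(\<Sum>j\<in>S. C l j * c' j) = C l j0 * z + (\<Sum>j\<in>S'. C l j * c j)" for l
    proof -
      have "(\<Sum>j\<in>S'. C l j * c' j) = (\<Sum>j\<in>S'. C l j * c j)"
        by (rule sum.cong) (use S' in \<open>auto simp: c'_def\<close>)
      then show ?thesis using S' by (simp add: c'_def)
    qed
    have "(\<Sum>j\<in>S. C l j * c' j) = 0" if "l \<in> insert l0 L" for l
    proof (cases "l = l0")
      case True
      then show ?thesis using j0 unfolding sum' by (simp add: z_def)
    next
      case False
      then have "0 = (\<Sum>j\<in>S'. C' l j * c j)" using c that by auto
      also have "\<dots> = (\<Sum>j\<in>S'. C l j * c j) - (\<Sum>j\<in>S'. C l j0 / C l0 j0 * (C l0 j * c j))"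
        by (simp add: C'_def algebra_simps sum_subtractf)
      also have "\<dots> = (\<Sum>j\<in>S'. C l j * c j) + C l j0 * z"
        by (simp only: z_def sum_distrib_left[symmetric]) simp
      finally show ?thesis unfolding sum' by (simp add: add.commute)
    qed
    moreover have "\<exists>j\<in>S. c' j \<noteq> 0" using c(1) S' by (auto simp: c'_def)
    ultimately show ?thesis by blast
  qed
qed

definition col_indep :: "nat \<Rightarrow> (nat \<Rightarrow> nat \<Rightarrow> 'k::field) \<Rightarrow> nat set \<Rightarrow> bool" where
  "col_indep m A S \<longleftrightarrow> S \<subseteq> {..<m} \<and>
     (\<forall>c. (\<forall>i<m. (\<Sum>j\<in>S. c j * A i j) = 0) \<longrightarrow> (\<forall>j\<in>S. c j = 0))"

lemma mat_rank_col_indep: "mat_rank m A = Max (card ` {S. col_indep m A S})"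
  unfolding mat_rank_def col_indep_def by (rule arg_cong[of _ _ Max]) auto

lemma finite_col_indep: "finite {S. col_indep m A S}"
  by (rule finite_subset[of _ "Pow {..<m}"]) (auto simp: col_indep_def)

lemma card_le_mat_rank: "col_indep m A S \<Longrightarrow> card S \<le> mat_rank m A"
  unfolding mat_rank_col_indep by (rule Max_ge) (auto simp: finite_col_indep)

lemma mat_rank_attained: "\<exists>S. col_indep m A S \<and> card S = mat_rank m A"
proof -
  have "col_indep m A {}" by (auto simp: col_indep_def)
  then have "mat_rank m A \<in> card ` {S. col_indep m A S}"
    unfolding mat_rank_col_indep by (intro Max_in) (use finite_col_indep in auto)
  then show ?thesis by auto
qed

text \<open>Rank factorisation: a largest independent set \<open>S\<close> of columns spans all
  columns, and \<open>D\<close> records the coefficients.\<close>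

lemma mat_rank_factor:
  fixes A :: "nat \<Rightarrow> nat \<Rightarrow> 'k::field"
  obtains S D where "finite S" "card S = mat_rank m A"
    "\<forall>i<m. \<forall>j<m. A i j = (\<Sum>s\<in>S. A i s * D s j)"
proof -
  obtain S where S: "col_indep m A S" "card S = mat_rank m A" using mat_rank_attained by blast
  have fS: "finite S" and sub: "S \<subseteq> {..<m}" using S finite_subset by (auto simp: col_indep_def)
  have "\<exists>d. \<forall>i<m. A i j = (\<Sum>s\<in>S. A i s * d s)" if j: "j < m" for j
  proof (cases "j \<in> S")
    case True
    have "A i j = (\<Sum>s\<in>S. A i s * (if s = j then 1 else 0))" for i
      using True fS by (simp add: if_distrib[of "(*) _"] cong: if_cong)
    then show ?thesis by (intro exI[of _ "\<lambda>s. if s = j then 1 else 0"]) auto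
  next
    case False
    \<comment> \<open>By maximality of \<open>S\<close> the enlarged set is dependent; the
      coefficient of \<open>j\<close> in the dependency is nonzero because \<open>S\<close> alone is
      independent.\<close>
    have "\<not> col_indep m A (insert j S)"
      using card_le_mat_rank[of m A "insert j S"] S False fS by auto
    then obtain c where c: "\<forall>i<m. (\<Sum>s\<in>insert j S. c s * A i s) = 0" "\<exists>s\<in>insert j S. c s \<noteq> 0"
      using sub j by (auto simp: col_indep_def)
    have c': "c j * A i j + (\<Sum>s\<in>S. c s * A i s) = 0" if "i < m" for i
      using c(1) that False fS by auto
    have cj: "c j \<noteq> 0"
    proof
      assume "c j = 0"
      then have "\<forall>s\<in>S. c s = 0" using c' S(1) by (auto simp: col_indep_def)
      then show False using c(2) \<open>c j = 0\<close> by auto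
    qed
    have "A i j = (\<Sum>s\<in>S. A i s * (- c s / c j))" if "i < m" for i
    proof -
      have "(\<Sum>s\<in>S. A i s * (- c s / c j)) = (\<Sum>s\<in>S. (c s * A i s) * (- 1 / c j))"
        by (rule sum.cong) (auto simp: field_simps)
      also have "\<dots> = (\<Sum>s\<in>S. c s * A i s) * (- 1 / c j)" by (simp only: sum_distrib_right)
      also have "(\<Sum>s\<in>S. c s * A i s) = - (c j * A i j)"
        using c'[OF that] by (simp add: add_eq_0_iff)
      finally show ?thesis using cj by simp
    qed
    then show ?thesis by (intro exI[of _ "\<lambda>s. - c s / c j"]) auto
  qed
  then have "\<forall>j. \<exists>d. j < m \<longrightarrow> (\<forall>i<m. A i j = (\<Sum>s\<in>S. A i s * d s))" by blast
  from choice[OF this] obtain D where "\<forall>j<m. \<forall>i<m. A i j = (\<Sum>s\<in>S. A i s * D j s)" by auto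
  then show ?thesis using fS S(2) by (intro that[of S "\<lambda>s j. D j s"]) auto
qed

text \<open>Converse of \<open>mat_rank_factor\<close>: more than \<open>card L\<close> columns of
  \<open>C\<close> satisfy a linear relation, and multiplying by \<open>B\<close> turns it into a
  relation between columns of \<open>A\<close>. Rank is thus the least inner dimension of a
  factorisation, and the upper bounds below come from exhibiting one.\<close>

lemma mat_rank_le_factor:
  fixes A :: "nat \<Rightarrow> nat \<Rightarrow> 'k::field"
  assumes "finite L" and "\<And>i j. i < m \<Longrightarrow> j < m \<Longrightarrow> A i j = (\<Sum>l\<in>L. B i l * C l j)"
  shows "mat_rank m A \<le> card L"
proof (rule ccontr)
  obtain S where S: "col_indep m A S" "card S = mat_rank m A" using mat_rank_attained by blast
  have fS: "finite S" and sub: "S \<subseteq> {..<m}" using S finite_subset by (auto simp: col_indep_def)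
  assume "\<not> mat_rank m A \<le> card L"
  then obtain c where c: "\<exists>j\<in>S. c j \<noteq> 0" "\<forall>l\<in>L. (\<Sum>j\<in>S. C l j * c j) = 0"
    using homogeneous_system_nontrivial[OF assms(1) fS, of C] S by auto
  have "(\<Sum>j\<in>S. c j * A i j) = 0" if "i < m" for i
  proof -
    have "(\<Sum>j\<in>S. c j * A i j) = (\<Sum>j\<in>S. \<Sum>l\<in>L. B i l * (C l j * c j))"
    proof (rule sum.cong)
      fix j assume "j \<in> S"
      then have "A i j = (\<Sum>l\<in>L. B i l * C l j)" using assms(2) that sub by auto
      then show "c j * A i j = (\<Sum>l\<in>L. B i l * (C l j * c j))"
        by (simp add: sum_distrib_left mult_ac)
    qed simp
    also have "\<dots> = (\<Sum>l\<in>L. B i l * (\<Sum>j\<in>S. C l j * c j))"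
      by (subst sum.swap) (simp add: sum_distrib_left)
    also have "\<dots> = 0" using c(2) by simp
    finally show ?thesis .
  qed
  then show False using S(1) c(1) by (auto simp: col_indep_def)
qed

lemma mat_rank_cong:
  fixes A :: "nat \<Rightarrow> nat \<Rightarrow> 'k::field"
  assumes "\<And>i j. i < m \<Longrightarrow> j < m \<Longrightarrow> A i j = B i j"
  shows "mat_rank m A = mat_rank m B"
proof -
  have "(\<Sum>j\<in>S. c j * A i j) = (\<Sum>j\<in>S. c j * B i j)" if "S \<subseteq> {..<m}" "i < m" for S c i
    by (rule sum.cong) (use assms that in auto)
  then have "col_indep m A S = col_indep m B S" for S
    unfolding col_indep_def by (intro conj_cong refl all_cong1 imp_cong) auto
  then have "col_indep m A = col_indep m B" by blast
  then show ?thesis unfolding mat_rank_col_indep by simp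
qed

lemma mat_rank_add_le:
  fixes A B :: "nat \<Rightarrow> nat \<Rightarrow> 'k::field"
  shows "mat_rank m (\<lambda>i j. A i j + B i j) \<le> mat_rank m A + mat_rank m B"
proof -
  obtain S D where S: "finite S" "card S = mat_rank m A"
    "\<forall>i<m. \<forall>j<m. A i j = (\<Sum>s\<in>S. A i s * D s j)" by (rule mat_rank_factor[of m A])
  obtain S' D' where S': "finite S'" "card S' = mat_rank m B"
    "\<forall>i<m. \<forall>j<m. B i j = (\<Sum>s\<in>S'. B i s * D' s j)" by (rule mat_rank_factor[of m B])
  \<comment> \<open>The two factorisations are placed side by side, with the disjoint sum as inner
    index.\<close>
  have "mat_rank m (\<lambda>i j. A i j + B i j) \<le> card (S <+> S')"
  proof (rule mat_rank_le_factor[where B = "\<lambda>i. case_sum (A i) (B i)"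
          and C = "\<lambda>l j. case l of Inl s \<Rightarrow> D s j | Inr s \<Rightarrow> D' s j"])
    fix i j assume "i < m" "j < m"
    then have "A i j = (\<Sum>s\<in>S. A i s * D s j)" "B i j = (\<Sum>s\<in>S'. B i s * D' s j)"
      using S(3) S'(3) by blast+
    then show "A i j + B i j = (\<Sum>l\<in>S <+> S'. (case l of Inl s \<Rightarrow> A i s | Inr s \<Rightarrow> B i s) *
        (case l of Inl s \<Rightarrow> D s j | Inr s \<Rightarrow> D' s j))"
      using S(1) S'(1) by (simp add: sum.Plus)
  qed (use S(1) S'(1) in simp)
  then show ?thesis using S S' by (simp add: card_Plus)
qed

lemma mat_rank_mult_le:
  fixes A B :: "nat \<Rightarrow> nat \<Rightarrow> 'k::field"
  shows "mat_rank m (\<lambda>i j. \<Sum>l<m. A i l * B l j) \<le> mat_rank m A" (is ?A)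
    and "mat_rank m (\<lambda>i j. \<Sum>l<m. A i l * B l j) \<le> mat_rank m B" (is ?B)
proof -
  obtain S D where S: "finite S" "card S = mat_rank m A"
    "\<forall>i<m. \<forall>j<m. A i j = (\<Sum>s\<in>S. A i s * D s j)" by (rule mat_rank_factor[of m A])
  have "(\<Sum>l<m. A i l * B l j) = (\<Sum>s\<in>S. A i s * (\<Sum>l<m. D s l * B l j))" if "i < m" for i j
  proof -
    have "(\<Sum>l<m. A i l * B l j) = (\<Sum>l<m. (\<Sum>s\<in>S. A i s * D s l) * B l j)"
      by (rule sum.cong[OF refl]) (use S(3) that in \<open>metis lessThan_iff\<close>)
    also have "\<dots> = (\<Sum>s\<in>S. A i s * (\<Sum>l<m. D s l * B l j))"
      by (simp only: sum_distrib_left sum_distrib_right mult.assoc) (rule sum.swap)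
    finally show ?thesis .
  qed
  then show ?A using mat_rank_le_factor[OF S(1), of m _ A "\<lambda>s j. \<Sum>l<m. D s l * B l j"] S(2) by simp
next
  obtain S D where S: "finite S" "card S = mat_rank m B"
    "\<forall>i<m. \<forall>j<m. B i j = (\<Sum>s\<in>S. B i s * D s j)" by (rule mat_rank_factor[of m B])
  have "(\<Sum>l<m. A i l * B l j) = (\<Sum>s\<in>S. (\<Sum>l<m. A i l * B l s) * D s j)" if "j < m" for i j
  proof -
    have "(\<Sum>l<m. A i l * B l j) = (\<Sum>l<m. A i l * (\<Sum>s\<in>S. B l s * D s j))"
      by (rule sum.cong[OF refl]) (use S(3) that in \<open>metis lessThan_iff\<close>)
    also have "\<dots> = (\<Sum>s\<in>S. (\<Sum>l<m. A i l * B l s) * D s j)"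
      by (simp only: sum_distrib_left sum_distrib_right mult.assoc) (rule sum.swap)
    finally show ?thesis .
  qed
  then show ?B using mat_rank_le_factor[OF S(1), of m _ "\<lambda>i s. \<Sum>l<m. A i l * B l s" D] S(2) by simp
qed

lemma mat_rank_smult_le:
  fixes A :: "nat \<Rightarrow> nat \<Rightarrow> 'k::field"
  shows "mat_rank m (\<lambda>i j. c * A i j) \<le> mat_rank m A"
proof -
  obtain S D where S: "finite S" "card S = mat_rank m A"
    "\<forall>i<m. \<forall>j<m. A i j = (\<Sum>s\<in>S. A i s * D s j)" by (rule mat_rank_factor[of m A])
  have "mat_rank m (\<lambda>i j. c * A i j) \<le> card S"
  proof (rule mat_rank_le_factor[OF S(1), where B = "\<lambda>i s. c * A i s" and C = D])
    fix i j assume "i < m" "j < m"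
    then have "A i j = (\<Sum>s\<in>S. A i s * D s j)" using S(3) by blast
    then show "c * A i j = (\<Sum>s\<in>S. c * A i s * D s j)"
      by (simp only: sum_distrib_left mult.assoc)
  qed
  then show ?thesis using S by simp
qed

text \<open>The matrix factors through its nonzero rows: \<open>B\<close> is the inclusion of these
  rows and \<open>C\<close> is \<open>A\<close> itself.\<close>

lemma mat_rank_le_nonzero_rows:
  fixes A :: "nat \<Rightarrow> nat \<Rightarrow> 'k::field"
  shows "mat_rank m A \<le> card {i. i < m \<and> (\<exists>j<m. A i j \<noteq> 0)}"
  by (rule mat_rank_le_factor[where B = "\<lambda>i l. if i = l then 1 else 0" and C = A])
     (auto simp: if_distrib[of "\<lambda>x. x * _"] cong: if_cong)

lemma mat_rank_le_dim: "mat_rank m (A :: nat \<Rightarrow> nat \<Rightarrow> 'k::field) \<le> m"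
proof -
  have "card {i. i < m \<and> (\<exists>j<m. A i j \<noteq> 0)} \<le> card {..<m}" by (rule card_mono) auto
  then show ?thesis using mat_rank_le_nonzero_rows[of m A] by simp
qed

lemma mat_rank_zero [simp]: "mat_rank m (\<lambda>i j. 0 :: 'k::field) = 0"
  using mat_rank_le_nonzero_rows[of m "\<lambda>i j. 0 :: 'k"] by simp

text \<open>Echelon form: in a linear dependency, the last column involved has the only nonzero entry of its row.\<close>

lemma mat_rank_ge_subdiagonal:
  fixes A :: "nat \<Rightarrow> nat \<Rightarrow> 'k::field" and d :: int
  assumes zero: "\<And>p q. p < m \<Longrightarrow> q < m \<Longrightarrow> int p - int q > d \<Longrightarrow> A p q = 0"
  shows "card {q. q < m \<and> (\<exists>p<m. int p - int q = d \<and> A p q \<noteq> 0)} \<le> mat_rank m A"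
    (is "card ?S \<le> _")
proof (rule card_le_mat_rank, unfold col_indep_def, intro conjI allI impI)
  show "?S \<subseteq> {..<m}" by auto
  fix c assume c: "\<forall>i<m. (\<Sum>j\<in>?S. c j * A i j) = 0"
  have fin: "finite ?S" by simp
  show "\<forall>j\<in>?S. c j = 0"
  proof (rule ccontr)
    assume "\<not> ?thesis"
    then have ne: "{j \<in> ?S. c j \<noteq> 0} \<noteq> {}" by blast
    define q where "q = Max {j \<in> ?S. c j \<noteq> 0}"
    have q: "q \<in> {j \<in> ?S. c j \<noteq> 0}" unfolding q_def by (rule Max_in) (use fin ne in auto)
    have qmax: "j \<le> q" if "j \<in> ?S" "c j \<noteq> 0" for j
      unfolding q_def by (rule Max_ge) (use fin that in auto)
    obtain p where p: "p < m" "int p - int q = d" "A p q \<noteq> 0" using q by auto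
    have "(\<Sum>j\<in>?S. c j * A p j) = (\<Sum>j\<in>{q}. c j * A p j)"
    proof (rule sum.mono_neutral_right)
      show "\<forall>j\<in>?S - {q}. c j * A p j = 0"
      proof
        fix j assume j: "j \<in> ?S - {q}"
        show "c j * A p j = 0"
        proof (cases "c j = 0")
          case False
          then have "j < q" using qmax[of j] j by auto
          then have "A p j = 0" using zero[of p j] p q by auto
          then show ?thesis by simp
        qed simp
      qed
    qed (use q fin in auto)
    then show False using c p q by auto
  qed
qed

text \<open>Upper bound: rank factorisations of the blocks combine, with pairs (block, inner index)
  as inner index. Lower bound: independent column sets of the blocks, shifted by \<open>off\<close>,
  are jointly independent, because a row of one block vanishes on the columns of all others.\<close>

lemma mat_rank_block_diag:
  fixes Ab :: "'b \<Rightarrow> nat \<Rightarrow> nat \<Rightarrow> 'k::field" and off sz :: "'b \<Rightarrow> nat"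
  assumes fin: "finite B"
    and sub: "\<And>b. b \<in> B \<Longrightarrow> off b + sz b \<le> m"
    and disj: "\<And>b b' p. b \<in> B \<Longrightarrow> b' \<in> B \<Longrightarrow> off b \<le> p \<Longrightarrow> p < off b + sz b \<Longrightarrow> off b' \<le> p \<Longrightarrow>
                p < off b' + sz b' \<Longrightarrow> b = b'"
    and A: "\<And>p q. p < m \<Longrightarrow> q < m \<Longrightarrow> A p q = (\<Sum>b\<in>B.
       if off b \<le> p \<and> off b \<le> q \<and> p - off b < sz b \<and> q - off b < sz b
       then Ab b (p - off b) (q - off b) else 0)"
  shows "mat_rank m A = (\<Sum>b\<in>B. mat_rank (sz b) (Ab b))"
proof (rule antisym)
  have "\<exists>SD. finite (fst SD) \<and> card (fst SD) = mat_rank (sz b) (Ab b) \<and>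
           (\<forall>i<sz b. \<forall>j<sz b. Ab b i j = (\<Sum>s\<in>fst SD. Ab b i s * snd SD s j))" for b
    by (rule mat_rank_factor[of "sz b" "Ab b"]) (metis fst_conv snd_conv)
  then obtain SD where SD: "\<And>b. finite (fst (SD b)) \<and> card (fst (SD b)) = mat_rank (sz b) (Ab b) \<and>
           (\<forall>i<sz b. \<forall>j<sz b. Ab b i j = (\<Sum>s\<in>fst (SD b). Ab b i s * snd (SD b) s j))"
    by metis
  define S where "S b = fst (SD b)" for b
  define D where "D b = snd (SD b)" for b
  have S: "\<And>b. finite (S b)" "\<And>b. card (S b) = mat_rank (sz b) (Ab b)"
    "\<And>b i j. i < sz b \<Longrightarrow> j < sz b \<Longrightarrow> Ab b i j = (\<Sum>s\<in>S b. Ab b i s * D b s j)"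
    using SD unfolding S_def D_def by blast+
  define F where "F p = (\<lambda>(b, s). if off b \<le> p \<and> p - off b < sz b then Ab b (p - off b) s else 0)" for p
  define G where "G = (\<lambda>(b, s) q. if off b \<le> q \<and> q - off b < sz b then D b s (q - off b) else 0)"
  have "mat_rank m A \<le> card (SIGMA b:B. S b)"
  proof (rule mat_rank_le_factor[where B = F and C = G])
    fix p q assume pq: "p < m" "q < m"
    have "(\<Sum>l\<in>(SIGMA b:B. S b). F p l * G l q) = (\<Sum>b\<in>B. \<Sum>s\<in>S b. F p (b, s) * G (b, s) q)"
      using fin S(1) by (simp add: sum.Sigma)
    also have "\<dots> = A p q"
      unfolding A[OF pq]
    proof (rule sum.cong)
      fix b
      show "(\<Sum>s\<in>S b. F p (b, s) * G (b, s) q) =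
        (if off b \<le> p \<and> off b \<le> q \<and> p - off b < sz b \<and> q - off b < sz b
         then Ab b (p - off b) (q - off b) else 0)"
        using S(3)[of "p - off b" b "q - off b"] by (auto simp: F_def G_def)
    qed simp
    finally show "A p q = (\<Sum>l\<in>(SIGMA b:B. S b). F p l * G l q)" by simp
  qed (use fin S(1) in auto)
  then show "mat_rank m A \<le> (\<Sum>b\<in>B. mat_rank (sz b) (Ab b))"
    using fin S by (simp add: card_SigmaI)
next
  have "\<forall>b. \<exists>S. col_indep (sz b) (Ab b) S \<and> card S = mat_rank (sz b) (Ab b)"
    using mat_rank_attained by blast
  then obtain S where S: "\<And>b. col_indep (sz b) (Ab b) (S b)"
    "\<And>b. card (S b) = mat_rank (sz b) (Ab b)" by metis
  have Ssub: "s < sz b" if "s \<in> S b" for s b using S(1)[of b] that by (auto simp: col_indep_def)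
  have fS: "finite (S b)" for b by (rule finite_subset[of _ "{..<sz b}"]) (use Ssub in auto)
  define h where "h = (\<lambda>(b, s). off b + s :: nat)"
  have inj: "inj_on h (SIGMA b:B. S b)"
  proof (rule inj_onI, clarify)
    fix b s b' s'
    assume *: "h (b, s) = h (b', s')" "b \<in> B" "s \<in> S b" "b' \<in> B" "s' \<in> S b'"
    have "b = b'"
      by (rule disj[of b b' "off b + s"]) (use * Ssub[of s b] Ssub[of s' b'] in \<open>auto simp: h_def\<close>)
    then show "b = b' \<and> s = s'" using * by (simp add: h_def)
  qed
  let ?S = "h ` (SIGMA b:B. S b)"
  have "col_indep m A ?S" unfolding col_indep_def
  proof (intro conjI allI impI)
    show "?S \<subseteq> {..<m}"
    proof (clarify)
      fix b s assume "b \<in> B" "s \<in> S b"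
      then show "h (b, s) < m" using Ssub[of s b] sub[of b] by (auto simp: h_def)
    qed
    fix c assume c: "\<forall>i<m. (\<Sum>j\<in>?S. c j * A i j) = 0"
    show "\<forall>j\<in>?S. c j = 0"
    proof (clarify)
      fix b s assume b: "b \<in> B" "s \<in> S b"
      have "(\<Sum>s\<in>S b. c (off b + s) * Ab b i s) = 0" if i: "i < sz b" for i
      proof -
        have bm: "off b + i < m" using sub[OF b(1)] i by simp
        have Aeq: "A (off b + i) (off b' + s') = (if b' = b then Ab b i s' else 0)"
          if b': "b' \<in> B" "s' \<in> S b'" for b' s'
        proof -
          have bm': "off b' + s' < m" using sub[OF b'(1)] Ssub[OF b'(2)] by simp
          \<comment> \<open>The row lies only in block \<open>b\<close> and the column only in block
            \<open>b'\<close>, so at most the summand of \<open>b\<close> survives, and only if the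
            two blocks coincide.\<close>
          have "A (off b + i) (off b' + s') = (\<Sum>b''\<in>B. if b'' = b then
              (if b' = b then Ab b i s' else 0) else 0)"
            unfolding A[OF bm bm']
          proof (rule sum.cong)
            fix b'' assume b'': "b'' \<in> B"
            have "b'' = b" if "off b'' \<le> off b + i" "off b + i - off b'' < sz b''"
              using disj[OF b'' b(1), of "off b + i"] that i by auto
            moreover have "b'' = b'" if "off b'' \<le> off b' + s'" "off b' + s' - off b'' < sz b''"
              using disj[OF b'' b'(1), of "off b' + s'"] that Ssub[OF b'(2)] by auto
            ultimately show "(if off b'' \<le> off b + i \<and> off b'' \<le> off b' + s' \<and>
                off b + i - off b'' < sz b'' \<and> off b' + s' - off b'' < sz b''
              then Ab b'' (off b + i - off b'') (off b' + s' - off b'') else 0) =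
              (if b'' = b then (if b' = b then Ab b i s' else 0) else 0)"
              using i Ssub[OF b'(2)] by auto
          qed simp
          then show ?thesis using b fin by simp
        qed
        have "0 = (\<Sum>j\<in>?S. c j * A (off b + i) j)" using c bm by auto
        also have "\<dots> = (\<Sum>(b', s')\<in>(SIGMA b:B. S b). c (off b' + s') * A (off b + i) (off b' + s'))"
          by (subst sum.reindex[OF inj]) (auto simp: h_def intro!: sum.cong)
        also have "\<dots> = (\<Sum>b'\<in>B. \<Sum>s'\<in>S b'. c (off b' + s') * A (off b + i) (off b' + s'))"
          using fin fS by (simp add: sum.Sigma)
        also have "\<dots> = (\<Sum>b'\<in>B. if b' = b then \<Sum>s'\<in>S b. c (off b + s') * Ab b i s' else 0)"
          by (rule sum.cong) (auto simp: Aeq intro!: sum.cong sum.neutral)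
        also have "\<dots> = (\<Sum>s'\<in>S b. c (off b + s') * Ab b i s')" using b fin by simp
        finally show ?thesis by simp
      qed
      then have "\<forall>s\<in>S b. c (off b + s) = 0"
        using S(1)[of b] unfolding col_indep_def
        by (elim conjE allE[where x = "\<lambda>s. c (off b + s)"]) auto
      then show "c (h (b, s)) = 0" using b by (auto simp: h_def)
    qed
  qed
  then have "card ?S \<le> mat_rank m A" by (rule card_le_mat_rank)
  then show "(\<Sum>b\<in>B. mat_rank (sz b) (Ab b)) \<le> mat_rank m A"
    using inj fin fS by (simp add: card_image card_SigmaI S(2))
qed

section \<open>Integer powers of a bijection\<close>

lemma Tpow_0 [simp]: "Tpow T 0 x = x"
  by (simp add: Tpow_def)

lemma Tpow_of_nat [simp]: "Tpow T (int n) = T ^^ n"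
  by (simp add: Tpow_def)

lemma Tpow_succ:
  assumes "bij T" shows "Tpow T (i + 1) x = T (Tpow T i x)"
proof (cases "0 \<le> i")
  case True
  then show ?thesis by (simp add: Tpow_def nat_add_distrib)
next
  case False
  then obtain n where "i = - int (Suc n)" by (metis int_cases linorder_not_le of_nat_0_le_iff)
  moreover have "T (inv T z) = z" for z using assms by (simp add: bij_is_surj surj_f_inv_f)
  ultimately show ?thesis by (auto simp: Tpow_def nat_add_distrib)
qed

lemma Tpow_pred:
  assumes "bij T" shows "Tpow T (i - 1) x = inv T (Tpow T i x)"
  using Tpow_succ[OF assms, of "i - 1" x] assms by (simp add: bij_is_inj)

lemma Tpow_add:
  assumes "bij T" shows "Tpow T (i + j) x = Tpow T i (Tpow T j x)"
proof (induction i rule: int_induct[where k = 0])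
  case (step1 i)
  have "Tpow T (i + 1 + j) x = Tpow T (i + j + 1) x" by (simp add: algebra_simps)
  then show ?case using step1 assms by (simp add: Tpow_succ)
next
  case (step2 i)
  have "Tpow T (i - 1 + j) x = Tpow T (i + j - 1) x" by (simp add: algebra_simps)
  then show ?case using step2 assms by (simp add: Tpow_pred)
qed simp

lemma Tpow_funpow:
  assumes "bij T" shows "Tpow T i ((T ^^ p) x) = Tpow T (i + int p) x"
  using Tpow_add[OF assms, of i "int p" x] by simp

lemma Tpow_cancel [simp]:
  assumes "bij T"
  shows "Tpow T i (Tpow T (- i) x) = x" "Tpow T (- i) (Tpow T i x) = x"
  using Tpow_add[OF assms, of i "- i" x] Tpow_add[OF assms, of "- i" i x] by simp_all

lemma continuous_on_funpow:
  fixes f :: "'a::topological_space \<Rightarrow> 'a"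
  assumes "continuous_on UNIV f" shows "continuous_on UNIV (f ^^ n)"
proof (induction n)
  case (Suc n)
  have "continuous_on UNIV (f \<circ> (f ^^ n))"
    by (rule continuous_on_compose[OF Suc]) (use assms continuous_on_subset in blast)
  then show ?case by simp
qed (simp add: id_def)

section \<open>Visits of an ergodic transformation\<close>

text \<open>Ergodicity is available for strictly invariant sets, which the set \<open>F 0\<close> of
  points with some visit need not be; the set of points with infinitely many visits is. It is the
  decreasing limit of the \<open>F n\<close>, which have equal measure as successive preimages, so
  its measure is at least that of \<open>A\<close>, hence 1.\<close>

lemma ergodic_forward_visits:
  fixes M :: "'a::topological_space measure"
  assumes "prob_space M" and M: "sets M = sets borel"
    and T: "T \<in> measurable borel borel"
    and inv: "\<forall>A\<in>sets borel. measure M (T -` A) = measure M A"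
    and erg: "\<forall>A\<in>sets borel. T -` A = A \<longrightarrow> measure M A = 0 \<or> measure M A = 1"
    and A: "A \<in> sets borel" "measure M A > 0"
  shows "measure M {z. \<exists>i. (T ^^ i) z \<in> A} = 1"
proof -
  interpret prob_space M by fact
  define F where "F n = {z. \<exists>i\<ge>n. (T ^^ i) z \<in> A}" for n
  have Tn: "(T ^^ i) \<in> measurable borel borel" for i
  proof (induction i)
    case 0
    then show ?case by (simp add: id_def)
  next
    case (Suc i)
    then show ?case using measurable_comp[OF Suc T] by (simp add: comp_def)
  qed
  have pre: "(T ^^ i) -` A \<in> sets borel" for i
    using measurable_sets[OF Tn A(1)] by simp
  have F_Un: "F n = (\<Union>i\<in>{n..}. (T ^^ i) -` A)" for n by (auto simp: F_def)
  have meas: "F n \<in> sets borel" for n unfolding F_Un using pre by auto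
  have shift: "T -` F n = F (Suc n)" for n
  proof (intro set_eqI iffI)
    fix z assume "z \<in> T -` F n"
    then obtain i where "i \<ge> n" "(T ^^ Suc i) z \<in> A" by (auto simp: F_def funpow_swap1)
    then show "z \<in> F (Suc n)" unfolding F_def by (intro CollectI exI[of _ "Suc i"]) auto
  next
    fix z assume "z \<in> F (Suc n)"
    then obtain i where i: "i \<ge> Suc n" "(T ^^ i) z \<in> A" by (auto simp: F_def)
    then obtain l where "i = Suc l" by (cases i) auto
    then show "z \<in> T -` F n" using i by (auto simp: F_def funpow_swap1)
  qed
  have mF: "measure M (F n) = measure M (F 0)" for n
  proof (induction n)
    case (Suc n)
    then show ?case using inv meas[of n] shift[of n] by metis
  qed simp
  have dec: "decseq F" unfolding decseq_def F_def using order_trans by (intro allI impI Collect_mono) blast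
  have lim: "(\<lambda>n. measure M (F n)) \<longlonglongrightarrow> measure M (\<Inter>n. F n)"
    by (rule finite_Lim_measure_decseq[OF _ dec]) (simp add: image_subset_iff meas M)
  have "(\<lambda>n. measure M (F n)) = (\<lambda>n. measure M (F 0))" using mF by blast
  then have eq: "measure M (\<Inter>n. F n) = measure M (F 0)"
    using LIMSEQ_unique[OF lim, of "measure M (F 0)"] by (metis tendsto_const)
  have I: "(\<Inter>n. F n) \<in> sets borel" using meas by auto
  have "T -` (\<Inter>n. F n) = (\<Inter>n. F (Suc n))" unfolding shift[symmetric] by auto
  also have "\<dots> = (\<Inter>n. F n)"
  proof (intro antisym subsetI)
    fix z assume "z \<in> (\<Inter>n. F (Suc n))"
    then show "z \<in> (\<Inter>n. F n)" using decseq_SucD[OF dec] by auto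
  qed auto
  finally have "measure M (\<Inter>n. F n) = 0 \<or> measure M (\<Inter>n. F n) = 1" using erg I by blast
  moreover have "measure M (F 0) \<ge> measure M A"
  proof (rule finite_measure_mono)
    show "A \<subseteq> F 0" unfolding F_def using funpow_0[of T] by (metis (mono_tags, lifting) le0 mem_Collect_eq subsetI)
  qed (simp add: meas M)
  ultimately have "measure M (F 0) = 1" using eq A by auto
  then show ?thesis by (simp add: F_def)
qed

section \<open>Return-time towers\<close>

locale tower_system =
  fixes T :: "'x::metric_space \<Rightarrow> 'x" and \<mu> :: "'x measure" and y :: 'x
    and E :: "nat \<Rightarrow> 'x set" and P :: "nat \<Rightarrow> 'x set set"
  assumes X_infinite: "infinite (UNIV :: 'x set)"
    and X_compact: "compact (UNIV :: 'x set)"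
    and T_homeo: "\<exists>T'. homeomorphism UNIV UNIV T T'"
    and mu_sets: "sets \<mu> = sets borel"
    and mu_prob: "prob_space \<mu>"
    and mu_full: "\<forall>U. open U \<and> U \<noteq> {} \<longrightarrow> measure \<mu> U > 0"
    and mu_inv: "\<forall>A \<in> sets borel. measure \<mu> (T -` A) = measure \<mu> A"
    and mu_erg: "\<forall>A \<in> sets borel. T -` A = A \<longrightarrow> measure \<mu> A = 0 \<or> measure \<mu> A = 1"
    and E_clopen: "\<forall>n. open (E n) \<and> closed (E n)"
    and E_decr: "\<forall>n. E (Suc n) \<subseteq> E n"
    and E_inter: "(\<Inter>n. E n) = {y}"
    and P_part: "\<forall>n. finite (P n) \<and> (\<forall>Z \<in> P n. Z \<noteq> {} \<and> open Z \<and> closed Z)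
                    \<and> pairwise disjnt (P n) \<and> \<Union>(P n) = - E n"
    and P_refine: "\<forall>n. \<forall>B \<in> insert (E (Suc n)) (P (Suc n)). \<exists>C \<in> insert (E n) (P n). B \<subseteq> C"
    and P_gen: "open = generate_topology (\<Union>n. insert (E n) (P n))"
begin

sublocale prob_space \<mu> by (rule mu_prob)

section \<open>Integer powers of the homeomorphism, invariance of the measure, absence of an atom at
  \<open>y\<close>\<close>

lemma space_mu [simp]: "space \<mu> = UNIV"
  using sets_eq_imp_space_eq[OF mu_sets] by simp

lemma T_facts: "bij T" "continuous_on UNIV T" "continuous_on UNIV (inv T)"
proof -
  obtain T' where T': "homeomorphism UNIV UNIV T T'" using T_homeo by auto
  then have 1: "\<And>x. T' (T x) = x" "\<And>x. T (T' x) = x" by (auto simp: homeomorphism_def)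
  then show "bij T" by (metis bijI' )
  then have "inv T = T'" using 1 by (metis bij_inv_eq_iff ext)
  then show "continuous_on UNIV T" "continuous_on UNIV (inv T)" using T' by (auto simp: homeomorphism_def)
qed

lemma bij_T [simp]: "bij T" by (rule T_facts)

lemma inj_funpow: "(T ^^ n) x = (T ^^ n) z \<longleftrightarrow> x = z"
proof
  assume "(T ^^ n) x = (T ^^ n) z"
  then have "Tpow T (- int n) (Tpow T (int n) x) = Tpow T (- int n) (Tpow T (int n) z)" by simp
  then show "x = z" by (simp del: Tpow_of_nat)
qed simp

lemma Tpow_continuous: "continuous_on UNIV (Tpow T i)"
  unfolding Tpow_def using T_facts continuous_on_funpow by auto

lemma open_Tpow_vimage: "open U \<Longrightarrow> open {z. Tpow T i z \<in> U}"
  using open_vimage[OF _ Tpow_continuous, of U i] by (simp add: vimage_def)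

lemma borel_Tpow_vimage:
  assumes "A \<in> sets borel" shows "{z. Tpow T i z \<in> A} \<in> sets borel"
  using measurable_sets[OF borel_measurable_continuous_onI[OF Tpow_continuous] assms, of i]
  by (simp add: vimage_def)

lemma measure_Tpow_vimage:
  assumes "A \<in> sets borel" shows "measure \<mu> {z. Tpow T i z \<in> A} = measure \<mu> A"
proof -
  have step: "measure \<mu> {z. Tpow T (i + 1) z \<in> A} = measure \<mu> {z. Tpow T i z \<in> A}" for i
  proof -
    have "{z. Tpow T (i + 1) z \<in> A} = T -` {z. Tpow T i z \<in> A}"
      using Tpow_add[OF bij_T, of i 1] Tpow_of_nat[of T 1] by auto
    then show ?thesis using bspec[OF mu_inv borel_Tpow_vimage[OF assms, of i]] by simp
  qed
  show ?thesis
  proof (induction i rule: int_induct[where k = 0])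
    case (step2 i)
    then show ?case using step[of "i - 1"] by simp
  qed (use step in simp_all)
qed

lemma funpow_image_eq: "(T ^^ p) ` A = {z. Tpow T (- int p) z \<in> A}"
proof -
  have "z \<in> (T ^^ p) ` A" if "Tpow T (- int p) z \<in> A" for z
  proof -
    have "z = (T ^^ p) (Tpow T (- int p) z)"
      using Tpow_cancel(1)[OF bij_T, of "int p" z] by simp
    then show ?thesis using that by blast
  qed
  moreover have "Tpow T (- int p) ((T ^^ p) x) = x" for x
    using Tpow_cancel(2)[OF bij_T, of "int p" x] by simp
  ultimately show ?thesis by auto
qed

lemma E_mono: "m \<le> n \<Longrightarrow> E n \<subseteq> E m"
  by (rule lift_Suc_antimono_le[of E]) (use E_decr in auto)

lemma y_in_E: "y \<in> E n" using E_inter by blast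

lemma borel_E: "E n \<in> sets borel" using E_clopen by auto

lemma measure_E_pos: "measure \<mu> (E n) > 0" using mu_full E_clopen y_in_E by blast

lemma measure_singleton_zero: "measure \<mu> {y} = 0"
proof (rule ccontr)
  assume ne: "measure \<mu> {y} \<noteq> 0"
  define c where "c = measure \<mu> {y}"
  have c: "c > 0" using ne by (simp add: c_def zero_less_measure_iff)
  define O' where "O' = (\<lambda>i. Tpow T (- int i) y) ` (UNIV :: nat set)"
  have mO: "measure \<mu> {Tpow T i y} = c" for i
  proof -
    have "{z. Tpow T (- i) z \<in> {y}} = {Tpow T i y}"
      using Tpow_cancel[OF bij_T, of i] by (auto simp del: Tpow_of_nat)
    then show ?thesis using measure_Tpow_vimage[of "{y}" "- i"] by (simp add: c_def)
  qed
  have finO: "finite O'"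
  proof (rule ccontr)
    assume "infinite O'"
    moreover obtain N :: nat where N: "real N * c > 1" using reals_Archimedean3[OF c] by metis
    ultimately obtain S where S: "S \<subseteq> O'" "finite S" "card S = N"
      by (meson infinite_arbitrarily_large)
    have "measure \<mu> S = (\<Sum>x\<in>S. measure \<mu> {x})"
      by (rule finite_measure_eq_sum_singleton) (use S mu_sets in auto)
    also have "\<dots> = (\<Sum>x\<in>S. c)" by (rule sum.cong) (use S mO in \<open>auto simp: O'_def\<close>)
    finally show False using S N prob_le_1[of S] by simp
  qed
  \<comment> \<open>A point that visits \<open>y\<close> lies on the backward orbit of
    \<open>y\<close>; if \<open>y\<close> had positive mass, almost every point would visit
    it.\<close>
  have sub: "{z. \<exists>i. (T ^^ i) z \<in> {y}} \<subseteq> O'"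
  proof
    fix z assume "z \<in> {z. \<exists>i. (T ^^ i) z \<in> {y}}"
    then obtain i where "Tpow T (int i) z = y" by auto
    then have "z = Tpow T (- int i) y" using Tpow_cancel(2)[OF bij_T, of "int i" z] by simp
    then show "z \<in> O'" by (auto simp: O'_def)
  qed
  have "measure \<mu> {z. \<exists>i. (T ^^ i) z \<in> {y}} = 1"
    by (rule ergodic_forward_visits[OF mu_prob mu_sets _ mu_inv mu_erg])
       (use T_facts c in \<open>auto simp: c_def intro: borel_measurable_continuous_onI\<close>)
  moreover have "closed O'" using finO by (rule finite_imp_closed)
  ultimately have 1: "measure \<mu> O' \<ge> 1"
    using finite_measure_mono[OF sub] mu_sets by auto
  have "open (- O')" "- O' \<noteq> {}" using \<open>closed O'\<close> finO X_infinite
    by (auto simp: open_Compl) (metis Compl_empty_eq double_compl)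
  then have "measure \<mu> (- O') > 0" using mu_full by blast
  moreover have "measure \<mu> (- O') = 1 - measure \<mu> O'"
    using prob_compl[of O'] \<open>closed O'\<close> mu_sets by (simp add: Compl_eq_Diff_UNIV)
  ultimately show False using 1 by simp
qed

lemma measure_E_tendsto_0: "(\<lambda>n. measure \<mu> (E n)) \<longlonglongrightarrow> 0"
proof -
  have "(\<lambda>n. measure \<mu> (E n)) \<longlonglongrightarrow> measure \<mu> (\<Inter>n. E n)"
    by (rule finite_Lim_measure_decseq)
       (use borel_E mu_sets E_decr in \<open>auto simp: decseq_Suc_iff\<close>)
  then show ?thesis using measure_singleton_zero E_inter by simp
qed

subsection \<open>Partition atoms\<close>

text \<open>Lying in the same member of the \<open>n\<close>-th partition, written as a relation so
  that refinement of partitions becomes the implication \<open>atom_eq_mono\<close> and atoms need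
  no names.\<close>

definition atom_eq :: "nat \<Rightarrow> 'x \<Rightarrow> 'x \<Rightarrow> bool" where
  "atom_eq n x z \<longleftrightarrow> (\<forall>C\<in>insert (E n) (P n). x \<in> C \<longleftrightarrow> z \<in> C)"

lemma atom_eq_refl [simp]: "atom_eq n x x" by (simp add: atom_eq_def)
lemma atom_eq_trans: "atom_eq n x z \<Longrightarrow> atom_eq n z w \<Longrightarrow> atom_eq n x w" by (simp add: atom_eq_def)

lemma atom_eq_E: "atom_eq n x z \<Longrightarrow> x \<in> E n \<longleftrightarrow> z \<in> E n" by (simp add: atom_eq_def)

lemma atom_exists: "\<exists>C\<in>insert (E n) (P n). x \<in> C"
  using P_part by (metis ComplI Union_iff insertCI)

lemma atom_unique:
  assumes "C \<in> insert (E n) (P n)" "D \<in> insert (E n) (P n)" "x \<in> C" "x \<in> D"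
  shows "C = D"
proof -
  have "Z \<inter> E n = {}" if "Z \<in> P n" for Z using P_part that by blast
  moreover have "Z = Z'" if "Z \<in> P n" "Z' \<in> P n" "x \<in> Z" "x \<in> Z'" for Z Z'
    using P_part that unfolding pairwise_def disjnt_def by blast
  ultimately show ?thesis using assms by blast
qed

lemma atom_eq_iff_mem:
  assumes "C \<in> insert (E n) (P n)" "x \<in> C"
  shows "atom_eq n x z \<longleftrightarrow> z \<in> C"
  unfolding atom_eq_def using atom_unique[of _ n C] assms by metis

lemma open_atom: "C \<in> insert (E n) (P n) \<Longrightarrow> open C"
  using P_part E_clopen by blast

lemma open_atom_eq: "open {z. atom_eq n x z}"
proof -
  obtain C where "C \<in> insert (E n) (P n)" "x \<in> C" using atom_exists by blast
  then have "{z. atom_eq n x z} = C" using atom_eq_iff_mem by blast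
  then show ?thesis using open_atom \<open>C \<in> _\<close> by simp
qed

lemma atom_eq_Suc: "atom_eq (Suc n) x z \<Longrightarrow> atom_eq n x z"
proof -
  assume a: "atom_eq (Suc n) x z"
  obtain B where B: "B \<in> insert (E (Suc n)) (P (Suc n))" "x \<in> B" using atom_exists by blast
  then obtain C where C: "C \<in> insert (E n) (P n)" "B \<subseteq> C" using P_refine by blast
  have "z \<in> C" using a B C atom_eq_iff_mem by blast
  then show ?thesis using C B atom_eq_iff_mem by blast
qed

lemma atom_eq_mono: "m \<le> n \<Longrightarrow> atom_eq n x z \<Longrightarrow> atom_eq m x z"
  by (induction n rule: dec_induct) (auto dest: atom_eq_Suc)

text \<open>The property holds for the generating atoms, passes to unions, and passes to
  intersections by taking the larger level.\<close>

lemma atom_eq_refines_open: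
  assumes "open U" "x \<in> U"
  shows "\<exists>N. \<forall>z. atom_eq N x z \<longrightarrow> z \<in> U"
proof -
  have "generate_topology (\<Union>n. insert (E n) (P n)) U" using assms P_gen by metis
  then show ?thesis using assms(2)
  proof (induction arbitrary: x rule: generate_topology.induct)
    case (Int a b)
    then obtain N M where "\<forall>z. atom_eq N x z \<longrightarrow> z \<in> a" "\<forall>z. atom_eq M x z \<longrightarrow> z \<in> b" by blast
    then show ?case using atom_eq_mono[of N "max N M"] atom_eq_mono[of M "max N M"]
      by (intro exI[of _ "max N M"]) auto
  next
    case (UN K)
    then show ?case by blast
  next
    case (Basis s)
    then show ?case using atom_eq_iff_mem by blast
  qed simp
qed

text \<open>Every point has a level whose atom lies in a set of constancy; atoms are open, so
  compactness leaves finitely many levels, and their maximum works everywhere.\<close>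

lemma loc_const_atom:
  assumes "loc_const (f :: 'x \<Rightarrow> 'k)"
  shows "\<exists>N. \<forall>n\<ge>N. \<forall>x z. atom_eq n x z \<longrightarrow> f x = f z"
proof -
  have "\<exists>N. \<forall>z. atom_eq N x z \<longrightarrow> f z = f x" for x
  proof -
    obtain U where "open U" "x \<in> U" "\<forall>z\<in>U. f z = f x" using assms by (auto simp: loc_const_def)
    then show ?thesis using atom_eq_refines_open[of U x] by blast
  qed
  then obtain N where N: "\<And>x z. atom_eq (N x) x z \<Longrightarrow> f z = f x" by metis
  obtain C where C: "finite C" "(UNIV :: 'x set) \<subseteq> (\<Union>x\<in>C. {z. atom_eq (N x) x z})"
    using compactE_image[OF X_compact, of UNIV "\<lambda>x. {z. atom_eq (N x) x z}"] open_atom_eq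
    by (metis (mono_tags, lifting) UN_I UNIV_I atom_eq_refl mem_Collect_eq subsetI)
  have "f x = f z" if n: "n \<ge> Max (insert 0 (N ` C))" and a: "atom_eq n x z" for n x z
  proof -
    obtain w where w: "w \<in> C" "atom_eq (N w) w x" using C(2) by blast
    have "N w \<le> n" using n w C(1) by (auto dest: Max.boundedE)
    then have "atom_eq (N w) w z" using atom_eq_mono[OF _ a] w atom_eq_trans by blast
    then show ?thesis using N w by metis
  qed
  then show ?thesis by blast
qed

subsection \<open>The bases of the towers\<close>

definition ret :: "nat \<Rightarrow> 'x \<Rightarrow> nat \<Rightarrow> bool" where
  "ret n x k \<longleftrightarrow> 1 \<le> k \<and> x \<in> E n \<and> (T ^^ k) x \<in> E n \<and> (\<forall>i\<in>{1..<k}. (T ^^ i) x \<notin> E n)"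

text \<open>The points with the itinerary of \<open>x\<close> through the \<open>n\<close>-th
  partition up to time \<open>k\<close>, both ends included. When \<open>k\<close> is the first
  return time this is the base of the tower through \<open>x\<close>. A member of V_n does not store
  its word, so it is recovered in this way from any point of its base.\<close>

definition cyl :: "nat \<Rightarrow> 'x \<Rightarrow> nat \<Rightarrow> 'x set" where
  "cyl n x k = {z. \<forall>i\<le>k. atom_eq n ((T ^^ i) x) ((T ^^ i) z)}"

abbreviation V :: "nat \<Rightarrow> ('x set \<times> nat) set" where "V \<equiv> Vset T E P"

lemma cyl_self [simp]: "x \<in> cyl n x k" by (simp add: cyl_def)

lemma ret_unique:
  assumes "ret n x k" "ret n x k'" shows "k = k'"
proof (rule ccontr)
  assume "k \<noteq> k'"
  then consider "k < k'" | "k' < k" by linarith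
  then show False using assms by cases (auto simp: ret_def)
qed

lemma cyl_eq_word:
  assumes "x \<in> E n" "(T ^^ k) x \<in> E n" "\<And>i. i \<in> {1..<k} \<Longrightarrow> Z i \<in> P n \<and> (T ^^ i) x \<in> Z i"
  shows "cyl n x k = E n \<inter> (\<Inter>i\<in>{1..<k}. (T ^^ i) -` Z i) \<inter> (T ^^ k) -` E n"
proof -
  \<comment> \<open>The word of the tower, completed by the letter \<open>E n\<close> at both ends,
    so that all \<open>k + 1\<close> positions are treated alike.\<close>
  define C where "C i = (if i \<in> {1..<k} then Z i else E n)" for i
  have "(T ^^ i) x \<in> C i \<and> C i \<in> insert (E n) (P n)" if "i \<le> k" for i
  proof (cases "i \<in> {1..<k}")
    case False
    then have "i = 0 \<or> i = k" using that by auto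
    then show ?thesis using assms(1,2) by (auto simp: C_def)
  qed (use assms(3) in \<open>auto simp: C_def\<close>)
  then have "atom_eq n ((T ^^ i) x) ((T ^^ i) z) \<longleftrightarrow> (T ^^ i) z \<in> C i" if "i \<le> k" for i z
    using that atom_eq_iff_mem by blast
  then have 1: "cyl n x k = {z. \<forall>i\<le>k. (T ^^ i) z \<in> C i}" by (auto simp: cyl_def)
  show ?thesis unfolding 1
  proof (intro set_eqI iffI)
    fix z assume z: "z \<in> {z. \<forall>i\<le>k. (T ^^ i) z \<in> C i}"
    have "z \<in> E n" using z by (auto simp: C_def dest: spec[of _ 0])
    moreover have "(T ^^ k) z \<in> E n" using z by (auto simp: C_def)
    moreover have "(T ^^ i) z \<in> Z i" if "i \<in> {1..<k}" for i
    proof -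
      have "(T ^^ i) z \<in> C i" using z that by auto
      then show ?thesis using that by (simp add: C_def)
    qed
    ultimately show "z \<in> E n \<inter> (\<Inter>i\<in>{1..<k}. (T ^^ i) -` Z i) \<inter> (T ^^ k) -` E n" by auto
  next
    fix z assume z: "z \<in> E n \<inter> (\<Inter>i\<in>{1..<k}. (T ^^ i) -` Z i) \<inter> (T ^^ k) -` E n"
    have "(T ^^ i) z \<in> C i" if "i \<le> k" for i
    proof (cases "i \<in> {1..<k}")
      case False
      then have "i = 0 \<or> i = k" using that by auto
      then show ?thesis using z by (auto simp: C_def)
    qed (use z in \<open>auto simp: C_def\<close>)
    then show "z \<in> {z. \<forall>i\<le>k. (T ^^ i) z \<in> C i}" by auto
  qed
qed

text \<open>The letters are disjoint from \<open>E n\<close>, so the height is forced to be the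
  first return time of each point of the base.\<close>

lemma V_D:
  assumes "v \<in> V n" "x \<in> fst v"
  shows "ret n x (snd v)" "fst v = cyl n x (snd v)"
proof -
  obtain W k where v: "v = (W, k)" by (cases v)
  obtain Z where Z: "1 \<le> k" "\<And>i. i \<in> {1..<k} \<Longrightarrow> Z i \<in> P n"
    "W = E n \<inter> (\<Inter>i\<in>{1..<k}. (T ^^ i) -` Z i) \<inter> (T ^^ k) -` E n"
    using assms(1) unfolding v Vset_def mem_Collect_eq prod.case by blast
  have x: "x \<in> E n" "(T ^^ k) x \<in> E n" "\<And>i. i \<in> {1..<k} \<Longrightarrow> Z i \<in> P n \<and> (T ^^ i) x \<in> Z i"
    using assms Z v by auto
  show "fst v = cyl n x (snd v)" using cyl_eq_word[OF x] v Z by simp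
  have "(T ^^ i) x \<notin> E n" if "i \<in> {1..<k}" for i
    using x(3)[OF that] P_part by blast
  then show "ret n x (snd v)" using x Z v by (auto simp: ret_def)
qed

lemma V_nonempty_base: "v \<in> V n \<Longrightarrow> \<exists>x. x \<in> fst v"
  by (auto simp: Vset_def)

lemma V_height: "v \<in> V n \<Longrightarrow> 1 \<le> snd v"
  by (auto simp: Vset_def)

lemma ret_V:
  assumes "ret n x k" shows "(cyl n x k, k) \<in> V n"
proof -
  have "\<forall>i. \<exists>Z. i \<in> {1..<k} \<longrightarrow> Z \<in> P n \<and> (T ^^ i) x \<in> Z"
  proof (intro allI)
    fix i
    show "\<exists>Z. i \<in> {1..<k} \<longrightarrow> Z \<in> P n \<and> (T ^^ i) x \<in> Z"
    proof (cases "i \<in> {1..<k}")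
      case True
      then have "(T ^^ i) x \<notin> E n" using assms by (auto simp: ret_def)
      then show ?thesis using atom_exists[of n "(T ^^ i) x"] by auto
    qed auto
  qed
  from choice[OF this] obtain Z where Z: "\<And>i. i \<in> {1..<k} \<Longrightarrow> Z i \<in> P n \<and> (T ^^ i) x \<in> Z i"
    by auto
  have "cyl n x k = E n \<inter> (\<Inter>i\<in>{1..<k}. (T ^^ i) -` Z i) \<inter> (T ^^ k) -` E n"
    using cyl_eq_word[of x n k Z] Z assms by (auto simp: ret_def)
  moreover have "cyl n x k \<noteq> {}" "1 \<le> k" using assms cyl_self[of x n k] by (fastforce, simp add: ret_def)
  ultimately show ?thesis unfolding Vset_def mem_Collect_eq prod.case using Z by blast
qed

lemma V_level_E:
  assumes "v \<in> V n" "x \<in> fst v" "i \<le> snd v"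
  shows "(T ^^ i) x \<in> E n \<longleftrightarrow> i = 0 \<or> i = snd v"
  using V_D(1)[OF assms(1,2)] assms(3) by (cases "i = snd v"; cases "i = 0") (auto simp: ret_def)

lemma V_atom_eq:
  assumes "v \<in> V n" "x \<in> fst v" "z \<in> fst v" "i \<le> snd v"
  shows "atom_eq n ((T ^^ i) x) ((T ^^ i) z)"
  using V_D(2)[OF assms(1,2)] assms by (auto simp: cyl_def)

lemma V_eqI:
  assumes "v \<in> V n" "v' \<in> V n" "x \<in> fst v" "x \<in> fst v'" shows "v = v'"
  using V_D[OF assms(1,3)] V_D[OF assms(2,4)] ret_unique by (metis prod.expand)

text \<open>Pulling back by \<open>T ^^ p\<close> puts \<open>x\<close> on level
  \<open>p' - p\<close> of the other tower; \<open>x\<close> is in \<open>E n\<close>, which below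
  the top meets a tower only at level 0, so \<open>p = p'\<close>.\<close>

lemma tower_unique_aux:
  assumes "v \<in> V n" "v' \<in> V n" "x \<in> fst v" "x' \<in> fst v'" "p < snd v" "p' < snd v'"
    and eq: "(T ^^ p) x = (T ^^ p') x'" and le: "p \<le> p'"
  shows "v = v' \<and> p = p' \<and> x = x'"
proof -
  have "(T ^^ p') x' = (T ^^ p) ((T ^^ (p' - p)) x')"
    using le funpow_add[of p "p' - p" T] by simp
  then have x: "x = (T ^^ (p' - p)) x'" using eq inj_funpow by metis
  have "x \<in> E n" using V_level_E[OF assms(1,3), of 0] by simp
  then have "p' - p = 0" using V_level_E[OF assms(2,4), of "p' - p"] x assms(6) by auto
  then show ?thesis using x le V_eqI[OF assms(1,2,3)] assms by auto
qed

lemma tower_unique: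
  assumes "v \<in> V n" "v' \<in> V n" "x \<in> fst v" "x' \<in> fst v'" "p < snd v" "p' < snd v'"
    and eq: "(T ^^ p) x = (T ^^ p') x'"
  shows "v = v'" "p = p'" "x = x'"
proof -
  have "v = v' \<and> p = p' \<and> x = x'"
  proof (cases "p \<le> p'")
    case True
    then show ?thesis using tower_unique_aux assms by blast
  next
    case False
    then have "v' = v \<and> p' = p \<and> x' = x" using tower_unique_aux[of v' n v x' x p' p] assms by auto
    then show ?thesis by auto
  qed
  then show "v = v'" "p = p'" "x = x'" by auto
qed

text \<open>Towers are given by finite words over a finite alphabet; restricting the letter function
  makes it extensional, so each word length contributes finitely many.\<close>

lemma countable_V: "countable (V n)"
proof -
  define f where "f k Z = (E n \<inter> (\<Inter>i\<in>{1..<k}. (T ^^ i) -` Z i) \<inter> (T ^^ k) -` E n, k)" for k Z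
  have "V n \<subseteq> (\<Union>k. f k ` ({1..<k} \<rightarrow>\<^sub>E P n))"
  proof
    fix v assume "v \<in> V n"
    then obtain Z where Z: "\<forall>i\<in>{1..<snd v}. Z i \<in> P n" "v = f (snd v) Z"
      unfolding Vset_def f_def by (cases v) (simp only: mem_Collect_eq case_prod_conv snd_conv, blast)
    have "f (snd v) Z = f (snd v) (restrict Z {1..<snd v})" unfolding f_def by auto
    then show "v \<in> (\<Union>k. f k ` ({1..<k} \<rightarrow>\<^sub>E P n))"
      using Z by (auto intro!: exI[of _ "snd v"] image_eqI[where x = "restrict Z {1..<snd v}"])
  qed
  moreover have "countable (\<Union>k. f k ` ({1..<k} \<rightarrow>\<^sub>E P n))"
    using P_part by (intro countable_UN countable_image countable_finite[OF finite_PiE]) auto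
  ultimately show ?thesis by (rule countable_subset)
qed

lemma open_base: assumes "v \<in> V n" shows "open (fst v)"
proof -
  obtain x where x: "x \<in> fst v" using V_nonempty_base assms by blast
  have "fst v = (\<Inter>i\<in>{..snd v}. {z. Tpow T (int i) z \<in> {w. atom_eq n ((T ^^ i) x) w}})"
    using V_D(2)[OF assms x] by (auto simp: cyl_def)
  also have "open \<dots>" by (intro open_INT ballI open_Tpow_vimage open_atom_eq) auto
  finally show ?thesis .
qed

section \<open>Measures of tower levels; the towers fill the space\<close>

abbreviation level :: "'x set \<times> nat \<Rightarrow> nat \<Rightarrow> 'x set" where
  "level v p \<equiv> (T ^^ p) ` fst v"

lemma borel_level: "v \<in> V n \<Longrightarrow> level v p \<in> sets borel"
  unfolding funpow_image_eq by (rule borel_Tpow_vimage[OF borel_open[OF open_base]])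

lemma measure_level: "v \<in> V n \<Longrightarrow> measure \<mu> (level v p) = measure \<mu> (fst v)"
  unfolding funpow_image_eq by (rule measure_Tpow_vimage[OF borel_open[OF open_base]])

text \<open>Levels of towers are pairwise disjoint and each has the measure of its base, so the left
  side is the measure of a disjoint union inside \<open>U\<close>. Later bounds on weighted level
  counts rest on this.\<close>

lemma sum_levels_le:
  assumes "finite S" "S \<subseteq> V n" "\<And>v. v \<in> S \<Longrightarrow> R v \<subseteq> {..<snd v}"
    and "\<And>v p. v \<in> S \<Longrightarrow> p \<in> R v \<Longrightarrow> level v p \<subseteq> U" "U \<in> sets borel"
  shows "(\<Sum>v\<in>S. measure \<mu> (fst v) * real (card (R v))) \<le> measure \<mu> U"
proof -
  have fR: "finite (R v)" if "v \<in> S" for v using finite_subset[OF assms(3)[OF that]] by simp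
  let ?I = "SIGMA v:S. R v"
  have "(\<Sum>v\<in>S. measure \<mu> (fst v) * real (card (R v))) = (\<Sum>v\<in>S. \<Sum>p\<in>R v. measure \<mu> (level v p))"
    using assms(2) measure_level by (intro sum.cong) auto
  also have "\<dots> = (\<Sum>(v, p)\<in>?I. measure \<mu> (level v p))"
    using fR assms(1) by (simp add: sum.Sigma)
  also have "\<dots> = measure \<mu> (\<Union>i\<in>?I. level (fst i) (snd i))"
  proof (subst finite_measure_finite_Union)
    show "disjoint_family_on (\<lambda>i. level (fst i) (snd i)) ?I"
      unfolding disjoint_family_on_def
    proof (intro ballI impI)
      fix i j assume ij: "i \<in> ?I" "j \<in> ?I" "i \<noteq> j"
      obtain v p where i: "i = (v, p)" by (cases i)
      obtain w q where j: "j = (w, q)" by (cases j)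
      have "v \<in> V n" "w \<in> V n" using assms(2) ij i j by auto
      moreover have "p < snd v" "q < snd w" using assms(3)[of v] assms(3)[of w] ij i j by auto
      ultimately show "level (fst i) (snd i) \<inter> level (fst j) (snd j) = {}"
        using tower_unique[of v n w _ _ p q] ij i j by fastforce
    qed
    show "(\<lambda>i. level (fst i) (snd i)) ` ?I \<subseteq> sets \<mu>"
      using assms(2) borel_level mu_sets by auto
  qed (use assms(1) fR in \<open>auto simp: case_prod_beta\<close>)
  also have "\<dots> \<le> measure \<mu> U"
  proof (rule finite_measure_mono)
    show "(\<Union>i\<in>?I. level (fst i) (snd i)) \<subseteq> U" using assms(4) by (intro UN_least) (metis mem_Sigma_iff prod.collapse)
  qed (use assms(5) mu_sets in simp)
  finally show ?thesis .
qed

definition vol :: "'x set \<times> nat \<Rightarrow> real" where "vol v = measure \<mu> (fst v) * real (snd v)"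

lemma summable_vol: "vol summable_on V n"
proof (rule nonneg_bdd_above_summable_on)
  show "bdd_above (sum vol ` {F. F \<subseteq> V n \<and> finite F})"
  proof (rule bdd_aboveI2)
    fix F assume "F \<in> {F. F \<subseteq> V n \<and> finite F}"
    then show "sum vol F \<le> measure \<mu> UNIV"
      using sum_levels_le[of F n "\<lambda>v. {..<snd v}" UNIV] by (simp add: vol_def)
  qed
qed (simp add: vol_def)

text \<open>The visit must come at a positive time, since it becomes the top of the tower through
  \<open>z\<close>; invariance absorbs the shift by one step.\<close>

lemma measure_forward: "measure \<mu> {z. \<exists>i\<ge>1. (T ^^ i) z \<in> E n} = 1"
proof -
  have 1: "measure \<mu> {z. \<exists>i. (T ^^ i) z \<in> E n} = 1"
    by (rule ergodic_forward_visits[OF mu_prob mu_sets _ mu_inv mu_erg borel_E measure_E_pos])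
       (use T_facts in \<open>auto intro: borel_measurable_continuous_onI\<close>)
  have "{z. \<exists>i. (T ^^ i) z \<in> E n} = (\<Union>i. {z. Tpow T (int i) z \<in> E n})" by auto
  then have b: "{z. \<exists>i. (T ^^ i) z \<in> E n} \<in> sets borel" using borel_Tpow_vimage[OF borel_E]
    by (simp del: Tpow_of_nat)
  have "{z. \<exists>i\<ge>1. (T ^^ i) z \<in> E n} = T -` {z. \<exists>i. (T ^^ i) z \<in> E n}"
  proof (intro set_eqI iffI)
    fix z assume "z \<in> {z. \<exists>i\<ge>1. (T ^^ i) z \<in> E n}"
    then obtain i where "i \<ge> 1" "(T ^^ i) z \<in> E n" by auto
    then show "z \<in> T -` {z. \<exists>i. (T ^^ i) z \<in> E n}"
      by (cases i) (auto simp: funpow_swap1)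
  next
    fix z assume "z \<in> T -` {z. \<exists>i. (T ^^ i) z \<in> E n}"
    then obtain i where "(T ^^ Suc i) z \<in> E n" by (auto simp: funpow_swap1)
    then show "z \<in> {z. \<exists>i\<ge>1. (T ^^ i) z \<in> E n}" by (intro CollectI exI[of _ "Suc i"]) auto
  qed
  then show ?thesis using bspec[OF mu_inv b] 1 by simp
qed

text \<open>\<open>inv T\<close> is again measure preserving and ergodic, because a set strictly
  invariant under \<open>inv T\<close> is strictly invariant under \<open>T\<close>.\<close>

lemma measure_backward: "measure \<mu> {z. \<exists>i. Tpow T (- int i) z \<in> E n} = 1"
proof -
  have pre: "inv T -` A = {z. Tpow T (-1) z \<in> A}" for A by (auto simp: Tpow_def)
  have "measure \<mu> {z. \<exists>i. (inv T ^^ i) z \<in> E n} = 1"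
  proof (rule ergodic_forward_visits[OF mu_prob mu_sets _ _ _ borel_E measure_E_pos])
    show "inv T \<in> borel_measurable borel" using T_facts by (auto intro: borel_measurable_continuous_onI)
    show "\<forall>A\<in>sets borel. measure \<mu> (inv T -` A) = measure \<mu> A"
      unfolding pre using measure_Tpow_vimage by blast
    show "\<forall>A\<in>sets borel. inv T -` A = A \<longrightarrow> measure \<mu> A = 0 \<or> measure \<mu> A = 1"
    proof (intro ballI impI)
      fix A :: "'x set" assume A: "A \<in> sets borel" "inv T -` A = A"
      then have "T -` A = T -` (inv T -` A)" by simp
      also have "\<dots> = A" by (auto simp: bij_is_inj)
      finally show "measure \<mu> A = 0 \<or> measure \<mu> A = 1" using A mu_erg by blast
    qed
  qed
  moreover have "(inv T ^^ i) z = Tpow T (- int i) z" for i z by (cases i) (auto simp: Tpow_def nat_add_distrib)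
  ultimately show ?thesis by simp
qed

text \<open>The tower through \<open>z\<close> runs from the last visit to \<open>E n\<close> at or
  before \<open>z\<close> to the first visit strictly after it.\<close>

lemma tower_cover:
  assumes "\<exists>i\<ge>1. (T ^^ i) z \<in> E n" "\<exists>i. Tpow T (- int i) z \<in> E n"
  shows "\<exists>v\<in>V n. \<exists>p<snd v. z \<in> level v p"
proof -
  define i where "i = (LEAST i. Tpow T (- int i) z \<in> E n)"
  define j where "j = (LEAST j. j \<ge> 1 \<and> (T ^^ j) z \<in> E n)"
  have i: "Tpow T (- int i) z \<in> E n" unfolding i_def using assms(2) by (rule LeastI_ex)
  have imin: "Tpow T (- int l) z \<notin> E n" if "l < i" for l
    using not_less_Least[OF that[unfolded i_def]] .
  have j: "j \<ge> 1 \<and> (T ^^ j) z \<in> E n" unfolding j_def using assms(1) by (rule LeastI_ex)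
  have jmin: "(T ^^ l) z \<notin> E n" if "1 \<le> l" "l < j" for l
    using not_less_Least[of l "\<lambda>j. j \<ge> 1 \<and> (T ^^ j) z \<in> E n"] that j_def by auto
  define x where "x = Tpow T (- int i) z"
  have Tx: "(T ^^ l) x = Tpow T (int l - int i) z" for l
    unfolding x_def using Tpow_add[OF bij_T, of "int l" "- int i" z] by simp
  have "ret n x (i + j)" unfolding ret_def
  proof (intro conjI ballI)
    show "(T ^^ (i + j)) x \<in> E n" unfolding Tx using j by simp
    fix l assume l: "l \<in> {1..<i + j}"
    show "(T ^^ l) x \<notin> E n"
    proof (cases "l \<le> i")
      case True
      then have "int l - int i = - int (i - l)" by simp
      then show ?thesis using imin[of "i - l"] l True unfolding Tx by simp
    next
      case False
      then have "(T ^^ l) x = (T ^^ (l - i)) z" unfolding Tx by (simp flip: Tpow_of_nat add: of_nat_diff)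
      then show ?thesis using jmin[of "l - i"] l False by auto
    qed
  qed (use i j in \<open>auto simp: x_def\<close>)
  moreover have "z = (T ^^ i) x" unfolding Tx by simp
  ultimately show ?thesis using ret_V[of n x "i + j"] j cyl_self
    by (intro bexI[of _ "(cyl n x (i + j), i + j)"] exI[of _ i]) auto
qed

text \<open>Kac's return time formula. At most 1 by disjointness of the levels; at least 1 because
  almost every point visits \<open>E n\<close> in both time directions and so lies in a
  tower.\<close>

lemma infsum_vol: "infsum vol (V n) = 1"
proof (rule antisym)
  show "infsum vol (V n) \<le> 1"
  proof (rule infsum_le_finite_sums[OF summable_vol])
    fix F assume "finite F" "F \<subseteq> V n"
    then show "sum vol F \<le> 1"
      using sum_levels_le[of F n "\<lambda>v. {..<snd v}" UNIV] prob_space by (simp add: vol_def)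
  qed
  define D where "D v = (\<Union>p<snd v. level v p)" for v
  have bD: "D v \<in> sets \<mu>" if "v \<in> V n" for v using borel_level that mu_sets by (auto simp: D_def)
  have "AE z in \<mu>. z \<in> {z. \<exists>i\<ge>1. (T ^^ i) z \<in> E n}" "AE z in \<mu>. z \<in> {z. \<exists>i. Tpow T (- int i) z \<in> E n}"
    using AE_prob_1 measure_forward measure_backward by blast+
  then have "AE z in \<mu>. z \<in> (\<Union>v\<in>V n. D v)"
    by eventually_elim (use tower_cover in \<open>fastforce simp: D_def\<close>)
  moreover have U: "(\<Union>v\<in>V n. D v) \<in> sets \<mu>" using bD countable_V by auto
  ultimately have 1: "measure \<mu> (\<Union>v\<in>V n. D v) = 1" using prob_eq_1 by auto
  then have ne: "V n \<noteq> {}" by auto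
  \<comment> \<open>The enumeration repeats towers when \<open>V n\<close> is finite, so the partial
    sums run over images of initial segments.\<close>
  define g where "g = from_nat_into (V n)"
  have g: "g i \<in> V n" "range g = V n" for i
    using ne countable_V by (auto simp: g_def from_nat_into range_from_nat_into)
  define A where "A N = (\<Union>v\<in>g ` {..N}. D v)" for N
  have "(\<Union>N. A N) = (\<Union>v\<in>range g. D v)" unfolding A_def by auto
  then have UA: "(\<Union>N. A N) = (\<Union>v\<in>V n. D v)" using g(2) by simp
  have "(\<lambda>N. measure \<mu> (A N)) \<longlonglongrightarrow> measure \<mu> (\<Union>N. A N)"
  proof (rule finite_Lim_measure_incseq)
    show "range A \<subseteq> sets \<mu>" using bD[OF g(1)] unfolding A_def by (intro image_subsetI sets.finite_UN) auto
    show "incseq A" unfolding A_def incseq_def by (intro allI impI UN_mono image_mono) auto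
  qed
  moreover have "measure \<mu> (A N) \<le> infsum vol (V n)" for N
  proof -
    have "measure \<mu> (A N) \<le> (\<Sum>v\<in>g ` {..N}. measure \<mu> (D v))"
      unfolding A_def by (rule finite_measure_subadditive_finite) (use bD[OF g(1)] in auto)
    also have "\<dots> \<le> sum vol (g ` {..N})"
    proof (rule sum_mono)
      fix v assume "v \<in> g ` {..N}"
      then have v: "v \<in> V n" using g by auto
      have "measure \<mu> (D v) \<le> (\<Sum>p<snd v. measure \<mu> (level v p))"
        unfolding D_def by (rule finite_measure_subadditive_finite) (use borel_level[OF v] mu_sets in auto)
      then show "measure \<mu> (D v) \<le> vol v" using measure_level[OF v] by (simp add: vol_def mult.commute)
    qed
    also have "\<dots> \<le> infsum vol (V n)"
      by (rule finite_sum_le_infsum[OF summable_vol]) (use g in \<open>auto simp: vol_def\<close>)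
    finally show ?thesis .
  qed
  ultimately show "1 \<le> infsum vol (V n)" using 1 UA LIMSEQ_le_const2 by metis
qed

end

section \<open>Kernels and block matrices\<close>

context tower_system
begin

text \<open>A function \<open>F\<close> of degree and point is viewed as the kernel with entry \<open>F (p - q) (T\<^sup>p x)\<close> between the
  points \<open>T\<^sup>p x\<close> and \<open>T\<^sup>q x\<close> of an orbit; for elements of the crossed product this is the
  regular representation. \<open>repr n F c\<close> says that along the towers of level \<open>n\<close> this kernel is
  block diagonal with blocks \<open>c\<close>. The connecting maps do not change the kernel.\<close>

definition repr :: "nat \<Rightarrow> ('x, 'k::zero) cp \<Rightarrow> ('x, 'k) RR \<Rightarrow> bool" where
  "repr n F c \<longleftrightarrow> (\<forall>v\<in>V n. \<forall>x\<in>fst v. \<forall>p<snd v. \<forall>q.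
     F (int p - q) ((T ^^ p) x) = (if 0 \<le> q \<and> q < int (snd v) then c v p (nat q) else 0))"

definition base :: "'x set \<times> nat \<Rightarrow> 'x" where "base v = (SOME x. x \<in> fst v)"

text \<open>The compression of a kernel to the towers of level \<open>n\<close>, read along the
  orbit of a chosen base point. It recovers an element of R_n from a kernel representing it; any
  other kernel is truncated, and the choice of base point is immaterial once the coefficients are
  constant on the atoms of level \<open>n\<close>.\<close>

definition comp :: "nat \<Rightarrow> ('x, 'k::zero) cp \<Rightarrow> ('x, 'k) RR" where
  "comp n F = (\<lambda>v p q. if v \<in> V n \<and> p < snd v \<and> q < snd v
     then F (int p - int q) ((T ^^ p) (base v)) else 0)"

abbreviation R :: "nat \<Rightarrow> ('x, 'k::zero) RR set" where "R \<equiv> Rc T E P"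

lemma base_in: "v \<in> V n \<Longrightarrow> base v \<in> fst v"
  unfolding base_def using V_nonempty_base by (rule someI_ex)

lemma R_zero: "a \<in> R n \<Longrightarrow> \<not> (v \<in> V n \<and> p < snd v \<and> q < snd v) \<Longrightarrow> a v p q = 0"
  unfolding Rc_def mem_Collect_eq by blast

lemma comp_R: "comp n F \<in> R n"
  by (auto simp: Rc_def comp_def)

lemma reprD:
  assumes "repr n F c" "v \<in> V n" "x \<in> fst v" "p < snd v"
  shows "F (int p - q) ((T ^^ p) x) = (if 0 \<le> q \<and> q < int (snd v) then c v p (nat q) else 0)"
  using assms unfolding repr_def by blast

lemma repr_eq_comp:
  assumes "repr n F c" "c \<in> R n" shows "c = comp n F"
proof (intro ext)
  fix v p q
  show "c v p q = comp n F v p q"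
  proof (cases "v \<in> V n \<and> p < snd v \<and> q < snd v")
    case True
    then show ?thesis using reprD[OF assms(1) _ base_in, of v n p "int q"] by (simp add: comp_def)
  next
    case False
    then show ?thesis using R_zero[OF assms(2)] by (auto simp: comp_def)
  qed
qed

text \<open>The device for proving equations in R_n: both sides are shown to represent the same
  kernel.\<close>

lemma repr_unique: "repr n F c \<Longrightarrow> repr n F d \<Longrightarrow> c \<in> R n \<Longrightarrow> d \<in> R n \<Longrightarrow> c = d"
  using repr_eq_comp by metis

lemma R_closed:
  "a \<in> R n \<Longrightarrow> b \<in> R n \<Longrightarrow> R_add a b \<in> R n"
  "a \<in> R n \<Longrightarrow> R_smult c a \<in> R n"
  "a \<in> R n \<Longrightarrow> b \<in> R n \<Longrightarrow> R_mult a b \<in> R n"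
  "R_one T E P n \<in> R n"
  for a b :: "('x, 'k::comm_semiring_1) RR"
  unfolding Rc_def R_add_def R_smult_def R_mult_def R_one_def by auto

lemma comp_add: "comp n (cp_add F G) = R_add (comp n F) (comp n G)"
  for F G :: "('x, 'k::comm_monoid_add) cp"
  by (auto simp: comp_def cp_add_def R_add_def intro!: ext)

lemma comp_smult: "comp n (cp_smult c F) = R_smult c (comp n F)"
  for F :: "('x, 'k::comm_semiring_0) cp"
  by (auto simp: comp_def cp_smult_def R_smult_def intro!: ext)

lemma comp_one: "comp n cp_one = R_one T E P n"
  by (auto simp: comp_def cp_one_def R_one_def intro!: ext)

lemma repr_add: "repr n F c \<Longrightarrow> repr n G d \<Longrightarrow> repr n (cp_add F G) (R_add c d)"
  for F G :: "('x, 'k::comm_monoid_add) cp"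
  by (auto simp: repr_def cp_add_def R_add_def)

lemma repr_smult: "repr n F c \<Longrightarrow> repr n (cp_smult a F) (R_smult a c)"
  for F :: "('x, 'k::comm_semiring_0) cp"
  by (auto simp: repr_def cp_smult_def R_smult_def)

lemma repr_one: "repr n cp_one (R_one T E P n)"
  by (auto simp: repr_def cp_one_def R_one_def)

text \<open>\<open>cp_mult\<close> sums over all degrees with nonzero coefficient function, possibly
  infinitely many for an arbitrary kernel, where the sum would be 0 by convention. Here only degrees
  nonzero at the given point enter, so finitely many nonzero entries per row suffice.\<close>

definition conv :: "('x, 'k::comm_semiring_0) cp \<Rightarrow> ('x, 'k) cp \<Rightarrow> ('x, 'k) cp" where
  "conv F G = (\<lambda>n x. \<Sum>i\<in>{i. F i x \<noteq> 0}. F i x * G (n - i) (Tpow T (- i) x))"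

lemma Tpow_orbit: "Tpow T (- (int p - q)) ((T ^^ p) x) = Tpow T q x"
  using Tpow_funpow[OF bij_T, of "- (int p - q)" p x] by simp

text \<open>The hypothesis confines row \<open>p\<close> of \<open>F\<close> to the columns below
  \<open>k\<close>; substituting \<open>i = p - l\<close> turns the convolution into a row of a
  matrix product.\<close>

lemma conv_orbit:
  assumes F0: "\<And>i. F i ((T ^^ p) x) \<noteq> 0 \<Longrightarrow> 0 \<le> int p - i \<and> int p - i < int k"
  shows "conv F G (int p - q) ((T ^^ p) x) =
    (\<Sum>l<k. F (int p - int l) ((T ^^ p) x) * G (int l - q) ((T ^^ l) x))"
proof -
  let ?z = "(T ^^ p) x"
  let ?h = "\<lambda>l. int p - int l"
  have sub: "{i. F i ?z \<noteq> 0} \<subseteq> ?h ` {..<k}"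
  proof
    fix i assume "i \<in> {i. F i ?z \<noteq> 0}"
    then have "0 \<le> int p - i \<and> int p - i < int k" using F0 by blast
    then show "i \<in> ?h ` {..<k}" by (intro image_eqI[of _ _ "nat (int p - i)"]) auto
  qed
  have "conv F G (int p - q) ?z =
      (\<Sum>i\<in>?h ` {..<k}. F i ?z * G (int p - q - i) (Tpow T (- i) ?z))"
    unfolding conv_def by (rule sum.mono_neutral_left[OF _ sub]) auto
  also have "\<dots> = (\<Sum>l<k. F (int p - int l) ?z * G (int l - q) ((T ^^ l) x))"
  proof (subst sum.reindex)
    show "inj_on ?h {..<k}" by (auto simp: inj_on_def)
    show "sum ((\<lambda>i. F i ?z * G (int p - q - i) (Tpow T (- i) ?z)) \<circ> ?h) {..<k} =
      (\<Sum>l<k. F (int p - int l) ?z * G (int l - q) ((T ^^ l) x))"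
      using Tpow_orbit[of p _ x] by (intro sum.cong) auto
  qed
  finally show ?thesis .
qed

lemma repr_conv:
  assumes "repr n F c" "repr n G d" shows "repr n (conv F G) (R_mult c d)"
  unfolding repr_def
proof (intro ballI allI impI)
  fix v x p q assume v: "v \<in> V n" "x \<in> fst v" "p < snd v"
  have "conv F G (int p - q) ((T ^^ p) x) =
      (\<Sum>l<snd v. F (int p - int l) ((T ^^ p) x) * G (int l - q) ((T ^^ l) x))"
  proof (rule conv_orbit)
    fix i assume "F i ((T ^^ p) x) \<noteq> 0"
    then show "0 \<le> int p - i \<and> int p - i < int (snd v)"
      using reprD[OF assms(1) v, of "int p - i"] by (auto split: if_splits)
  qed
  also have "\<dots> = (\<Sum>l<snd v. c v p l * (if 0 \<le> q \<and> q < int (snd v) then d v l (nat q) else 0))"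
    by (rule sum.cong) (use reprD[OF assms(1) v] reprD[OF assms(2) v(1,2)] in auto)
  finally show "conv F G (int p - q) ((T ^^ p) x) =
      (if 0 \<le> q \<and> q < int (snd v) then R_mult c d v p (nat q) else 0)"
    by (cases "0 \<le> q \<and> q < int (snd v)") (auto simp: R_mult_def intro!: sum.neutral)
qed

text \<open>Tower coordinates of a point are unique, so block entries can be read back as a kernel.
  Outside the towers the values are arbitrary, and \<open>repr\<close> never looks there.\<close>

lemma repr_exists: "\<exists>F. repr n F c"
proof -
  define F where "F d z = (let w = (SOME w. fst w \<in> V n \<and> snd w < snd (fst w) \<and> z \<in> level (fst w) (snd w))
    in if 0 \<le> int (snd w) - d \<and> int (snd w) - d < int (snd (fst w))
       then c (fst w) (snd w) (nat (int (snd w) - d)) else 0)" for d z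
  have "repr n F c" unfolding repr_def
  proof (intro ballI allI impI)
    fix v x p q assume v: "v \<in> V n" "x \<in> fst v" "p < snd v"
    have "(SOME w. fst w \<in> V n \<and> snd w < snd (fst w) \<and> (T ^^ p) x \<in> level (fst w) (snd w)) = (v, p)"
    proof (rule some_equality)
      fix w assume w: "fst w \<in> V n \<and> snd w < snd (fst w) \<and> (T ^^ p) x \<in> level (fst w) (snd w)"
      then obtain x' where "x' \<in> fst (fst w)" "(T ^^ snd w) x' = (T ^^ p) x" by fastforce
      then show "w = (v, p)"
        using tower_unique[of "fst w" n v x' x "snd w" p] w v by (metis prod.collapse)
    qed (use v in auto)
    then show "F (int p - q) ((T ^^ p) x) = (if 0 \<le> q \<and> q < int (snd v) then c v p (nat q) else 0)"
      unfolding F_def by (auto simp: Let_def)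
  qed
  then show ?thesis by blast
qed

subsection \<open>The connecting maps\<close>

text \<open>The occurrences of level-\<open>m\<close> towers inside \<open>v'\<close>, as pairs of
  tower and starting height. The nested sum in \<open>j_n\<close> becomes a single sum over these
  pairs.\<close>

definition blocks :: "nat \<Rightarrow> 'x set \<times> nat \<Rightarrow> (('x set \<times> nat) \<times> nat) set" where
  "blocks m v' = {(v, j). v \<in> V m \<and> j \<in> Jset T v v'}"

lemma funpow_diff: "j \<le> p \<Longrightarrow> (T ^^ (p - j)) ((T ^^ j) x) = (T ^^ p) x"
  using funpow_add[of "p - j" j T] by simp

text \<open>For the bound on \<open>j + snd v\<close>: the top of \<open>v'\<close> lies in
  \<open>E (Suc m)\<close>, hence in \<open>E m\<close>, and a level-\<open>m\<close> tower has no
  visit to \<open>E m\<close> strictly between its two ends, so it cannot stick out of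
  \<open>v'\<close>.\<close>

lemma blocksD:
  assumes "v' \<in> V (Suc m)" "(v, j) \<in> blocks m v'" "x \<in> fst v'"
  shows "v \<in> V m" "(T ^^ j) x \<in> fst v" "j + snd v \<le> snd v'" "j < snd v'"
proof -
  show v: "v \<in> V m" and x: "(T ^^ j) x \<in> fst v" and j: "j < snd v'"
    using assms by (auto simp: blocks_def Jset_def)
  have "(T ^^ (snd v' - j)) ((T ^^ j) x) \<in> E m"
    using funpow_diff[of j "snd v'" x] j V_level_E[OF assms(1,3), of "snd v'"] E_decr by auto
  then show "j + snd v \<le> snd v'"
    using V_level_E[OF v x, of "snd v' - j"] j by (cases "snd v \<le> snd v' - j") auto
qed

lemma blocks_unique:
  assumes "v' \<in> V (Suc m)" "(v, j) \<in> blocks m v'" "(w, i) \<in> blocks m v'"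
    and "j \<le> p" "p < j + snd v" "i \<le> p" "p < i + snd w"
  shows "v = w" "j = i"
proof -
  obtain x where x: "x \<in> fst v'" using V_nonempty_base assms(1) by blast
  note 1 = blocksD[OF assms(1,2) x] and 2 = blocksD[OF assms(1,3) x]
  note tu = tower_unique[OF 1(1) 2(1) 1(2) 2(2), of "p - j" "p - i"]
  have eq: "(T ^^ (p - j)) ((T ^^ j) x) = (T ^^ (p - i)) ((T ^^ i) x)"
    using assms funpow_diff by simp
  show "v = w" by (rule tu(1)) (use assms eq in auto)
  have "p - j = p - i" by (rule tu(2)) (use assms eq in auto)
  then show "j = i" using assms by simp
qed

lemma finite_blocks:
  assumes "v' \<in> V (Suc m)" shows "finite (blocks m v')"
proof (rule inj_on_finite[of snd])
  show "inj_on snd (blocks m v')"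
  proof (rule inj_onI)
    fix a b assume ab: "a \<in> blocks m v'" "b \<in> blocks m v'" "snd a = snd b"
    obtain v i w where vw: "a = (v, i)" "b = (w, i)" using ab(3) by (metis prod.collapse)
    have "v \<in> V m" "w \<in> V m" using ab vw by (auto simp: blocks_def)
    then have "1 \<le> snd v" "1 \<le> snd w" using V_height by auto
    then show "a = b" using blocks_unique(1)[OF assms, of v i w i i] ab vw by simp
  qed
  show "snd ` blocks m v' \<subseteq> {..<snd v'}" by (auto simp: blocks_def Jset_def)
qed simp

text \<open>Row \<open>p\<close> belongs to the interval between the last visit of \<open>x\<close>
  to \<open>E m\<close> at or before \<open>p\<close> and the next visit after
  \<open>p\<close>.\<close>

lemma blocks_cover:
  assumes "v' \<in> V (Suc m)" "p < snd v'"
  shows "\<exists>v j. (v, j) \<in> blocks m v' \<and> j \<le> p \<and> p < j + snd v"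
proof -
  obtain x where x: "x \<in> fst v'" using V_nonempty_base assms(1) by blast
  define j where "j = Max {i. i \<le> p \<and> (T ^^ i) x \<in> E m}"
  have "(T ^^ 0) x \<in> E m" using V_level_E[OF assms(1) x, of 0] E_decr by auto
  then have ne: "{i. i \<le> p \<and> (T ^^ i) x \<in> E m} \<noteq> {}" by blast
  have fin: "finite {i. i \<le> p \<and> (T ^^ i) x \<in> E m}" by simp
  have j: "j \<le> p" "(T ^^ j) x \<in> E m" using Max_in[OF fin ne] by (auto simp: j_def)
  have jmax: "i \<le> j" if "i \<le> p" "(T ^^ i) x \<in> E m" for i
    unfolding j_def by (rule Max_ge) (use that in auto)
  define k where "k = (LEAST i. p < i \<and> (T ^^ i) x \<in> E m)"
  have ex: "p < snd v' \<and> (T ^^ snd v') x \<in> E m"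
    using V_level_E[OF assms(1) x, of "snd v'"] E_decr assms(2) by auto
  then have k: "p < k" "(T ^^ k) x \<in> E m" "k \<le> snd v'"
    unfolding k_def using LeastI[of "\<lambda>i. p < i \<and> (T ^^ i) x \<in> E m", OF ex]
    Least_le[of "\<lambda>i. p < i \<and> (T ^^ i) x \<in> E m", OF ex] by auto
  have kmin: "(T ^^ i) x \<notin> E m" if "p < i" "i < k" for i
    using not_less_Least[of i "\<lambda>i. p < i \<and> (T ^^ i) x \<in> E m"] that by (auto simp: k_def)
  have "ret m ((T ^^ j) x) (k - j)" unfolding ret_def
  proof (intro conjI ballI)
    show "(T ^^ (k - j)) ((T ^^ j) x) \<in> E m" using funpow_diff[of j k x] j k by simp
    fix i assume i: "i \<in> {1..<k - j}"
    have eq: "(T ^^ i) ((T ^^ j) x) = (T ^^ (i + j)) x" by (simp add: funpow_add)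
    show "(T ^^ i) ((T ^^ j) x) \<notin> E m"
    proof (cases "i + j \<le> p")
      case True
      then show ?thesis using jmax[of "i + j"] i eq by auto
    next
      case False
      moreover have "i + j < k" using i by auto
      ultimately show ?thesis using kmin[of "i + j"] eq by simp
    qed
  qed (use j k in auto)
  then have v: "(cyl m ((T ^^ j) x) (k - j), k - j) \<in> V m" by (rule ret_V)
  \<comment> \<open>The whole level lies in the base found from \<open>x\<close>, because points of
    the base of \<open>v'\<close> share their itinerary through the finer partition.\<close>
  have "level v' j \<subseteq> cyl m ((T ^^ j) x) (k - j)"
  proof
    fix z assume "z \<in> level v' j"
    then obtain w where w: "w \<in> fst v'" "z = (T ^^ j) w" by blast
    have "atom_eq m ((T ^^ i) ((T ^^ j) x)) ((T ^^ i) z)" if "i \<le> k - j" for i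
    proof -
      have "i + j \<le> snd v'" using that k j by simp
      from V_atom_eq[OF assms(1) x w(1) this]
      show ?thesis unfolding w(2) by (simp add: funpow_add atom_eq_Suc)
    qed
    then show "z \<in> cyl m ((T ^^ j) x) (k - j)" by (simp add: cyl_def)
  qed
  then have "((cyl m ((T ^^ j) x) (k - j), k - j), j) \<in> blocks m v'"
    using v j assms(2) by (simp add: blocks_def Jset_def)
  then show ?thesis using j k by (intro exI conjI) auto
qed

lemma j_n_blocks:
  assumes "v' \<in> V (Suc m)" "p < snd v'" "q < snd v'"
  shows "j_n T E P m a v' p q = (\<Sum>b\<in>blocks m v'.
     if snd b \<le> p \<and> snd b \<le> q \<and> p - snd b < snd (fst b) \<and> q - snd b < snd (fst b)
     then a (fst b) (p - snd b) (q - snd b) else 0)"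
proof -
  have eq: "blocks m v' = (SIGMA v:{v \<in> V m. Jset T v v' \<noteq> {}}. Jset T v v')"
    by (auto simp: blocks_def)
  have "{v \<in> V m. Jset T v v' \<noteq> {}} = fst ` blocks m v'" by (force simp: blocks_def)
  then have "finite {v \<in> V m. Jset T v v' \<noteq> {}}" using finite_blocks[OF assms(1)] by simp
  moreover have "finite (Jset T v v')" for v by (simp add: Jset_def)
  ultimately show ?thesis
    unfolding eq j_n_def using assms by (simp add: sum.Sigma case_prod_beta)
qed

lemma j_n_R: "j_n T E P m a \<in> R (Suc m)"
  by (auto simp: Rc_def j_n_def)

text \<open>Exactly one block covers row \<open>p\<close>. Read through that smaller tower,
  \<open>F\<close> gives the entry of \<open>c\<close> inside the block and 0 in columns outside it,
  which is what the sum in \<open>j_n\<close> produces.\<close>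

lemma repr_j_n:
  assumes "repr m F c" shows "repr (Suc m) F (j_n T E P m c)"
  unfolding repr_def
proof (intro ballI allI impI)
  fix v' x p q assume v': "v' \<in> V (Suc m)" "x \<in> fst v'" "p < snd v'"
  obtain v j where b: "(v, j) \<in> blocks m v'" "j \<le> p" "p < j + snd v" using blocks_cover v' by blast
  note bD = blocksD[OF v'(1) b(1) v'(2)]
  have "F (int p - q) ((T ^^ p) x) = F (int (p - j) - (q - int j)) ((T ^^ (p - j)) ((T ^^ j) x))"
    using b funpow_diff[of j p x] by (simp add: of_nat_diff)
  also have "\<dots> = (if 0 \<le> q - int j \<and> q - int j < int (snd v) then c v (p - j) (nat (q - int j)) else 0)"
    by (rule reprD[OF assms bD(1,2)]) (use b in auto)
  also have "\<dots> = (if 0 \<le> q \<and> q < int (snd v') then j_n T E P m c v' p (nat q) else 0)"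
  proof (cases "0 \<le> q \<and> q < int (snd v')")
    case True
    then obtain q' where q': "q = int q'" "q' < snd v'" by (metis nonneg_int_cases of_nat_less_iff)
    have "j_n T E P m c v' p q' = (\<Sum>b\<in>blocks m v'. if b = (v, j) then
        (if j \<le> q' \<and> q' - j < snd v then c v (p - j) (q' - j) else 0) else 0)"
      unfolding j_n_blocks[OF v'(1,3) q'(2)]
    proof (rule sum.cong)
      fix b' assume b': "b' \<in> blocks m v'"
      have uniq: "b' = (v, j)" if "snd b' \<le> p" "p - snd b' < snd (fst b')"
      proof -
        obtain w i where bw: "b' = (w, i)" by (cases b')
        have "p < i + snd w" using that bw by auto
        then show ?thesis
          using blocks_unique[OF v'(1) b'[unfolded bw] b(1), of p] b(2,3) that bw by simp
      qed
      show "(if snd b' \<le> p \<and> snd b' \<le> q' \<and> p - snd b' < snd (fst b') \<and> q' - snd b' < snd (fst b')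
          then c (fst b') (p - snd b') (q' - snd b') else 0) =
        (if b' = (v, j) then (if j \<le> q' \<and> q' - j < snd v then c v (p - j) (q' - j) else 0) else 0)"
      proof (cases "b' = (v, j)")
        case True
        then show ?thesis using b by simp
      next
        case False
        then have "\<not> (snd b' \<le> p \<and> p - snd b' < snd (fst b'))" using uniq by blast
        then show ?thesis using False by (simp only: if_False) (rule if_not_P, blast)
      qed
    qed simp
    also have "\<dots> = (if j \<le> q' \<and> q' - j < snd v then c v (p - j) (q' - j) else 0)"
      using finite_blocks[OF v'(1)] b(1) by simp
    finally show ?thesis using q' by (auto simp: nat_diff_distrib of_nat_diff)
  next
    case False
    then show ?thesis using bD(3) by auto
  qed
  finally show "F (int p - q) ((T ^^ p) x) =
    (if 0 \<le> q \<and> q < int (snd v') then j_n T E P m c v' p (nat q) else 0)" .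
qed

lemma jup_R: "c \<in> R m \<Longrightarrow> jup T E P m k c \<in> R (m + k)"
  by (cases k) (auto simp: j_n_R)

lemma repr_jup: "repr m F c \<Longrightarrow> repr (m + k) F (jup T E P m k c)"
  by (induction k) (auto simp: repr_j_n)

lemma jup_jup: "jup T E P (m + k) l (jup T E P m k c) = jup T E P m (k + l) c"
  by (induction l) (auto simp: add.assoc)

lemma jup_eq_comp: "repr m F c \<Longrightarrow> c \<in> R m \<Longrightarrow> jup T E P m k c = comp (m + k) F"
  by (rule repr_eq_comp) (auto intro: repr_jup jup_R)

text \<open>Here and in the next three lemmas both sides lie in the same ring and represent one
  kernel, so \<open>repr_unique\<close> identifies them.\<close>

lemma jup_add:
  fixes a b :: "('x, 'k::comm_semiring_1) RR"
  assumes "a \<in> R m" "b \<in> R m"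
  shows "jup T E P m k (R_add a b) = R_add (jup T E P m k a) (jup T E P m k b)"
proof -
  obtain F G where "repr m F a" "repr m G b" using repr_exists by metis
  then show ?thesis using assms
    by (intro repr_unique[of "m + k" "cp_add F G"]) (auto intro: repr_jup repr_add jup_R R_closed)
qed

lemma jup_smult:
  fixes a :: "('x, 'k::comm_semiring_1) RR"
  assumes "a \<in> R m" shows "jup T E P m k (R_smult c a) = R_smult c (jup T E P m k a)"
proof -
  obtain F where "repr m F a" using repr_exists by metis
  then show ?thesis using assms
    by (intro repr_unique[of "m + k" "cp_smult c F"]) (auto intro: repr_jup repr_smult jup_R R_closed)
qed

lemma jup_mult:
  fixes a b :: "('x, 'k::comm_semiring_1) RR"
  assumes "a \<in> R m" "b \<in> R m"
  shows "jup T E P m k (R_mult a b) = R_mult (jup T E P m k a) (jup T E P m k b)"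
proof -
  obtain F G where "repr m F a" "repr m G b" using repr_exists by metis
  then show ?thesis using assms
    by (intro repr_unique[of "m + k" "conv F G"]) (auto intro: repr_jup repr_conv jup_R R_closed)
qed

lemma jup_one: "jup T E P m k (R_one T E P m) = (R_one T E P (m + k) :: ('x, 'k::comm_semiring_1) RR)"
  by (rule repr_unique[OF repr_jup[OF repr_one] repr_one]) (auto intro: jup_R R_closed)

end

section \<open>The rank functions on the block matrix rings\<close>

context tower_system
begin

abbreviation wsum :: "nat \<Rightarrow> ('x set \<times> nat \<Rightarrow> real) \<Rightarrow> real" where
  "wsum n g \<equiv> infsum (\<lambda>v. measure \<mu> (fst v) * g v) (V n)"

abbreviation rk :: "nat \<Rightarrow> ('x, 'k::field) RR \<Rightarrow> real" where
  "rk \<equiv> rkR \<mu> T E P"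

text \<open>The bound by the height makes the weighted sum converge, by comparison with
  \<open>vol\<close>.\<close>

definition admissible :: "nat \<Rightarrow> ('x set \<times> nat \<Rightarrow> real) \<Rightarrow> bool" where
  "admissible n g \<longleftrightarrow> (\<forall>v\<in>V n. 0 \<le> g v \<and> g v \<le> real (snd v))"

lemma summable_wsum:
  assumes "admissible n g" shows "(\<lambda>v. measure \<mu> (fst v) * g v) summable_on V n"
  by (rule summable_on_comparison_test[OF summable_vol])
     (use assms in \<open>auto simp: vol_def admissible_def intro!: mult_left_mono\<close>)

lemma admissible_rank: "admissible n (\<lambda>v. real (mat_rank (snd v) (a v)))"
  by (simp add: admissible_def mat_rank_le_dim)

lemmas summable_rk = summable_wsum[OF admissible_rank]

lemma wsum_height: "wsum n (\<lambda>v. real (snd v)) = 1"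
  using infsum_vol[of n] unfolding vol_def .

lemma wsum_le_measure:
  assumes "\<And>v. v \<in> V n \<Longrightarrow> S v \<subseteq> {..<snd v}"
    and "\<And>v p. v \<in> V n \<Longrightarrow> p \<in> S v \<Longrightarrow> level v p \<subseteq> U" "U \<in> sets borel"
  shows "wsum n (\<lambda>v. real (card (S v))) \<le> measure \<mu> U"
proof (rule infsum_le_finite_sums)
  have "card (S v) \<le> snd v" if "v \<in> V n" for v
    using card_mono[OF _ assms(1)[OF that]] by simp
  then show "(\<lambda>v. measure \<mu> (fst v) * real (card (S v))) summable_on V n"
    by (intro summable_wsum) (simp add: admissible_def)
  fix F assume F: "finite F" "F \<subseteq> V n"
  show "(\<Sum>v\<in>F. measure \<mu> (fst v) * real (card (S v))) \<le> measure \<mu> U"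
    by (rule sum_levels_le[OF F]) (use assms F in blast)+
qed

lemma rk_nonneg [simp]: "0 \<le> rk n a"
  unfolding rkR_def by (rule infsum_nonneg) simp

lemma rk_mono:
  assumes "\<And>v. v \<in> V n \<Longrightarrow> mat_rank (snd v) (a v) \<le> mat_rank (snd v) (b v)"
  shows "rk n a \<le> rk n b"
  unfolding rkR_def using assms
  by (intro infsum_mono[OF summable_rk summable_rk] mult_left_mono) simp_all

lemma rk_add_le: "rk n (R_add a b) \<le> rk n a + rk n b"
proof -
  have "rk n a + rk n b = wsum n (\<lambda>v. real (mat_rank (snd v) (a v)) + real (mat_rank (snd v) (b v)))"
    unfolding rkR_def distrib_left by (rule infsum_add[symmetric, OF summable_rk summable_rk])
  moreover have "rk n (R_add a b) \<le> \<dots>" unfolding rkR_def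
  proof (rule infsum_mono[OF summable_rk])
    show "(\<lambda>v. measure \<mu> (fst v) * (real (mat_rank (snd v) (a v)) + real (mat_rank (snd v) (b v))))
      summable_on V n"
      unfolding distrib_left by (rule summable_on_add[OF summable_rk summable_rk])
    fix v
    have "mat_rank (snd v) (R_add a b v) \<le> mat_rank (snd v) (a v) + mat_rank (snd v) (b v)"
      unfolding R_add_def by (rule mat_rank_add_le)
    then have "real (mat_rank (snd v) (R_add a b v)) \<le>
        real (mat_rank (snd v) (a v)) + real (mat_rank (snd v) (b v))" by linarith
    then show "measure \<mu> (fst v) * real (mat_rank (snd v) (R_add a b v)) \<le>
       measure \<mu> (fst v) * (real (mat_rank (snd v) (a v)) + real (mat_rank (snd v) (b v)))"
      by (rule mult_left_mono) simp
  qed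
  ultimately show ?thesis by simp
qed

lemma rk_mult_le:
  "rk n (R_mult a b) \<le> rk n a" "rk n (R_mult a b) \<le> rk n b"
  unfolding R_mult_def by (rule rk_mono, rule mat_rank_mult_le)+

lemma rk_smult_le: "rk n (R_smult c a) \<le> rk n a"
  unfolding R_smult_def by (rule rk_mono, rule mat_rank_smult_le)

lemma rk_uminus: "rk n (R_smult (- 1) a) = rk n a"
proof (rule antisym[OF rk_smult_le])
  have "R_smult (- 1) (R_smult (- 1) a) = a" by (simp add: R_smult_def)
  then show "rk n a \<le> rk n (R_smult (- 1) a)" using rk_smult_le[of n "- 1" "R_smult (- 1) a"] by simp
qed

lemma rk_zero [simp]: "rk n (\<lambda>v i j. 0) = 0"
  unfolding rkR_def by simp

text \<open>Rank is at most the number of nonzero rows, and only rows whose level lies in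
  \<open>U\<close> occur. This is how a small set bounds a rank distance; \<open>U\<close> will be a
  \<open>halo\<close> or some \<open>E n\<close>.\<close>

lemma rk_le_measure:
  assumes "\<And>v p q. v \<in> V n \<Longrightarrow> p < snd v \<Longrightarrow> q < snd v \<Longrightarrow> a v p q \<noteq> 0 \<Longrightarrow> level v p \<subseteq> U"
    and "U \<in> sets borel"
  shows "rk n a \<le> measure \<mu> U"
proof -
  define S where "S v = {p. p < snd v \<and> (\<exists>q<snd v. a v p q \<noteq> 0)}" for v
  have S: "S v \<subseteq> {..<snd v}" for v by (auto simp: S_def)
  have c: "card (S v) \<le> snd v" for v using card_mono[OF _ S[of v]] by simp
  have "rk n a \<le> wsum n (\<lambda>v. real (card (S v)))" unfolding rkR_def
  proof (rule infsum_mono[OF summable_rk summable_wsum])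
    show "admissible n (\<lambda>v. real (card (S v)))" using c by (simp add: admissible_def)
    fix v
    show "measure \<mu> (fst v) * real (mat_rank (snd v) (a v)) \<le> measure \<mu> (fst v) * real (card (S v))"
      unfolding S_def using mat_rank_le_nonzero_rows[of "snd v" "a v"] by (intro mult_left_mono) auto
  qed
  also have "\<dots> \<le> measure \<mu> U"
    by (rule wsum_le_measure[OF S _ assms(2)]) (use assms(1) in \<open>unfold S_def mem_Collect_eq, blast\<close>)
  finally show ?thesis .
qed

subsection \<open>The connecting maps preserve the rank\<close>

text \<open>After exchanging the sums, a coarse tower \<open>v\<close> is weighted by the levels of
  finer towers that lie in its base. These levels are disjoint, so they weigh at most the measure of
  the base.\<close>

lemma wsum_blocks_le:
  assumes "admissible m g" "admissible (Suc m) (\<lambda>v'. \<Sum>b\<in>blocks m v'. g (fst b))"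
  shows "wsum (Suc m) (\<lambda>v'. \<Sum>b\<in>blocks m v'. g (fst b)) \<le> wsum m g"
proof (rule infsum_le_finite_sums[OF summable_wsum[OF assms(2)]])
  fix S assume S: "finite S" "S \<subseteq> V (Suc m)"
  \<comment> \<open>Finitely many fine towers contain only finitely many coarse ones, so the
    exchange is one of finite sums.\<close>
  define Vs where "Vs = (\<Union>v'\<in>S. fst ` blocks m v')"
  have fVs: "finite Vs" using S finite_blocks by (auto simp: Vs_def)
  have Vs: "Vs \<subseteq> V m" by (auto simp: Vs_def blocks_def)
  define J where "J v v' = {j. (v, j) \<in> blocks m v'}" for v v'
  have J: "J v v' \<subseteq> {..<snd v'}" for v v' by (auto simp: J_def blocks_def Jset_def)
  have fJ: "finite (J v v')" for v v' using finite_subset[OF J] by simp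
  have "(\<Sum>b\<in>blocks m v'. g (fst b)) = (\<Sum>v\<in>Vs. real (card (J v v')) * g v)" if "v' \<in> S" for v'
  proof -
    have "blocks m v' = (SIGMA v:Vs. J v v')" using that by (force simp: Vs_def J_def)
    then show ?thesis using fVs fJ by (simp add: sum.Sigma[symmetric] case_prod_beta'
      sum.Sigma[of Vs "\<lambda>v. J v v'" "\<lambda>v j. g v", simplified case_prod_beta', symmetric])
  qed
  then have "(\<Sum>v'\<in>S. measure \<mu> (fst v') * (\<Sum>b\<in>blocks m v'. g (fst b))) =
      (\<Sum>v'\<in>S. \<Sum>v\<in>Vs. g v * (measure \<mu> (fst v') * real (card (J v v'))))"
    by (intro sum.cong) (auto simp: sum_distrib_left mult_ac)
  also have "\<dots> = (\<Sum>v\<in>Vs. g v * (\<Sum>v'\<in>S. measure \<mu> (fst v') * real (card (J v v'))))"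
    unfolding sum_distrib_left by (rule sum.swap)
  also have "\<dots> \<le> (\<Sum>v\<in>Vs. g v * measure \<mu> (fst v))"
  proof (intro sum_mono mult_left_mono)
    fix v assume v: "v \<in> Vs"
    then have vV: "v \<in> V m" using Vs by blast
    then show "0 \<le> g v" using assms(1) by (simp add: admissible_def)
    show "(\<Sum>v'\<in>S. measure \<mu> (fst v') * real (card (J v v'))) \<le> measure \<mu> (fst v)"
    proof (rule sum_levels_le[OF S J])
      show "level v' j \<subseteq> fst v" if "j \<in> J v v'" for v' j
        using that by (simp add: J_def blocks_def Jset_def)
      show "fst v \<in> sets borel" using open_base[OF vV] by simp
    qed
  qed
  also have "\<dots> \<le> wsum m g" unfolding mult.commute[of "g _"]
    by (rule finite_sum_le_infsum[OF summable_wsum[OF assms(1)] fVs Vs])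
       (use assms(1) in \<open>auto simp: admissible_def simp del: split_paired_All\<close>)
  finally show "(\<Sum>v'\<in>S. measure \<mu> (fst v') * (\<Sum>b\<in>blocks m v'. g (fst b))) \<le> wsum m g" .
qed

text \<open>The row intervals occupied by the blocks tile \<open>{..<snd v'}\<close>.\<close>

lemma sum_blocks_height:
  assumes "v' \<in> V (Suc m)" shows "(\<Sum>b\<in>blocks m v'. snd (fst b)) = snd v'"
proof -
  have "{..<snd v'} = (\<Union>b\<in>blocks m v'. {snd b..<snd b + snd (fst b)})"
  proof (intro set_eqI iffI)
    fix p assume "p \<in> {..<snd v'}"
    then have "p < snd v'" by simp
    then obtain v j where "(v, j) \<in> blocks m v'" "j \<le> p" "p < j + snd v"
      using blocks_cover[OF assms] by blast
    then show "p \<in> (\<Union>b\<in>blocks m v'. {snd b..<snd b + snd (fst b)})" by (intro UN_I[of "(v, j)"]) auto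
  next
    fix p assume "p \<in> (\<Union>b\<in>blocks m v'. {snd b..<snd b + snd (fst b)})"
    then obtain v j where b: "(v, j) \<in> blocks m v'" "p < j + snd v" by auto
    obtain x where "x \<in> fst v'" using V_nonempty_base assms by blast
    from blocksD(3)[OF assms b(1) this] show "p \<in> {..<snd v'}" using b by simp
  qed
  then have "snd v' = card (\<Union>b\<in>blocks m v'. {snd b..<snd b + snd (fst b)})" by (metis card_lessThan)
  also have "\<dots> = (\<Sum>b\<in>blocks m v'. card {snd b..<snd b + snd (fst b)})"
  proof (rule card_UN_disjoint[OF finite_blocks[OF assms]])
    show "\<forall>i\<in>blocks m v'. \<forall>j\<in>blocks m v'. i \<noteq> j \<longrightarrow>
      {snd i..<snd i + snd (fst i)} \<inter> {snd j..<snd j + snd (fst j)} = {}"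
    proof (intro ballI impI)
      fix a b assume ab: "a \<in> blocks m v'" "b \<in> blocks m v'" "a \<noteq> b"
      obtain v i w j where vw: "a = (v, i)" "b = (w, j)" by (cases a, cases b)
      show "{snd a..<snd a + snd (fst a)} \<inter> {snd b..<snd b + snd (fst b)} = {}"
      proof (rule ccontr)
        assume "\<not> ?thesis"
        then obtain p where "p \<in> {snd a..<snd a + snd (fst a)} \<inter> {snd b..<snd b + snd (fst b)}" by blast
        then have "i \<le> p" "p < i + snd v" "j \<le> p" "p < j + snd w" by (simp_all add: vw)
        then show False using blocks_unique[OF assms ab(1,2)[unfolded vw], of p] ab(3) vw by simp
      qed
    qed
  qed simp
  finally show ?thesis by simp
qed

lemma admissible_blocks:
  assumes "admissible m g" shows "admissible (Suc m) (\<lambda>v'. \<Sum>b\<in>blocks m v'. g (fst b))"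
  unfolding admissible_def
proof (intro ballI conjI)
  fix v' assume v': "v' \<in> V (Suc m)"
  have g: "0 \<le> g (fst b) \<and> g (fst b) \<le> real (snd (fst b))" if "b \<in> blocks m v'" for b
  proof -
    have "fst b \<in> V m" using that by (auto simp: blocks_def)
    then show ?thesis using assms by (simp add: admissible_def)
  qed
  then show "0 \<le> (\<Sum>b\<in>blocks m v'. g (fst b))" by (simp add: sum_nonneg)
  have "(\<Sum>b\<in>blocks m v'. g (fst b)) \<le> (\<Sum>b\<in>blocks m v'. real (snd (fst b)))"
    by (rule sum_mono) (use g in blast)
  also have "\<dots> = real (snd v')" using sum_blocks_height[OF v'] by (metis of_nat_sum)
  finally show "(\<Sum>b\<in>blocks m v'. g (fst b)) \<le> real (snd v')" .
qed

text \<open>Both \<open>g\<close> and its complement \<open>|W| - g\<close> satisfy the inequality, and the two total to 1.\<close>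

lemma wsum_blocks:
  assumes g: "admissible m g"
  shows "wsum (Suc m) (\<lambda>v'. \<Sum>b\<in>blocks m v'. g (fst b)) = wsum m g"
proof -
  define h where "h v = real (snd v) - g v" for v
  have h: "admissible m h" using g by (simp add: admissible_def h_def)
  let ?B = "\<lambda>g v'. \<Sum>b\<in>blocks m v'. g (fst b)"
  have tot: "wsum n a + wsum n b = 1"
    if "admissible n a" "admissible n b" "\<And>v. v \<in> V n \<Longrightarrow> a v + b v = real (snd v)" for n a b
  proof -
    have "wsum n a + wsum n b = infsum (\<lambda>v. measure \<mu> (fst v) * a v + measure \<mu> (fst v) * b v) (V n)"
      by (rule infsum_add[symmetric, OF summable_wsum[OF that(1)] summable_wsum[OF that(2)]])
    also have "\<dots> = wsum n (\<lambda>v. real (snd v))"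
      by (rule infsum_cong) (use that(3) in \<open>simp flip: distrib_left\<close>)
    finally show ?thesis using wsum_height by simp
  qed
  have "wsum m g + wsum m h = 1" by (rule tot[OF g h]) (simp add: h_def)
  moreover have "wsum (Suc m) (?B g) + wsum (Suc m) (?B h) = 1"
  proof (rule tot[OF admissible_blocks[OF g] admissible_blocks[OF h]])
    fix v' assume "v' \<in> V (Suc m)"
    from sum_blocks_height[OF this] have "real (snd v') = (\<Sum>b\<in>blocks m v'. real (snd (fst b)))"
      by (metis of_nat_sum)
    then show "?B g v' + ?B h v' = real (snd v')" by (simp add: h_def sum_subtractf)
  qed
  moreover note wsum_blocks_le[OF g admissible_blocks[OF g]] wsum_blocks_le[OF h admissible_blocks[OF h]]
  ultimately show ?thesis by linarith
qed

text \<open>The rank of a block diagonal matrix is the sum over its blocks, and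
  \<open>wsum_blocks\<close> evaluates the resulting weighted sum at the coarser level.\<close>

lemma rk_j_n: "rk (Suc m) (j_n T E P m c) = rk m c"
proof -
  have "mat_rank (snd v') (j_n T E P m c v') = (\<Sum>b\<in>blocks m v'. mat_rank (snd (fst b)) (c (fst b)))"
    if v': "v' \<in> V (Suc m)" for v'
  proof (rule mat_rank_block_diag[OF finite_blocks[OF v'], where off = snd])
    obtain x where x: "x \<in> fst v'" using V_nonempty_base v' by blast
    show "snd b + snd (fst b) \<le> snd v'" if "b \<in> blocks m v'" for b
      using blocksD(3)[OF v' _ x, of "fst b" "snd b"] that by simp
    show "b = b'" if "b \<in> blocks m v'" "b' \<in> blocks m v'" "snd b \<le> p" "p < snd b + snd (fst b)"
      "snd b' \<le> p" "p < snd b' + snd (fst b')" for b b' p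
    proof -
      have "fst b = fst b'" "snd b = snd b'"
        using blocks_unique[OF v', of "fst b" "snd b" "fst b'" "snd b'" p] that
        unfolding prod.collapse by blast+
      then show ?thesis by (rule prod_eqI)
    qed
  qed (rule j_n_blocks[OF v'])
  then have "rk (Suc m) (j_n T E P m c) =
      wsum (Suc m) (\<lambda>v'. \<Sum>b\<in>blocks m v'. real (mat_rank (snd (fst b)) (c (fst b))))"
    unfolding rkR_def by (intro infsum_cong) simp
  also have "\<dots> = rk m c"
    unfolding rkR_def by (rule wsum_blocks[OF admissible_rank])
  finally show ?thesis .
qed

lemma rk_jup: "rk (m + k) (jup T E P m k c) = rk m c"
  by (induction k) (auto simp: rk_j_n)

subsection \<open>Counting visits\<close>

text \<open>A lower bound from an upper bound: the levels in the complement of \<open>U\<close>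
  weigh at most its measure, and all levels together weigh 1, so the rest must lie in
  \<open>U\<close>.\<close>

lemma wsum_visits_ge:
  assumes U: "U \<in> sets borel"
    and dich: "\<And>v p. v \<in> V n \<Longrightarrow> p < snd v \<Longrightarrow> level v p \<subseteq> U \<or> level v p \<subseteq> - U"
  shows "measure \<mu> U \<le> wsum n (\<lambda>v. real (card {p. p < snd v \<and> level v p \<subseteq> U}))"
proof -
  let ?A = "\<lambda>v. {p. p < snd v \<and> level v p \<subseteq> U}" and ?B = "\<lambda>v. {p. p < snd v \<and> level v p \<subseteq> - U}"
  have card_le: "card {p. p < snd v \<and> Q p} \<le> snd v" for v :: "'x set \<times> nat" and Q
    using card_mono[of "{..<snd v}" "{p. p < snd v \<and> Q p}"] by force
  have adm: "admissible n (\<lambda>v. real (card (?A v)))" "admissible n (\<lambda>v. real (card (?B v)))"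
    using card_le by (simp_all add: admissible_def)
  have "card (?A v) + card (?B v) = snd v" if v: "v \<in> V n" for v
  proof -
    have "fst v \<noteq> {}" using V_nonempty_base[OF v] by blast
    then have "?A v \<inter> ?B v = {}" by blast
    moreover have "?A v \<union> ?B v = {..<snd v}" using dich[OF v] by blast
    ultimately show ?thesis by (metis (no_types, lifting) card_Un_disjoint card_lessThan finite_Un finite_lessThan)
  qed
  then have "1 = infsum (\<lambda>v. measure \<mu> (fst v) * real (card (?A v)) + measure \<mu> (fst v) * real (card (?B v))) (V n)"
    unfolding wsum_height[of n, symmetric] distrib_left[symmetric]
    by (intro infsum_cong) (simp flip: of_nat_add)
  also have "\<dots> = wsum n (\<lambda>v. real (card (?A v))) + wsum n (\<lambda>v. real (card (?B v)))"
    by (rule infsum_add[OF summable_wsum[OF adm(1)] summable_wsum[OF adm(2)]])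
  finally have 1: "1 = \<dots>" .
  have "wsum n (\<lambda>v. real (card (?B v))) \<le> measure \<mu> (- U)"
    by (rule wsum_le_measure) (use U in \<open>auto simp: borel_comp\<close>)
  moreover have "measure \<mu> (- U) = 1 - measure \<mu> U"
    using prob_compl[of U] U mu_sets by (simp add: Compl_eq_Diff_UNIV)
  ultimately show ?thesis using 1 by linarith
qed

text \<open>A defect of \<open>d\<close> in each tower costs \<open>d\<close> times the total
  measure of the bases, which are disjoint subsets of \<open>E n\<close>.\<close>

lemma rk_ge_visits:
  assumes U: "U \<in> sets borel"
    and dich: "\<And>v p. v \<in> V n \<Longrightarrow> p < snd v \<Longrightarrow> level v p \<subseteq> U \<or> level v p \<subseteq> - U"
    and rank: "\<And>v. v \<in> V n \<Longrightarrow> card {p. p < snd v \<and> level v p \<subseteq> U} \<le> mat_rank (snd v) (a v) + d"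
  shows "measure \<mu> U - real d * measure \<mu> (E n) \<le> rk n a"
proof -
  let ?A = "\<lambda>v. {p. p < snd v \<and> level v p \<subseteq> U}"
  have "card (?A v) \<le> snd v" for v using card_mono[of "{..<snd v}" "?A v"] by force
  then have adm: "admissible n (\<lambda>v. real (card (?A v)))" by (simp add: admissible_def)
  have "admissible n (\<lambda>v. 1)" using V_height by (force simp: admissible_def simp del: split_paired_All)
  from summable_wsum[OF this] have s1: "(\<lambda>v. measure \<mu> (fst v)) summable_on V n" by simp
  have sd: "(\<lambda>v. measure \<mu> (fst v) * real d) summable_on V n"
    using s1 by (rule summable_on_cmult_left)
  have "wsum n (\<lambda>v. real (card (?A v))) \<le>
      infsum (\<lambda>v. measure \<mu> (fst v) * real (mat_rank (snd v) (a v)) + measure \<mu> (fst v) * real d) (V n)"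
  proof (rule infsum_mono[OF summable_wsum[OF adm] summable_on_add[OF summable_rk sd]])
    fix v assume "v \<in> V n"
    from rank[OF this] have "real (card (?A v)) \<le> real (mat_rank (snd v) (a v)) + real d" by linarith
    then show "measure \<mu> (fst v) * real (card (?A v)) \<le>
        measure \<mu> (fst v) * real (mat_rank (snd v) (a v)) + measure \<mu> (fst v) * real d"
      unfolding distrib_left[symmetric] by (rule mult_left_mono) simp
  qed
  also have "\<dots> = rk n a + wsum n (\<lambda>v. real d)"
    unfolding rkR_def by (rule infsum_add[OF summable_rk sd])
  also have "wsum n (\<lambda>v. real d) = infsum (\<lambda>v. measure \<mu> (fst v)) (V n) * real d"
    by (rule infsum_cmult_left) (use s1 in blast)
  also have "infsum (\<lambda>v. measure \<mu> (fst v)) (V n) \<le> measure \<mu> (E n)"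
  proof -
    have "wsum n (\<lambda>v. real (card {0::nat})) \<le> measure \<mu> (E n)"
    proof (rule wsum_le_measure[OF _ _ borel_E])
      fix v assume v: "v \<in> V n"
      show "{0} \<subseteq> {..<snd v}" using V_height[OF v] by simp
      show "level v p \<subseteq> E n" if "p \<in> {0}" for p
        using that V_level_E[OF v, of _ 0] by auto
    qed
    then show ?thesis by simp
  qed
  finally have "wsum n (\<lambda>v. real (card (?A v))) \<le> rk n a + measure \<mu> (E n) * real d"
    by (simp add: mult_right_mono)
  then show ?thesis using wsum_visits_ge[OF U, of n] dich by (simp add: mult.commute)
qed

end

section \<open>The direct limit and its rank completion\<close>

context tower_system
begin

section \<open>The rank pseudometric on pairs (level, matrix)\<close>

definition valid :: "nat \<times> ('x, 'k::field) RR \<Rightarrow> bool" where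
  "valid z \<longleftrightarrow> snd z \<in> R (fst z)"

abbreviation sub :: "('x, 'k::field) RR \<Rightarrow> ('x, 'k) RR \<Rightarrow> ('x, 'k) RR" where
  "sub a b \<equiv> R_add a (R_smult (- 1) b)"

abbreviation lift :: "nat \<times> ('x, 'k::field) RR \<Rightarrow> nat \<Rightarrow> ('x, 'k) RR" where
  "lift \<equiv> lv T E P"

abbreviation dd :: "nat \<times> ('x, 'k::field) RR \<Rightarrow> nat \<times> ('x, 'k) RR \<Rightarrow> real" where
  "dd \<equiv> dinf \<mu> T E P"

lemma lift_R: "valid z \<Longrightarrow> fst z \<le> M \<Longrightarrow> lift z M \<in> R M"
  unfolding lv_def valid_def using jup_R[of "snd z" "fst z" "M - fst z"] by simp

lemma lift_self [simp]: "lift (M, c) M = c" "lift z (fst z) = snd z"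
  by (simp_all add: lv_def)

lemma lift_lift: "fst z \<le> N \<Longrightarrow> N \<le> M \<Longrightarrow> lift (N, lift z N) M = lift z M"
  unfolding lv_def using jup_jup[of "fst z" "N - fst z" "M - N" "snd z"] by simp

lemma rk_lift: "fst z \<le> M \<Longrightarrow> rk M (lift z M) = rk (fst z) (snd z)"
  unfolding lv_def using rk_jup[of "fst z" "M - fst z" "snd z"] by simp

lemma lift_add:
  assumes "a \<in> R N" "b \<in> R N"
  shows "lift (N, R_add a b) M = R_add (lift (N, a) M) (lift (N, b) M)"
  unfolding lv_def using jup_add[OF assms, of "M - N"] by simp

lemma lift_smult:
  assumes "a \<in> R N" shows "lift (N, R_smult c a) M = R_smult c (lift (N, a) M)"
  unfolding lv_def using jup_smult[OF assms, of "M - N" c] by simp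

lemma lift_mult:
  assumes "a \<in> R N" "b \<in> R N"
  shows "lift (N, R_mult a b) M = R_mult (lift (N, a) M) (lift (N, b) M)"
  unfolding lv_def using jup_mult[OF assms, of "M - N"] by simp

text \<open>The connecting maps are linear and preserve rank, so every common level gives the same
  distance; \<open>dinf\<close> itself uses the lowest one.\<close>

lemma dd_at:
  assumes "valid z" "valid w" "fst z \<le> M" "fst w \<le> M"
  shows "dd z w = rk M (sub (lift z M) (lift w M))"
proof -
  let ?m = "max (fst z) (fst w)"
  have z: "lift z ?m \<in> R ?m" and w: "lift w ?m \<in> R ?m" using assms by (auto intro: lift_R)
  have "lift (?m, sub (lift z ?m) (lift w ?m)) M = sub (lift z M) (lift w M)"
    using z w assms by (simp add: lift_add lift_smult R_closed lift_lift)
  moreover have "rk M (lift (?m, sub (lift z ?m) (lift w ?m)) M) = rk ?m (sub (lift z ?m) (lift w ?m))"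
    using rk_lift[of "(?m, sub (lift z ?m) (lift w ?m))" M] assms by simp
  ultimately show ?thesis unfolding dinf_def by (simp add: Let_def)
qed

lemma dd_nonneg [simp]: "0 \<le> dd z w"
  by (simp add: dinf_def Let_def)

lemma sub_self: "sub a a = (\<lambda>v i j. 0)"
  by (simp add: R_add_def R_smult_def)

lemma dd_self [simp]: "dd z z = 0"
  by (simp add: dinf_def Let_def sub_self)

lemma dd_sym: "dd z w = dd w z"
proof -
  have "rk m (sub a b) = rk m (sub b a)" for m and a b :: "('x, 'k::field) RR"
  proof -
    have "sub a b = R_smult (- 1) (sub b a)" by (simp add: R_add_def R_smult_def)
    then show ?thesis using rk_uminus[of m "sub b a"] by (simp only:)
  qed
  then show ?thesis unfolding dinf_def Let_def by (simp add: max.commute)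
qed

lemma dd_triangle:
  assumes "valid z" "valid u" "valid w" shows "dd z w \<le> dd z u + dd u w"
proof -
  define M where "M = max (fst z) (max (fst u) (fst w))"
  have M: "fst z \<le> M" "fst u \<le> M" "fst w \<le> M" by (auto simp: M_def)
  have "sub (lift z M) (lift w M) = R_add (sub (lift z M) (lift u M)) (sub (lift u M) (lift w M))"
    by (auto simp: R_add_def R_smult_def intro!: ext)
  then show ?thesis
    using rk_add_le[of M "sub (lift z M) (lift u M)" "sub (lift u M) (lift w M)"]
      dd_at[OF assms(1,3) M(1,3)] dd_at[OF assms(1,2) M(1,2)] dd_at[OF assms(2,3) M(2,3)] by simp
qed

text \<open>Subadditivity makes the rank 1-Lipschitz; this is what lets it extend to the
  completion.\<close>

lemma rk_diff_le_dd:
  assumes "valid z" "valid w"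
  shows "\<bar>rk (fst z) (snd z) - rk (fst w) (snd w)\<bar> \<le> dd z w"
proof -
  have *: "rk (fst z) (snd z) \<le> rk (fst w) (snd w) + dd z w"
    if "valid z" "valid w" for z w :: "nat \<times> ('x, 'k::field) RR"
  proof -
    define M where "M = max (fst z) (fst w)"
    have M: "fst z \<le> M" "fst w \<le> M" by (auto simp: M_def)
    have "lift z M = R_add (lift w M) (sub (lift z M) (lift w M))"
      by (auto simp: R_add_def R_smult_def intro!: ext)
    then have "rk M (lift z M) \<le> rk M (lift w M) + rk M (sub (lift z M) (lift w M))"
      using rk_add_le[of M "lift w M" "sub (lift z M) (lift w M)"] by simp
    then show ?thesis unfolding rk_lift[OF M(1)] rk_lift[OF M(2)] dd_at[OF that M] .
  qed
  show ?thesis using *[OF assms] *[OF assms(2,1)] dd_sym[of z w] by linarith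
qed

section \<open>Ring operations on pairs and their Lipschitz bounds\<close>

definition zop :: "(('x, 'k::field) RR \<Rightarrow> ('x, 'k) RR \<Rightarrow> ('x, 'k) RR)
    \<Rightarrow> nat \<times> ('x, 'k) RR \<Rightarrow> nat \<times> ('x, 'k) RR \<Rightarrow> nat \<times> ('x, 'k) RR" where
  "zop f z w = (max (fst z) (fst w), f (lift z (max (fst z) (fst w))) (lift w (max (fst z) (fst w))))"

definition zsmult :: "'k::field \<Rightarrow> nat \<times> ('x, 'k) RR \<Rightarrow> nat \<times> ('x, 'k) RR" where
  "zsmult c z = (fst z, R_smult c (snd z))"

lemma seq_op_zop: "seq_op T E P f s t = (\<lambda>k. zop f (s k) (t k))"
  by (simp add: seq_op_def zop_def Let_def)

lemma fst_zop [simp]: "fst (zop f z w) = max (fst z) (fst w)"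
  by (simp add: zop_def)

lemma fst_zsmult [simp]: "fst (zsmult c z) = fst z"
  by (simp add: zsmult_def)

lemma valid_zop:
  assumes "valid z" "valid w"
  shows "valid (zop R_add z w)" "valid (zop R_mult z w)"
  using assms by (simp_all add: valid_def zop_def lift_R[unfolded valid_def] R_closed)

lemma valid_zsmult: "valid z \<Longrightarrow> valid (zsmult c z)"
  by (simp add: valid_def zsmult_def R_closed)

lemma lift_zop:
  assumes "valid z" "valid w" "fst z \<le> M" "fst w \<le> M"
  shows "lift (zop R_add z w) M = R_add (lift z M) (lift w M)"
    and "lift (zop R_mult z w) M = R_mult (lift z M) (lift w M)"
proof -
  let ?m = "max (fst z) (fst w)"
  have "lift z ?m \<in> R ?m" "lift w ?m \<in> R ?m" using assms by (auto intro: lift_R)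
  then show "lift (zop R_add z w) M = R_add (lift z M) (lift w M)"
    and "lift (zop R_mult z w) M = R_mult (lift z M) (lift w M)"
    unfolding zop_def using assms by (simp_all add: lift_add lift_mult lift_lift)
qed

lemma lift_zsmult: "valid z \<Longrightarrow> lift (zsmult c z) M = R_smult c (lift z M)"
  unfolding zsmult_def valid_def using lift_smult[of "snd z" "fst z" c M] by (simp add: lv_def)

lemma dd_zadd:
  assumes "valid z" "valid w" "valid z'" "valid w'"
  shows "dd (zop R_add z w) (zop R_add z' w') \<le> dd z z' + dd w w'"
proof -
  define M where "M = max (max (fst z) (fst w)) (max (fst z') (fst w'))"
  have M: "fst z \<le> M" "fst w \<le> M" "fst z' \<le> M" "fst w' \<le> M" by (auto simp: M_def)
  have "dd (zop R_add z w) (zop R_add z' w') =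
      rk M (sub (R_add (lift z M) (lift w M)) (R_add (lift z' M) (lift w' M)))"
    using assms M by (subst dd_at[of _ _ M]) (auto simp: valid_zop lift_zop)
  also have "sub (R_add (lift z M) (lift w M)) (R_add (lift z' M) (lift w' M)) =
      R_add (sub (lift z M) (lift z' M)) (sub (lift w M) (lift w' M))"
    by (auto simp: R_add_def R_smult_def intro!: ext)
  also have "rk M \<dots> \<le> rk M (sub (lift z M) (lift z' M)) + rk M (sub (lift w M) (lift w' M))"
    by (rule rk_add_le)
  finally show ?thesis using dd_at[OF assms(1,3) M(1,3)] dd_at[OF assms(2,4) M(2,4)] by simp
qed

text \<open>The difference is split as \<open>(z - z') w + z' (w - w')\<close>, and a product has at
  most the rank of either factor.\<close>

lemma dd_zmult:
  assumes "valid z" "valid w" "valid z'" "valid w'"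
  shows "dd (zop R_mult z w) (zop R_mult z' w') \<le> dd z z' + dd w w'"
proof -
  define M where "M = max (max (fst z) (fst w)) (max (fst z') (fst w'))"
  have M: "fst z \<le> M" "fst w \<le> M" "fst z' \<le> M" "fst w' \<le> M" by (auto simp: M_def)
  have "dd (zop R_mult z w) (zop R_mult z' w') =
      rk M (sub (R_mult (lift z M) (lift w M)) (R_mult (lift z' M) (lift w' M)))"
    using assms M by (subst dd_at[of _ _ M]) (auto simp: valid_zop lift_zop)
  also have "sub (R_mult (lift z M) (lift w M)) (R_mult (lift z' M) (lift w' M)) =
      R_add (R_mult (sub (lift z M) (lift z' M)) (lift w M)) (R_mult (lift z' M) (sub (lift w M) (lift w' M)))"
    by (auto simp: R_add_def R_smult_def R_mult_def algebra_simps sum_subtractf sum.distrib sum_negf intro!: ext)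
  also have "rk M \<dots> \<le> rk M (R_mult (sub (lift z M) (lift z' M)) (lift w M)) +
      rk M (R_mult (lift z' M) (sub (lift w M) (lift w' M)))"
    by (rule rk_add_le)
  also have "\<dots> \<le> rk M (sub (lift z M) (lift z' M)) + rk M (sub (lift w M) (lift w' M))"
    by (intro add_mono rk_mult_le)
  finally show ?thesis using dd_at[OF assms(1,3) M(1,3)] dd_at[OF assms(2,4) M(2,4)] by simp
qed

lemma dd_zsmult:
  assumes "valid z" "valid z'" shows "dd (zsmult c z) (zsmult c z') \<le> dd z z'"
proof -
  define M where "M = max (fst z) (fst z')"
  have M: "fst z \<le> M" "fst z' \<le> M" by (auto simp: M_def)
  have "dd (zsmult c z) (zsmult c z') = rk M (sub (R_smult c (lift z M)) (R_smult c (lift z' M)))"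
    using assms M by (subst dd_at[of _ _ M]) (auto simp: valid_zsmult lift_zsmult)
  also have "sub (R_smult c (lift z M)) (R_smult c (lift z' M)) = R_smult c (sub (lift z M) (lift z' M))"
    by (auto simp: R_add_def R_smult_def algebra_simps intro!: ext)
  also have "rk M \<dots> \<le> rk M (sub (lift z M) (lift z' M))" by (rule rk_smult_le)
  finally show ?thesis using dd_at[OF assms M] by simp
qed

text \<open>Scalar multiplication in the form of a binary operation, so that
  \<open>cauchy_binary\<close> and \<open>cl_binary\<close> cover it as well.\<close>

lemma dd_zsmult_add:
  assumes "valid z" "valid w" "valid z'" "valid w'"
  shows "dd (zsmult c z) (zsmult c z') \<le> dd z z' + dd w w'"
  using dd_zsmult[OF assms(1,3), of c] dd_nonneg[of w w'] by linarith

subsection \<open>Cauchy sequences and their classes\<close>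

type_synonym ('y, 'l) zseq = "nat \<Rightarrow> nat \<times> ('y, 'l) RR"

abbreviation cauchy :: "('x, 'k::field) zseq \<Rightarrow> bool" where "cauchy \<equiv> cauchy_R \<mu> T E P"
abbreviation cl :: "('x, 'k::field) zseq \<Rightarrow> ('x, 'k) zseq set" where "cl \<equiv> cls \<mu> T E P"

lemma cauchy_iff:
  "cauchy s \<longleftrightarrow> (\<forall>k. valid (s k)) \<and> (\<forall>\<epsilon>>0. \<exists>N. \<forall>p\<ge>N. \<forall>q\<ge>N. dd (s p) (s q) < \<epsilon>)"
  unfolding cauchy_R_def valid_def ..

lemma cauchy_valid: "cauchy s \<Longrightarrow> valid (s k)"
  by (simp add: cauchy_iff)

lemma cauchyD: "cauchy s \<Longrightarrow> \<epsilon> > 0 \<Longrightarrow> \<exists>N. \<forall>p\<ge>N. \<forall>q\<ge>N. dd (s p) (s q) < \<epsilon>"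
  by (simp add: cauchy_iff)

lemma in_cl: "t \<in> cl s \<longleftrightarrow> cauchy t \<and> (\<lambda>k. dd (s k) (t k)) \<longlonglongrightarrow> 0"
  by (simp add: cls_def)

lemma self_in_cl: "cauchy s \<Longrightarrow> s \<in> cl s"
  by (simp add: in_cl)

lemma dd_tendsto_trans:
  assumes "\<And>k. valid (s k)" "\<And>k. valid (t k)" "\<And>k. valid (u k)"
    and "(\<lambda>k. dd (s k) (t k)) \<longlonglongrightarrow> 0" "(\<lambda>k. dd (t k) (u k)) \<longlonglongrightarrow> 0"
  shows "(\<lambda>k. dd (s k) (u k)) \<longlonglongrightarrow> 0"
proof (rule tendsto_sandwich[OF _ _ tendsto_const])
  show "(\<lambda>k. dd (s k) (t k) + dd (t k) (u k)) \<longlonglongrightarrow> 0" using tendsto_add[OF assms(4,5)] by simp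
qed (use dd_triangle[OF assms(1,2,3)] in auto)

lemma cl_eqI:
  assumes "cauchy s" "cauchy t" "(\<lambda>k. dd (s k) (t k)) \<longlonglongrightarrow> 0"
  shows "cl s = cl t"
proof -
  have sub: "cl s \<subseteq> cl t" if "cauchy s" "cauchy t" "(\<lambda>k. dd (s k) (t k)) \<longlonglongrightarrow> 0"
    for s t :: "('x, 'k::field) zseq"
  proof
    fix u assume "u \<in> cl s"
    then have u: "cauchy u" "(\<lambda>k. dd (s k) (u k)) \<longlonglongrightarrow> 0" by (auto simp: in_cl)
    have "(\<lambda>k. dd (t k) (s k)) \<longlonglongrightarrow> 0" using that(3) unfolding dd_sym[of "s _"] .
    then have "(\<lambda>k. dd (t k) (u k)) \<longlonglongrightarrow> 0"
      using dd_tendsto_trans[of t s u] that u cauchy_valid by blast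
    then show "u \<in> cl t" using u by (simp add: in_cl)
  qed
  have "(\<lambda>k. dd (t k) (s k)) \<longlonglongrightarrow> 0" using assms(3) unfolding dd_sym[of "s _"] .
  then show ?thesis using sub[OF assms] sub[OF assms(2,1)] by blast
qed

lemma cl_eqD: "cauchy t \<Longrightarrow> cl s = cl t \<Longrightarrow> (\<lambda>k. dd (s k) (t k)) \<longlonglongrightarrow> 0"
  using self_in_cl[of t] by (metis in_cl)

lemma rep_cl:
  assumes "cauchy s"
  shows "cauchy (rep (cl s))" "(\<lambda>k. dd (s k) (rep (cl s) k)) \<longlonglongrightarrow> 0"
proof -
  have "rep (cl s) \<in> cl s" unfolding rep_def using self_in_cl[OF assms] by (rule someI[of "\<lambda>t. t \<in> cl s"])
  then show "cauchy (rep (cl s))" "(\<lambda>k. dd (s k) (rep (cl s) k)) \<longlonglongrightarrow> 0" by (simp_all add: in_cl)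
qed

lemma cauchy_binary:
  assumes v: "\<And>z w. valid z \<Longrightarrow> valid w \<Longrightarrow> valid (f z w)"
    and d: "\<And>z w z' w'. valid z \<Longrightarrow> valid w \<Longrightarrow> valid z' \<Longrightarrow> valid w' \<Longrightarrow>
        dd (f z w) (f z' w') \<le> dd z z' + dd w w'"
    and s: "cauchy s" and t: "cauchy t"
  shows "cauchy (\<lambda>k. f (s k) (t k))"
  unfolding cauchy_iff
proof (intro conjI allI impI)
  fix e :: real assume "e > 0"
  then have e: "e / 2 > 0" by simp
  obtain N where N: "\<forall>p\<ge>N. \<forall>q\<ge>N. dd (s p) (s q) < e / 2" using cauchyD[OF s e] by blast
  obtain M where M: "\<forall>p\<ge>M. \<forall>q\<ge>M. dd (t p) (t q) < e / 2" using cauchyD[OF t e] by blast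
  have "dd (f (s p) (t p)) (f (s q) (t q)) < e" if "p \<ge> max N M" "q \<ge> max N M" for p q
  proof -
    have "dd (s p) (s q) < e / 2" "dd (t p) (t q) < e / 2" using N M that by auto
    then show ?thesis
      using d[of "s p" "t p" "s q" "t q"] cauchy_valid[OF s] cauchy_valid[OF t] by fastforce
  qed
  then show "\<exists>N. \<forall>p\<ge>N. \<forall>q\<ge>N. dd (f (s p) (t p)) (f (s q) (t q)) < e" by blast
qed (rule v[OF cauchy_valid[OF s] cauchy_valid[OF t]])

text \<open>The operations of the completion act on representatives picked by choice; the Lipschitz
  bound makes the resulting class independent of them, so any Cauchy representative may be
  used.\<close>

lemma cl_binary:
  assumes v: "\<And>z w. valid z \<Longrightarrow> valid w \<Longrightarrow> valid (f z w)"
    and d: "\<And>z w z' w'. valid z \<Longrightarrow> valid w \<Longrightarrow> valid z' \<Longrightarrow> valid w' \<Longrightarrow>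
        dd (f z w) (f z' w') \<le> dd z z' + dd w w'"
    and s: "cauchy s" and t: "cauchy t"
  shows "cl (\<lambda>k. f (rep (cl s) k) (rep (cl t) k)) = cl (\<lambda>k. f (s k) (t k))"
proof (rule sym, rule cl_eqI)
  show "cauchy (\<lambda>k. f (s k) (t k))" by (rule cauchy_binary[OF v d s t])
  show "cauchy (\<lambda>k. f (rep (cl s) k) (rep (cl t) k))"
    by (rule cauchy_binary[OF v d rep_cl(1)[OF s] rep_cl(1)[OF t]])
  show "(\<lambda>k. dd (f (s k) (t k)) (f (rep (cl s) k) (rep (cl t) k))) \<longlonglongrightarrow> 0"
  proof (rule tendsto_sandwich[OF _ _ tendsto_const])
    show "(\<lambda>k. dd (s k) (rep (cl s) k) + dd (t k) (rep (cl t) k)) \<longlonglongrightarrow> 0"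
      using tendsto_add[OF rep_cl(2)[OF s] rep_cl(2)[OF t]] by simp
    show "\<forall>\<^sub>F k in sequentially. dd (f (s k) (t k)) (f (rep (cl s) k) (rep (cl t) k))
        \<le> dd (s k) (rep (cl s) k) + dd (t k) (rep (cl t) k)"
      by (intro always_eventually allI d cauchy_valid[OF s] cauchy_valid[OF t]
        cauchy_valid[OF rep_cl(1)[OF s]] cauchy_valid[OF rep_cl(1)[OF t]])
  qed simp
qed

lemma cauchy_add: "cauchy s \<Longrightarrow> cauchy t \<Longrightarrow> cauchy (\<lambda>k. zop R_add (s k) (t k))"
  by (rule cauchy_binary[OF valid_zop(1) dd_zadd])

lemma cauchy_mult: "cauchy s \<Longrightarrow> cauchy t \<Longrightarrow> cauchy (\<lambda>k. zop R_mult (s k) (t k))"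
  by (rule cauchy_binary[OF valid_zop(2) dd_zmult])

lemma cauchy_smult: "cauchy s \<Longrightarrow> cauchy (\<lambda>k. zsmult c (s k))"
  by (rule cauchy_binary[OF _ dd_zsmult_add]) (rule valid_zsmult)

lemma Rrk_add_cl:
  assumes "cauchy s" "cauchy t"
  shows "Rrk_add \<mu> T E P (cl s) (cl t) = cl (\<lambda>k. zop R_add (s k) (t k))"
  unfolding Rrk_add_def seq_op_zop by (rule cl_binary[OF valid_zop(1) dd_zadd assms])

lemma Rrk_mult_cl:
  assumes "cauchy s" "cauchy t"
  shows "Rrk_mult \<mu> T E P (cl s) (cl t) = cl (\<lambda>k. zop R_mult (s k) (t k))"
  unfolding Rrk_mult_def seq_op_zop by (rule cl_binary[OF valid_zop(2) dd_zmult assms])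

lemma Rrk_smult_cl:
  assumes "cauchy s" shows "Rrk_smult \<mu> T E P c (cl s) = cl (\<lambda>k. zsmult c (s k))"
  unfolding Rrk_smult_def zsmult_def[symmetric]
  by (rule cl_binary[OF _ dd_zsmult_add assms assms]) (rule valid_zsmult)

lemma Rrk_sub_cl:
  assumes "cauchy s" "cauchy t"
  shows "Rrk_sub \<mu> T E P (cl s) (cl t) = cl (\<lambda>k. zop R_add (s k) (zsmult (- 1) (t k)))"
  unfolding Rrk_sub_def Rrk_smult_cl[OF assms(2)] by (rule Rrk_add_cl[OF assms(1) cauchy_smult[OF assms(2)]])

text \<open>The definition of \<open>rkC\<close> takes the limit along a chosen representative. It
  exists because ranks along a Cauchy sequence are Cauchy, and an equivalent sequence has the same
  limit because ranks differ by at most the distance.\<close>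

lemma rkC_cl:
  assumes "cauchy s"
  shows "(\<lambda>k. rk (fst (s k)) (snd (s k))) \<longlonglongrightarrow> rkC \<mu> T E P (cl s)"
proof -
  define r where "r = rep (cl s)"
  define f where "f k = rk (fst (r k)) (snd (r k))" for k
  have r: "cauchy r" and lim: "(\<lambda>k. dd (s k) (r k)) \<longlonglongrightarrow> 0"
    unfolding r_def by (rule rep_cl[OF assms])+
  have "Cauchy f"
  proof (rule metric_CauchyI)
    fix e :: real assume "e > 0"
    then obtain N where N: "\<forall>p\<ge>N. \<forall>q\<ge>N. dd (r p) (r q) < e" using cauchyD[OF r] by metis
    have "dist (f p) (f q) < e" if "p \<ge> N" "q \<ge> N" for p q
    proof -
      have "dd (r p) (r q) < e" using N that by simp
      moreover have "\<bar>f p - f q\<bar> \<le> dd (r p) (r q)"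
        unfolding f_def by (rule rk_diff_le_dd) (rule cauchy_valid[OF r])+
      ultimately show ?thesis unfolding dist_real_def by linarith
    qed
    then show "\<exists>M. \<forall>m\<ge>M. \<forall>n\<ge>M. dist (f m) (f n) < e" by (intro exI[of _ N]) simp
  qed
  then have f: "f \<longlonglongrightarrow> rkC \<mu> T E P (cl s)"
    unfolding rkC_def r_def[symmetric] f_def[symmetric] Cauchy_convergent_iff convergent_LIMSEQ_iff .
  have "(\<lambda>k. rk (fst (s k)) (snd (s k)) - f k) \<longlonglongrightarrow> 0"
  proof (rule Lim_null_comparison[OF always_eventually lim], rule allI)
    fix k
    show "norm (rk (fst (s k)) (snd (s k)) - f k) \<le> dd (s k) (r k)"
      unfolding f_def real_norm_def
      by (rule rk_diff_le_dd) (rule cauchy_valid[OF assms], rule cauchy_valid[OF r])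
  qed
  from tendsto_add[OF this f] show ?thesis by simp
qed

lemma rkC_sub_cl:
  assumes "cauchy s" "cauchy t"
  shows "(\<lambda>k. dd (s k) (t k)) \<longlonglongrightarrow> rkC \<mu> T E P (Rrk_sub \<mu> T E P (cl s) (cl t))"
proof -
  have "rk (fst (zop R_add (s k) (zsmult (- 1) (t k)))) (snd (zop R_add (s k) (zsmult (- 1) (t k)))) =
      dd (s k) (t k)" for k
    unfolding dinf_def zop_def
    by (simp add: Let_def lift_zsmult cauchy_valid[OF assms(2)])
  then show ?thesis
    using rkC_cl[OF cauchy_add[OF assms(1) cauchy_smult[OF assms(2), of "- 1"]]]
    unfolding Rrk_sub_cl[OF assms] by (simp only:)
qed

lemma cauchy_const: "valid z \<Longrightarrow> cauchy (\<lambda>k. z)"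
  by (auto simp: cauchy_iff)

lemma Rrk_iff: "X \<in> Rrk \<mu> T E P \<longleftrightarrow> (\<exists>s. cauchy s \<and> X = cl s)"
  by (auto simp: Rrk_def)

end

section \<open>The crossed product\<close>

lemma loc_const_const [simp]: "loc_const (\<lambda>x. c)"
  unfolding loc_const_def by (auto intro: exI[of _ UNIV])

lemma loc_constE:
  assumes "loc_const f" obtains U where "open U" "x \<in> U" "\<forall>z\<in>U. f z = f x"
  using assms[unfolded loc_const_def, rule_format, of x] by (elim exE conjE)

lemma loc_const_binary:
  assumes "loc_const f" "loc_const g" shows "loc_const (\<lambda>x. h (f x) (g x))"
  unfolding loc_const_def
proof
  fix x
  obtain U where U: "open U" "x \<in> U" "\<forall>z\<in>U. f z = f x" by (rule loc_constE[OF assms(1)])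
  obtain W where W: "open W" "x \<in> W" "\<forall>z\<in>W. g z = g x" by (rule loc_constE[OF assms(2)])
  show "\<exists>U. open U \<and> x \<in> U \<and> (\<forall>z\<in>U. h (f z) (g z) = h (f x) (g x))"
  proof (intro exI[of _ "U \<inter> W"] conjI ballI)
    fix z assume "z \<in> U \<inter> W"
    then have "f z = f x" "g z = g x" using U(3) W(3) by blast+
    then show "h (f z) (g z) = h (f x) (g x)" by (simp only:)
  qed (use U(1,2) W(1,2) in auto)
qed

lemma loc_const_sum:
  assumes "finite S" "\<And>i. i \<in> S \<Longrightarrow> loc_const (f i)"
  shows "loc_const (\<lambda>x. \<Sum>i\<in>S. f i x :: 'k::comm_monoid_add)"
  using assms
proof (induction S rule: finite_induct)
  case (insert i S)
  then show ?case using loc_const_binary[of "f i" "\<lambda>x. \<Sum>i\<in>S. f i x" "(+)"] by simp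
qed simp

lemma loc_const_compose:
  assumes "loc_const f" "continuous_on UNIV g" shows "loc_const (\<lambda>x. f (g x))"
  unfolding loc_const_def
proof
  fix x
  obtain U where U: "open U" "g x \<in> U" "\<forall>z\<in>U. f z = f (g x)" by (rule loc_constE[OF assms(1)])
  show "\<exists>U. open U \<and> x \<in> U \<and> (\<forall>z\<in>U. f (g z) = f (g x))"
  proof (intro exI[of _ "g -` U"] conjI ballI)
    show "open (g -` U)" by (rule open_vimage[OF U(1) assms(2)])
    show "f (g z) = f (g x)" if "z \<in> g -` U" for z using U(3) that by blast
  qed (use U(2) in simp)
qed

lemma loc_const_indicator:
  assumes "open U" "closed U" shows "loc_const (\<lambda>x. if x \<in> U then a else b)"
  unfolding loc_const_def
proof
  fix x
  show "\<exists>S. open S \<and> x \<in> S \<and> (\<forall>z\<in>S. (if z \<in> U then a else b) = (if x \<in> U then a else b))"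
    by (intro exI[of _ "if x \<in> U then U else - U"]) (use assms in auto)
qed

text \<open>\<open>cp_mono U d\<close> is the monomial \<open>\<chi>\<^sub>U t\<^sup>d\<close>.\<close>

definition cp_mono :: "'x set \<Rightarrow> int \<Rightarrow> ('x, 'k::{zero,one}) cp" where
  "cp_mono U d = (\<lambda>i x. if i = d \<and> x \<in> U then 1 else 0)"

lemma cp_mono_simps: "cp_chi U = cp_mono U 0" "cp_t = cp_mono UNIV 1" "cp_one = cp_mono UNIV 0"
  by (auto simp: cp_mono_def cp_chi_def cp_t_def cp_one_def intro!: ext)

lemma cp_mult_sum:
  assumes "finite I" "{i. a i \<noteq> (\<lambda>x. 0)} \<subseteq> I"
  shows "cp_mult T a b n x = (\<Sum>i\<in>I. a i x * b (n - i) (Tpow T (- i) x))"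
  unfolding cp_mult_def by (rule sum.mono_neutral_left[OF assms]) auto

lemma cp_mult_mono_left:
  fixes b :: "('x, 'k::comm_semiring_1) cp"
  shows "cp_mult T (cp_mono U d) b = (\<lambda>n x. if x \<in> U then b (n - d) (Tpow T (- d) x) else 0)"
  by (intro ext, subst cp_mult_sum[of "{d}"]) (auto simp: cp_mono_def)

text \<open>The generators, indicators and matrix units below are all monomials, so their products
  reduce to this formula.\<close>

lemma cp_mult_mono:
  "cp_mult T (cp_mono U d) (cp_mono W e :: ('x, 'k::comm_semiring_1) cp) =
     cp_mono {x \<in> U. Tpow T (- d) x \<in> W} (d + e)"
  unfolding cp_mult_mono_left by (auto simp: cp_mono_def intro!: ext)

lemma CP_mono: "open U \<Longrightarrow> closed U \<Longrightarrow> cp_mono U d \<in> CP"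
proof -
  assume U: "open U" "closed U"
  have "finite {i. cp_mono U d i \<noteq> (\<lambda>x. 0 :: 'b)}"
    by (rule finite_subset[of _ "{d}"]) (auto simp: cp_mono_def)
  moreover have "loc_const (cp_mono U d i :: 'a \<Rightarrow> 'b)" for i
    unfolding cp_mono_def using loc_const_indicator[OF U] by (cases "i = d") auto
  ultimately show ?thesis by (simp add: CP_def)
qed

lemma CP_add: "a \<in> CP \<Longrightarrow> b \<in> CP \<Longrightarrow> cp_add a b \<in> CP"
  for a b :: "('x::topological_space, 'k::comm_monoid_add) cp"
proof -
  assume ab: "a \<in> CP" "b \<in> CP"
  have "finite {i. cp_add a b i \<noteq> (\<lambda>x. 0)}"
    by (rule finite_subset[of _ "{i. a i \<noteq> (\<lambda>x. 0)} \<union> {i. b i \<noteq> (\<lambda>x. 0)}"])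
       (use ab in \<open>auto simp: cp_add_def CP_def\<close>)
  moreover have "loc_const (cp_add a b i)" for i
    unfolding cp_add_def using ab by (intro loc_const_binary[of "a i" "b i" "(+)"]) (simp_all add: CP_def)
  ultimately show ?thesis by (simp add: CP_def)
qed

lemma CP_smult: "a \<in> CP \<Longrightarrow> cp_smult c a \<in> CP"
  for a :: "('x::topological_space, 'k::comm_semiring_0) cp"
proof -
  assume a: "a \<in> CP"
  have "finite {i. cp_smult c a i \<noteq> (\<lambda>x. 0)}"
    by (rule finite_subset[of _ "{i. a i \<noteq> (\<lambda>x. 0)}"]) (use a in \<open>auto simp: cp_smult_def CP_def\<close>)
  moreover have "loc_const (cp_smult c a i)" for i
    unfolding cp_smult_def using a
    by (intro loc_const_binary[of "a i" "a i" "\<lambda>u w. c * u"]) (simp_all add: CP_def)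
  ultimately show ?thesis by (simp add: CP_def)
qed

context tower_system
begin

lemma CP_mult:
  fixes a b :: "('x, 'k::comm_semiring_0) cp"
  assumes "a \<in> CP" "b \<in> CP" shows "cp_mult T a b \<in> CP"
proof -
  let ?A = "{i. a i \<noteq> (\<lambda>x. 0)}" and ?B = "{i. b i \<noteq> (\<lambda>x. 0)}"
  have f: "finite ?A" "finite ?B" using assms by (auto simp: CP_def)
  have "{n. cp_mult T a b n \<noteq> (\<lambda>x. 0)} \<subseteq> (\<lambda>(i, j). i + j) ` (?A \<times> ?B)"
  proof
    fix n assume n: "n \<in> {n. cp_mult T a b n \<noteq> (\<lambda>x. 0)}"
    have "\<exists>i\<in>?A. b (n - i) \<noteq> (\<lambda>x. 0)"
    proof (rule ccontr)
      assume "\<not> ?thesis"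
      then have "\<forall>i\<in>?A. b (n - i) = (\<lambda>x. 0)" by blast
      then have "cp_mult T a b n = (\<lambda>x. 0)"
        unfolding cp_mult_def by (intro ext sum.neutral ballI) (metis mult_zero_right)
      then show False using n by simp
    qed
    then obtain i where "i \<in> ?A" "n - i \<in> ?B" by blast
    then show "n \<in> (\<lambda>(i, j). i + j) ` (?A \<times> ?B)" by (intro image_eqI[of _ _ "(i, n - i)"]) auto
  qed
  then have "finite {n. cp_mult T a b n \<noteq> (\<lambda>x. 0)}" using f finite_subset by blast
  moreover have "loc_const (cp_mult T a b n)" for n
    unfolding cp_mult_def
  proof (rule loc_const_sum[OF f(1)])
    fix i
    have "loc_const (a i)" "loc_const (b (n - i))" using assms by (auto simp: CP_def)
    then show "loc_const (\<lambda>x. a i x * b (n - i) (Tpow T (- i) x))"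
      using loc_const_binary[of "a i" "\<lambda>x. b (n - i) (Tpow T (- i) x)" "(*)"]
        loc_const_compose[OF _ Tpow_continuous] by blast
  qed
  ultimately show ?thesis by (simp add: CP_def)
qed

lemma CP_star:
  fixes a :: "('x, 'k::zero) cp"
  assumes "a \<in> CP" "cj 0 = 0" shows "cp_star T cj a \<in> CP"
proof -
  have "{n. cp_star T cj a n \<noteq> (\<lambda>x. 0)} \<subseteq> uminus ` {i. a i \<noteq> (\<lambda>x. 0)}"
  proof
    fix n assume n: "n \<in> {n. cp_star T cj a n \<noteq> (\<lambda>x. 0)}"
    then have "a (- n) \<noteq> (\<lambda>x. 0)" using assms(2) by (auto simp: cp_star_def)
    then show "n \<in> uminus ` {i. a i \<noteq> (\<lambda>x. 0)}" by (intro image_eqI[of _ _ "- n"]) auto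
  qed
  moreover have "finite {i. a i \<noteq> (\<lambda>x. 0)}" using assms by (simp add: CP_def)
  ultimately have "finite {n. cp_star T cj a n \<noteq> (\<lambda>x. 0)}" by (metis finite_imageI finite_subset)
  moreover have "loc_const (cp_star T cj a n)" for n
  proof -
    have "loc_const (a (- n))" using assms by (simp add: CP_def)
    from loc_const_compose[OF this Tpow_continuous[of "- n"]]
    have l: "loc_const (\<lambda>x. a (- n) (Tpow T (- n) x))" .
    from loc_const_binary[OF l l, of "\<lambda>u v. cj u"] show ?thesis unfolding cp_star_def .
  qed
  ultimately show ?thesis by (simp add: CP_def)
qed

text \<open>Only finitely many coefficients are nonzero, so \<open>D\<close> is a maximum of
  absolute degrees and \<open>N\<close> a maximum of the levels from
  \<open>loc_const_atom\<close>.\<close>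

lemma CP_bounds:
  fixes a :: "('x, 'k::zero) cp"
  assumes "a \<in> CP"
  obtains D N :: nat where "\<forall>i x. a i x \<noteq> 0 \<longrightarrow> \<bar>i\<bar> \<le> int D"
    and "\<forall>n\<ge>N. \<forall>i x z. atom_eq n x z \<longrightarrow> a i x = a i z"
proof -
  let ?A = "{i. a i \<noteq> (\<lambda>x. 0)}"
  have fA: "finite ?A" using assms by (simp add: CP_def)
  define D where "D = Max (insert 0 ((\<lambda>i. nat \<bar>i\<bar>) ` ?A))"
  have D: "\<bar>i\<bar> \<le> int D" if "a i x \<noteq> 0" for i x
  proof -
    have "i \<in> ?A" using that by auto
    then have "nat \<bar>i\<bar> \<le> D" unfolding D_def using fA by (intro Max_ge) auto
    then show ?thesis by linarith
  qed
  have "\<exists>N. \<forall>n\<ge>N. \<forall>x z. atom_eq n x z \<longrightarrow> a i x = a i z" for i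
    using assms loc_const_atom[of "a i"] by (simp add: CP_def)
  then obtain f where f: "\<And>i n x z. n \<ge> f i \<Longrightarrow> atom_eq n x z \<Longrightarrow> a i x = a i z" by metis
  define N where "N = Max (insert 0 (f ` ?A))"
  have "a i x = a i z" if "n \<ge> N" "atom_eq n x z" for n i x z
  proof (cases "i \<in> ?A")
    case True
    then have "f i \<le> N" unfolding N_def using fA by (intro Max_ge) auto
    then show ?thesis using f[of i n x z] that by simp
  qed simp
  then show ?thesis using that D by blast
qed

subsection \<open>Truncated regular representation\<close>

definition halo :: "nat \<Rightarrow> nat \<Rightarrow> 'x set" where
  "halo n D = (\<Union>i\<in>{- int D..int D}. {z. Tpow T i z \<in> E n})"

lemma borel_halo: "halo n D \<in> sets borel"
  unfolding halo_def using borel_Tpow_vimage[OF borel_E] by (intro sets.finite_UN) auto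

lemma measure_halo: "measure \<mu> (halo n D) \<le> real (2 * D + 1) * measure \<mu> (E n)"
proof -
  have "measure \<mu> (halo n D) \<le> (\<Sum>i\<in>{- int D..int D}. measure \<mu> {z. Tpow T i z \<in> E n})"
    unfolding halo_def
    by (rule finite_measure_subadditive_finite) (use borel_Tpow_vimage[OF borel_E] mu_sets in auto)
  also have "\<dots> = real (2 * D + 1) * measure \<mu> (E n)"
    using measure_Tpow_vimage[OF borel_E] by (simp add: nat_add_distrib nat_mult_distrib)
  finally show ?thesis .
qed

lemma halo_tendsto_0: "(\<lambda>n. measure \<mu> (halo n D)) \<longlonglongrightarrow> 0"
proof (rule tendsto_sandwich[OF _ _ tendsto_const])
  show "(\<lambda>n. real (2 * D + 1) * measure \<mu> (E n)) \<longlonglongrightarrow> 0"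
    using tendsto_mult_left[OF measure_E_tendsto_0, of "real (2 * D + 1)"] by simp
qed (use measure_halo in auto)

text \<open>Points of one base share their itinerary up to the top, so a visit to \<open>E m\<close>
  near row \<open>p\<close> by one of them is a visit by all.\<close>

lemma level_halo:
  assumes "v \<in> V M" "m \<le> M" "x \<in> fst v" "p < snd v" "s \<le> snd v"
    and "(T ^^ s) x \<in> E m" "\<bar>int s - int p\<bar> \<le> int D"
  shows "level v p \<subseteq> halo m D"
proof
  fix z assume "z \<in> level v p"
  then obtain w where w: "w \<in> fst v" "z = (T ^^ p) w" by blast
  have "Tpow T (int s - int p) z = (T ^^ s) w"
    using Tpow_funpow[OF bij_T, of "int s - int p" p w] w by simp
  moreover have "(T ^^ s) w \<in> E m"
    using atom_eq_E[OF atom_eq_mono[OF assms(2) V_atom_eq[OF assms(1,3) w(1) assms(5)]]] assms(6) by simp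
  ultimately show "z \<in> halo m D" unfolding halo_def using assms(7) by (intro UN_I[of "int s - int p"]) auto
qed

abbreviation ph :: "('x, 'k::field) cp \<Rightarrow> ('x, 'k) zseq" where
  "ph a \<equiv> \<lambda>k. (k, comp k a)"

lemma valid_comp [simp]: "valid (k, comp k a)"
  by (simp add: valid_def comp_R)

lemma dd_comp: "dd (k, comp k a) (k, comp k b) = rk k (sub (comp k a) (comp k b))"
  by (simp add: dinf_def Let_def)

text \<open>\<open>F\<close> is the kernel of the truncation at level \<open>m\<close>. In each row
  it agrees with \<open>a\<close> on columns inside the level-\<open>m\<close> tower through that
  row and is 0 elsewhere. A discrepancy is thus a nonzero entry of \<open>a\<close> that leaves this
  tower through its bottom or top, and that end lies within \<open>D\<close> of the row.\<close>

lemma dd_ph_le: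
  fixes a :: "('x, 'k::field) cp"
  assumes D: "\<And>i x. a i x \<noteq> 0 \<Longrightarrow> \<bar>i\<bar> \<le> int D"
    and N: "\<And>n i x z. n \<ge> N \<Longrightarrow> atom_eq n x z \<Longrightarrow> a i x = a i z"
    and m: "N \<le> m" "m \<le> M"
  shows "dd (ph a m) (ph a M) \<le> measure \<mu> (halo m D)"
proof -
  obtain F where F: "repr m F (comp m a)" using repr_exists by blast
  have "lift (m, comp m a) M = comp M F"
    unfolding lv_def using jup_eq_comp[OF F comp_R, of "M - m"] m by simp
  then have "dd (ph a m) (ph a M) = rk M (sub (comp M F) (comp M a))"
    using dd_at[of "(m, comp m a)" "(M, comp M a)" M] m by simp
  also have "\<dots> \<le> measure \<mu> (halo m D)"
  proof (rule rk_le_measure[OF _ borel_halo])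
    fix v p q assume v: "v \<in> V M" "p < snd v" "q < snd v" and ne: "sub (comp M F) (comp M a) v p q \<noteq> 0"
    define x where "x = base v"
    have x: "x \<in> fst v" unfolding x_def by (rule base_in[OF v(1)])
    have ne': "F (int p - int q) ((T ^^ p) x) \<noteq> a (int p - int q) ((T ^^ p) x)"
      using ne v by (auto simp: R_add_def R_smult_def comp_def x_def)
    have Em: "E M \<subseteq> E m" using E_mono m by blast
    have fwd: "\<exists>i\<ge>1. (T ^^ i) ((T ^^ p) x) \<in> E m"
    proof (intro exI conjI)
      have "(T ^^ (snd v - p)) ((T ^^ p) x) = (T ^^ snd v) x" using funpow_diff v by simp
      then show "(T ^^ (snd v - p)) ((T ^^ p) x) \<in> E m" using V_level_E[OF v(1) x, of "snd v"] Em by auto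
    qed (use v in simp)
    have bwd: "\<exists>i. Tpow T (- int i) ((T ^^ p) x) \<in> E m"
    proof (intro exI)
      have "Tpow T (- int p) ((T ^^ p) x) = x" using Tpow_cancel(2)[OF bij_T, of "int p" x] by simp
      then show "Tpow T (- int p) ((T ^^ p) x) \<in> E m" using V_level_E[OF v(1) x, of 0] Em by auto
    qed
    obtain v0 p0 where v0: "v0 \<in> V m" "p0 < snd v0" "(T ^^ p) x \<in> level v0 p0"
      using tower_cover[OF fwd bwd] by blast
    then obtain x0 where x0: "x0 \<in> fst v0" "(T ^^ p) x = (T ^^ p0) x0" by blast
    \<comment> \<open>The column measured from the bottom of the level-\<open>m\<close> tower, in
      which row \<open>p\<close> has position \<open>p0\<close>.\<close>
    define q0 where "q0 = int q - int p + int p0"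
    have Fq: "F (int p - int q) ((T ^^ p) x) =
        (if 0 \<le> q0 \<and> q0 < int (snd v0) then comp m a v0 p0 (nat q0) else 0)"
      using reprD[OF F v0(1) x0(1) v0(2), of q0] x0(2) by (simp add: q0_def)
    have out: "\<not> (0 \<le> q0 \<and> q0 < int (snd v0))"
    proof
      assume q0: "0 \<le> q0 \<and> q0 < int (snd v0)"
      then have "comp m a v0 p0 (nat q0) = a (int p0 - q0) ((T ^^ p0) (base v0))"
        using v0 by (auto simp: comp_def)
      also have "\<dots> = a (int p0 - q0) ((T ^^ p0) x0)"
        by (rule N[OF m(1) V_atom_eq[OF v0(1) base_in[OF v0(1)] x0(1)]]) (use v0 in simp)
      finally show False using Fq q0 ne' x0(2) by (simp add: q0_def)
    qed
    then have "a (int p - int q) ((T ^^ p) x) \<noteq> 0" using Fq ne' by auto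
    then have dist: "\<bar>int p - int q\<bar> \<le> int D" by (rule D)
    have x0': "Tpow T (int i + int p - int p0) x = (T ^^ i) x0" for i
    proof -
      have "Tpow T (int i - int p0) ((T ^^ p) x) = Tpow T (int i - int p0) ((T ^^ p0) x0)"
        using x0(2) by simp
      then show ?thesis using Tpow_funpow[OF bij_T, of "int i - int p0"] by (simp add: algebra_simps)
    qed
    have "\<exists>s\<le>snd v. (T ^^ s) x \<in> E m \<and> \<bar>int s - int p\<bar> \<le> int D"
    proof (cases "q0 < 0")
      case True
      \<comment> \<open>The bottom of the tower, which lies after column \<open>q\<close>; hence
        \<open>p0\<close> is at most \<open>p\<close> and the natural subtraction is not cut
        off.\<close>
      define s where "s = p - p0"
      have s: "int s = int p - int p0" using True by (simp add: s_def q0_def of_nat_diff)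
      have "(T ^^ s) x = x0" using x0'[of 0] s Tpow_of_nat[of T s] by simp
      then have "(T ^^ s) x \<in> E m" using V_level_E[OF v0(1) x0(1), of 0] by simp
      moreover have "\<bar>int s - int p\<bar> \<le> int D" using s True dist by (simp add: q0_def)
      ultimately show ?thesis using v(2) by (intro exI[of _ s]) (simp add: s_def)
    next
      case False
      then have ge: "q0 \<ge> int (snd v0)" using out by simp
      \<comment> \<open>The top of the tower, at or before column \<open>q\<close> and therefore
        still within \<open>v\<close>.\<close>
      define s where "s = snd v0 + p - p0"
      have s: "int s = int (snd v0) + int p - int p0" using v0(2) by (simp add: s_def of_nat_diff)
      have "(T ^^ s) x = (T ^^ snd v0) x0" using x0'[of "snd v0"] s Tpow_of_nat[of T s] by simp
      then have "(T ^^ s) x \<in> E m" using V_level_E[OF v0(1) x0(1), of "snd v0"] by simp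
      moreover have "\<bar>int s - int p\<bar> \<le> int D" using s ge dist v0(2) by (simp add: q0_def)
      moreover have "s \<le> snd v" using s ge v(3) by (simp add: q0_def)
      ultimately show ?thesis by blast
    qed
    then obtain s where "s \<le> snd v" "(T ^^ s) x \<in> E m" "\<bar>int s - int p\<bar> \<le> int D" by blast
    then show "level v p \<subseteq> halo m D" by (rule level_halo[OF v(1) m(2) x v(2)])
  qed
  finally show ?thesis .
qed

lemma cauchy_ph:
  assumes "a \<in> CP" shows "cauchy (ph a)"
  unfolding cauchy_iff
proof (intro conjI allI impI)
  fix e :: real assume e: "e > 0"
  obtain D N :: nat where D: "\<forall>i x. a i x \<noteq> 0 \<longrightarrow> \<bar>i\<bar> \<le> int D"
    and N: "\<forall>n\<ge>N. \<forall>i x z. atom_eq n x z \<longrightarrow> a i x = a i z" by (rule CP_bounds[OF assms])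
  obtain K where K: "\<And>n. n \<ge> K \<Longrightarrow> measure \<mu> (halo n D) < e"
    using order_tendstoD(2)[OF halo_tendsto_0 e] unfolding eventually_sequentially by blast
  have *: "dd (ph a p) (ph a q) < e" if "max N K \<le> p" "p \<le> q" for p q
  proof -
    have "dd (ph a p) (ph a q) \<le> measure \<mu> (halo p D)"
      by (rule dd_ph_le[where N = N]) (use D N that in auto)
    then show ?thesis using K[of p] that by simp
  qed
  have "dd (ph a p) (ph a q) < e" if "max N K \<le> p" "max N K \<le> q" for p q
    using *[of p q] *[of q p] that dd_sym[of "ph a p" "ph a q"] by (cases "p \<le> q") auto
  then show "\<exists>N. \<forall>p\<ge>N. \<forall>q\<ge>N. dd (ph a p) (ph a q) < e" by blast
qed simp

text \<open>The full convolution and the product of truncations differ in a row only if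
  \<open>a\<close> has a nonzero entry there that leaves the tower, which puts the row within
  \<open>D\<close> of one of the ends.\<close>

lemma comp_mult_close:
  fixes a b :: "('x, 'k::field) cp"
  assumes "a \<in> CP" and D: "\<And>i x. a i x \<noteq> 0 \<Longrightarrow> \<bar>i\<bar> \<le> int D"
  shows "rk n (sub (comp n (cp_mult T a b)) (R_mult (comp n a) (comp n b))) \<le> measure \<mu> (halo n D)"
proof (rule rk_le_measure[OF _ borel_halo])
  have conv: "cp_mult T a b i z = conv a b i z" for i z
    unfolding cp_mult_def conv_def using assms(1)
    by (intro sum.mono_neutral_right) (auto simp: CP_def)
  fix v p q assume v: "v \<in> V n" "p < snd v" "q < snd v"
    and ne: "sub (comp n (cp_mult T a b)) (R_mult (comp n a) (comp n b)) v p q \<noteq> 0"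
  define x where "x = base v"
  have x: "x \<in> fst v" unfolding x_def by (rule base_in[OF v(1)])
  have "conv a b (int p - int q) ((T ^^ p) x) \<noteq>
      (\<Sum>l<snd v. a (int p - int l) ((T ^^ p) x) * b (int l - int q) ((T ^^ l) x))"
    using ne v by (auto simp: R_add_def R_smult_def R_mult_def comp_def conv x_def)
  then obtain i where i: "a i ((T ^^ p) x) \<noteq> 0" "\<not> (0 \<le> int p - i \<and> int p - i < int (snd v))"
    using conv_orbit[where F = a and p = p and x = x and k = "snd v" and G = b and q = "int q"] by blast
  have "\<bar>i\<bar> \<le> int D" using D i(1) by blast
  then consider "\<bar>int 0 - int p\<bar> \<le> int D" | "\<bar>int (snd v) - int p\<bar> \<le> int D"
    using i(2) v(2) by linarith
  then show "level v p \<subseteq> halo n D"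
  proof cases
    case 1
    show ?thesis by (rule level_halo[OF v(1) order_refl x v(2) _ _ 1]) (use V_level_E[OF v(1) x, of 0] in auto)
  next
    case 2
    show ?thesis
      by (rule level_halo[OF v(1) order_refl x v(2) _ _ 2]) (use V_level_E[OF v(1) x, of "snd v"] in auto)
  qed
qed

subsection \<open>Faithfulness\<close>

text \<open>The diagonal \<open>p - q = d\<close> carries the top coefficient and everything with
  \<open>p - q > d\<close> is 0, so \<open>mat_rank_ge_subdiagonal\<close> applies. The loss |d|
  bounds the number of rows whose partner column \<open>p - d\<close> falls outside the
  tower.\<close>

lemma rank_top_coefficient:
  fixes a :: "('x, 'k::field) cp"
  assumes v: "v \<in> V n" and top: "\<And>i z. i > d \<Longrightarrow> a i z = 0"
  shows "card {p. p < snd v \<and> level v p \<subseteq> {z. a d z \<noteq> 0}} \<le> mat_rank (snd v) (comp n a v) + nat \<bar>d\<bar>"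
proof -
  let ?k = "snd v" and ?A = "comp n a v"
  let ?S = "{p. p < ?k \<and> level v p \<subseteq> {z. a d z \<noteq> 0}}"
  let ?Q = "{q. q < ?k \<and> (\<exists>p<?k. int p - int q = d \<and> ?A p q \<noteq> 0)}"
  let ?X = "{p. p < ?k \<and> \<not> (0 \<le> int p - d \<and> int p - d < int ?k)}"
  have x: "base v \<in> fst v" by (rule base_in[OF v])
  have "?S \<subseteq> (\<lambda>q. nat (int q + d)) ` ?Q \<union> ?X"
  proof
    fix p assume p: "p \<in> ?S"
    show "p \<in> (\<lambda>q. nat (int q + d)) ` ?Q \<union> ?X"
    proof (cases "0 \<le> int p - d \<and> int p - d < int ?k")
      case True
      then obtain q where q: "int q = int p - d" "q < ?k" by (metis nonneg_int_cases of_nat_less_iff)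
      have "(T ^^ p) (base v) \<in> {z. a d z \<noteq> 0}" using p x by blast
      then have "?A p q \<noteq> 0" using p q v by (simp add: comp_def)
      then have "q \<in> ?Q" using p q by auto
      then show ?thesis using q by (intro UnI1 image_eqI[of _ _ q]) auto
    qed (use p in auto)
  qed
  then have "card ?S \<le> card ((\<lambda>q. nat (int q + d)) ` ?Q \<union> ?X)" by (rule card_mono[rotated]) auto
  also have "\<dots> \<le> card ?Q + card ?X"
    by (rule order_trans[OF card_Un_le]) (simp add: card_image_le)
  also have "card ?Q \<le> mat_rank ?k ?A"
    by (rule mat_rank_ge_subdiagonal) (use top in \<open>auto simp: comp_def\<close>)
  also have "card ?X \<le> nat \<bar>d\<bar>"
  proof (cases "d \<ge> 0")
    case True
    then have "?X \<subseteq> {..<nat \<bar>d\<bar>}" by auto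
    from card_mono[OF _ this] show ?thesis by simp
  next
    case False
    then have "?X \<subseteq> {?k - nat \<bar>d\<bar>..<?k}" by auto
    from card_mono[OF _ this] show ?thesis by simp
  qed
  finally show ?thesis by simp
qed

lemma rk_comp_lower_bound:
  fixes a :: "('x, 'k::field) cp"
  assumes "a \<in> CP" "a \<noteq> cp_zero"
  obtains c d :: real and N :: nat where "c > 0" "\<forall>n\<ge>N. c - d * measure \<mu> (E n) \<le> rk n (comp n a)"
proof -
  let ?A = "{i. a i \<noteq> (\<lambda>x. 0)}"
  have fA: "finite ?A" using assms by (simp add: CP_def)
  have neA: "?A \<noteq> {}" using assms(2) by (auto simp: cp_zero_def)
  define d where "d = Max ?A"
  have dA: "d \<in> ?A" unfolding d_def by (rule Max_in[OF fA neA])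
  have top: "a i z = 0" if "i > d" for i z
  proof (rule ccontr)
    assume "a i z \<noteq> 0"
    then have "i \<in> ?A" by auto
    then have "i \<le> d" unfolding d_def by (rule Max_ge[OF fA])
    then show False using that by simp
  qed
  define U where "U = {z. a d z \<noteq> 0}"
  have "open U"
  proof (subst open_subopen, rule ballI)
    fix x assume x: "x \<in> U"
    have "loc_const (a d)" using assms by (simp add: CP_def)
    then obtain S where "open S" "x \<in> S" "\<forall>z\<in>S. a d z = a d x" by (rule loc_constE)
    moreover have "S \<subseteq> U"
    proof
      fix z assume "z \<in> S"
      then have "a d z = a d x" using \<open>\<forall>z\<in>S. a d z = a d x\<close> by blast
      then show "z \<in> U" using x by (simp add: U_def)
    qed
    ultimately show "\<exists>S. open S \<and> x \<in> S \<and> S \<subseteq> U" by blast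
  qed
  moreover have "U \<noteq> {}" using dA by (auto simp: U_def)
  ultimately have pos: "measure \<mu> U > 0" using mu_full by blast
  obtain D N :: nat where "\<forall>i x. a i x \<noteq> 0 \<longrightarrow> \<bar>i\<bar> \<le> int D"
    and N': "\<forall>n\<ge>N. \<forall>i x z. atom_eq n x z \<longrightarrow> a i x = a i z" by (rule CP_bounds[OF assms(1)])
  have N: "\<And>n i x z. n \<ge> N \<Longrightarrow> atom_eq n x z \<Longrightarrow> a i x = a i z" using N' by blast
  have "measure \<mu> U - real (nat \<bar>d\<bar>) * measure \<mu> (E n) \<le> rk n (comp n a)" if n: "n \<ge> N" for n
  proof (rule rk_ge_visits)
    show "U \<in> sets borel" using \<open>open U\<close> by simp
    fix v p assume v: "v \<in> V n" "p < snd v"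
    have "a d ((T ^^ p) w) = a d ((T ^^ p) (base v))" if "w \<in> fst v" for w
      by (rule N[OF n V_atom_eq[OF v(1) that base_in[OF v(1)]]]) (use v in simp)
    then show "level v p \<subseteq> U \<or> level v p \<subseteq> - U" unfolding U_def by auto
  next
    fix v assume "v \<in> V n"
    then show "card {p. p < snd v \<and> level v p \<subseteq> U} \<le> mat_rank (snd v) (comp n a v) + nat \<bar>d\<bar>"
      unfolding U_def by (rule rank_top_coefficient[OF _ top])
  qed
  then show ?thesis using that[OF pos, of N "real (nat \<bar>d\<bar>)"] by blast
qed

lemma rk_comp_limit_pos:
  fixes a :: "('x, 'k::field) cp"
  assumes "a \<in> CP" "(\<lambda>n. rk n (comp n a)) \<longlonglongrightarrow> 0" shows "a = cp_zero"
proof (rule ccontr)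
  assume ne: "a \<noteq> cp_zero"
  obtain c d :: real and N :: nat where c: "c > 0"
    "\<forall>n\<ge>N. c - d * measure \<mu> (E n) \<le> rk n (comp n a)"
    by (rule rk_comp_lower_bound[OF assms(1) ne])
  have "(\<lambda>n. c - d * measure \<mu> (E n)) \<longlonglongrightarrow> c - d * 0"
    by (intro tendsto_intros measure_E_tendsto_0)
  then have "c - d * 0 \<le> 0" by (rule LIMSEQ_le[OF _ assms(2)]) (use c in blast)
  then show False using c by simp
qed

end

section \<open>The approximating subalgebras\<close>

locale tower_system_star = tower_system T \<mu> y E P
  for T :: "'x::metric_space \<Rightarrow> 'x" and \<mu> :: "'x measure" and y :: 'x
    and E :: "nat \<Rightarrow> 'x set" and P :: "nat \<Rightarrow> 'x set set" +
  fixes cj :: "'k::field \<Rightarrow> 'k"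
  assumes cj_invol: "\<forall>a. cj (cj a) = a"
    and cj_add: "\<forall>a b. cj (a + b) = cj a + cj b"
    and cj_mult: "\<forall>a b. cj (a * b) = cj a * cj b"
begin

lemma cj_0 [simp]: "cj 0 = 0"
  using cj_add[rule_format, of 0 0] by (metis add.right_neutral add_left_imp_eq)

lemma cj_1 [simp]: "cj 1 = 1"
proof -
  have "cj 1 \<noteq> 0" using cj_invol cj_0 by (metis zero_neq_one)
  moreover have "cj 1 * cj 1 = cj 1" using cj_mult[rule_format, of 1 1] by simp
  ultimately show ?thesis by simp
qed

abbreviation An :: "nat \<Rightarrow> ('x, 'k) cp set" where "An \<equiv> A_n T cj P"

lemma cp_star_mono: "cp_star T cj (cp_mono U d) = cp_mono {x. Tpow T d x \<in> U} (- d)"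
  by (auto simp: cp_star_def cp_mono_def intro!: ext)

lemma An_induct [consumes 1, case_names gen one add smult mult star]:
  assumes "a \<in> An n"
    and "\<And>Z. Z \<in> P n \<Longrightarrow> Q (cp_mono Z 1)" "Q cp_one"
    and "\<And>a b. a \<in> An n \<Longrightarrow> b \<in> An n \<Longrightarrow> Q a \<Longrightarrow> Q b \<Longrightarrow> Q (cp_add a b)"
    and "\<And>a c. a \<in> An n \<Longrightarrow> Q a \<Longrightarrow> Q (cp_smult c a)"
    and "\<And>a b. a \<in> An n \<Longrightarrow> b \<in> An n \<Longrightarrow> Q a \<Longrightarrow> Q b \<Longrightarrow> Q (cp_mult T a b)"
    and "\<And>a. a \<in> An n \<Longrightarrow> Q a \<Longrightarrow> Q (cp_star T cj a)"
  shows "Q a"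
  using assms(1) unfolding A_n_def
proof (induction rule: subalg_gen.induct)
  case (gen g)
  then obtain Z where "Z \<in> P n" "g = cp_mult T (cp_chi Z) cp_t" by blast
  then show ?case using assms(2) by (simp add: cp_mono_simps cp_mult_mono)
qed (use assms(3-) in \<open>auto simp: A_n_def\<close>)

lemma An_gen: "Z \<in> P n \<Longrightarrow> cp_mono Z 1 \<in> An n"
proof -
  assume "Z \<in> P n"
  then have "cp_mult T (cp_chi Z) cp_t \<in> An n" unfolding A_n_def by (intro subalg_gen.gen) blast
  then show ?thesis by (simp add: cp_mono_simps cp_mult_mono)
qed

lemma An_closed:
  "cp_one \<in> An n"
  "a \<in> An n \<Longrightarrow> b \<in> An n \<Longrightarrow> cp_add a b \<in> An n"
  "a \<in> An n \<Longrightarrow> cp_smult c a \<in> An n"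
  "a \<in> An n \<Longrightarrow> b \<in> An n \<Longrightarrow> cp_mult T a b \<in> An n"
  "a \<in> An n \<Longrightarrow> cp_star T cj a \<in> An n"
  unfolding A_n_def by (rule subalg_gen.intros; assumption)+

lemma An_sum:
  assumes "finite S" "\<And>s. s \<in> S \<Longrightarrow> F s \<in> An n" shows "cp_sum F S \<in> An n"
  using assms
proof (induction S rule: finite_induct)
  case empty
  have "cp_sum F {} = cp_smult 0 cp_one" by (auto simp: cp_sum_def cp_smult_def intro!: ext)
  then show ?case using An_closed by metis
next
  case (insert s S)
  have "cp_sum F (insert s S) = cp_add (F s) (cp_sum F S)"
    using insert by (auto simp: cp_sum_def cp_add_def intro!: ext)
  then show ?case using insert An_closed(2) by simp
qed

lemma An_CP: "a \<in> An n \<Longrightarrow> a \<in> CP"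
proof (induction rule: An_induct)
  case (gen Z)
  then show ?case using P_part by (intro CP_mono) auto
next
  case one
  then show ?case unfolding cp_mono_simps by (intro CP_mono) auto
qed (auto intro: CP_add CP_smult CP_mult CP_star)

subsection \<open>Elements of the subalgebras do not cross the base\<close>

text \<open>The path between \<open>z\<close> and \<open>Tpow T (- d) z\<close> crosses a cut
  between towers. A cut lies just below each visit to \<open>E n\<close>, hence the half-open
  interval: the lower end of the path may lie in \<open>E n\<close> without a crossing, the upper
  end may not.\<close>

definition blocked :: "nat \<Rightarrow> 'x \<Rightarrow> int \<Rightarrow> bool" where
  "blocked n z d \<longleftrightarrow> (\<exists>i. min 0 (- d) < i \<and> i \<le> max 0 (- d) \<and> Tpow T i z \<in> E n)"

text \<open>The two properties that the generators have and the algebra operations preserve: no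
  entry crosses a cut, and along a tower entries do not depend on the point of the base. The second
  lets a single base point determine the block.\<close>

definition local :: "nat \<Rightarrow> ('x, 'k) cp \<Rightarrow> bool" where
  "local n a \<longleftrightarrow> (\<forall>z d. blocked n z d \<longrightarrow> a d z = 0) \<and>
     (\<forall>v\<in>V n. \<forall>x\<in>fst v. \<forall>x'\<in>fst v. \<forall>p<snd v. \<forall>d. a d ((T ^^ p) x) = a d ((T ^^ p) x'))"

lemma localD:
  assumes "local n a"
  shows "blocked n z d \<Longrightarrow> a d z = 0"
    and "v \<in> V n \<Longrightarrow> x \<in> fst v \<Longrightarrow> x' \<in> fst v \<Longrightarrow> p < snd v \<Longrightarrow> a d ((T ^^ p) x) = a d ((T ^^ p) x')"
  using assms unfolding local_def by blast+

lemma blocked_exit: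
  assumes "v \<in> V n" "x \<in> fst v" "p < snd v" "\<not> (0 \<le> int p - d \<and> int p - d < int (snd v))"
  shows "blocked n ((T ^^ p) x) d"
proof (cases "int p - d < 0")
  case True
  have "Tpow T (- int p) ((T ^^ p) x) = x" using Tpow_cancel(2)[OF bij_T, of "int p" x] by simp
  then show ?thesis unfolding blocked_def using True V_level_E[OF assms(1,2), of 0]
    by (intro exI[of _ "- int p"]) auto
next
  case False
  have "Tpow T (int (snd v) - int p) ((T ^^ p) x) = (T ^^ snd v) x"
    using Tpow_funpow[OF bij_T, of "int (snd v) - int p" p x] by simp
  then show ?thesis unfolding blocked_def using False assms V_level_E[OF assms(1,2), of "snd v"]
    by (intro exI[of _ "int (snd v) - int p"]) auto
qed

text \<open>When a path is broken at an intermediate point, each cut on it is crossed by at least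
  one of the two pieces, even if the detour overshoots an end. This gives stability of
  \<open>local\<close> under products.\<close>

lemma blocked_split:
  assumes "blocked n z d" shows "blocked n z i \<or> blocked n (Tpow T (- i) z) (d - i)"
proof -
  obtain l where l: "min 0 (- d) < l" "l \<le> max 0 (- d)" "Tpow T l z \<in> E n"
    using assms by (auto simp: blocked_def)
  have l': "Tpow T (l + i) (Tpow T (- i) z) = Tpow T l z"
    using Tpow_add[OF bij_T, of "l + i" "- i" z] by simp
  show ?thesis
  proof (cases "min 0 (- i) < l \<and> l \<le> max 0 (- i)")
    case True
    then show ?thesis using l by (auto simp: blocked_def)
  next
    case False
    then have "min 0 (- (d - i)) < l + i" "l + i \<le> max 0 (- (d - i))" using l by auto
    then show ?thesis using l l' unfolding blocked_def by (intro disjI2 exI[of _ "l + i"]) auto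
  qed
qed

lemma blocked_reverse: "blocked n z d \<Longrightarrow> blocked n (Tpow T (- d) z) (- d)"
proof -
  assume "blocked n z d"
  then obtain l where l: "min 0 (- d) < l" "l \<le> max 0 (- d)" "Tpow T l z \<in> E n"
    by (auto simp: blocked_def)
  have "Tpow T (l + d) (Tpow T (- d) z) = Tpow T l z"
    using Tpow_add[OF bij_T, of "l + d" "- d" z] by simp
  then show ?thesis using l unfolding blocked_def by (intro exI[of _ "l + d"]) auto
qed

lemma orbit_step:
  assumes "0 \<le> int p - i" shows "Tpow T (- i) ((T ^^ p) x) = (T ^^ nat (int p - i)) x"
  using Tpow_funpow[OF bij_T, of "- i" p x] Tpow_of_nat[of T "nat (int p - i)"] assms by simp

lemma An_local: "a \<in> An n \<Longrightarrow> local n a"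
proof (induction rule: An_induct)
  case (gen Z)
  have ZE: "z \<notin> Z" if "z \<in> E n" for z using that P_part gen by blast
  show ?case unfolding local_def
  proof (intro conjI allI ballI impI)
    fix z d assume b: "blocked n z d"
    show "(cp_mono Z 1 d z :: 'k) = 0"
    proof (cases "d = 1")
      case True
      then obtain i where "- 1 < i" "i \<le> 0" "Tpow T i z \<in> E n" using b by (auto simp: blocked_def)
      moreover from this have "i = 0" by simp
      ultimately have "z \<in> E n" by simp
      then show ?thesis using ZE by (simp add: cp_mono_def)
    qed (simp add: cp_mono_def)
  next
    fix v x x' p d assume "v \<in> V n" "x \<in> fst v" "x' \<in> fst v" "p < snd v"
    then have "(T ^^ p) x \<in> Z \<longleftrightarrow> (T ^^ p) x' \<in> Z"
      using V_atom_eq[of v n x x' p] gen unfolding atom_eq_def by auto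
    then show "(cp_mono Z 1 d ((T ^^ p) x) :: 'k) = cp_mono Z 1 d ((T ^^ p) x')" by (simp add: cp_mono_def)
  qed
next
  case one
  have "\<not> blocked n z 0" for z by (auto simp: blocked_def)
  then have "(cp_one d z :: 'k) = 0" if "blocked n z d" for z d
    using that by (cases "d = 0") (auto simp: cp_one_def)
  then show ?case unfolding local_def by (simp add: cp_one_def)
next
  case (add a b)
  note a = localD[OF add.IH(1)] and b = localD[OF add.IH(2)]
  show ?case unfolding local_def cp_add_def
  proof (intro conjI allI ballI impI)
    fix z d assume "blocked n z d"
    then show "a d z + b d z = 0" using a(1) b(1) by simp
  next
    fix v x x' p d assume v: "v \<in> V n" "x \<in> fst v" "x' \<in> fst v" "p < snd v"
    show "a d ((T ^^ p) x) + b d ((T ^^ p) x) = a d ((T ^^ p) x') + b d ((T ^^ p) x')"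
      using a(2)[OF v, of d] b(2)[OF v, of d] by simp
  qed
next
  case (smult a c)
  note a = localD[OF smult.IH]
  show ?case unfolding local_def cp_smult_def
  proof (intro conjI allI ballI impI)
    fix z d assume "blocked n z d"
    then show "c * a d z = 0" using a(1) by simp
  next
    fix v x x' p d assume v: "v \<in> V n" "x \<in> fst v" "x' \<in> fst v" "p < snd v"
    show "c * a d ((T ^^ p) x) = c * a d ((T ^^ p) x')" using a(2)[OF v, of d] by simp
  qed
next
  case (mult a b)
  note a = localD[OF mult.IH(1)] and b = localD[OF mult.IH(2)]
  show ?case unfolding local_def
  proof (intro conjI allI ballI impI)
    fix z d assume "blocked n z d"
    then show "cp_mult T a b d z = 0" unfolding cp_mult_def
    proof (intro sum.neutral ballI)
      fix i
      show "a i z * b (d - i) (Tpow T (- i) z) = 0"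
        using blocked_split[OF \<open>blocked n z d\<close>, of i] a(1)[of z i] b(1)[of "Tpow T (- i) z" "d - i"] by auto
    qed
  next
    fix v x x' p d assume v: "v \<in> V n" "x \<in> fst v" "x' \<in> fst v" "p < snd v"
    show "cp_mult T a b d ((T ^^ p) x) = cp_mult T a b d ((T ^^ p) x')" unfolding cp_mult_def
    proof (rule sum.cong[OF refl])
      fix i
      show "a i ((T ^^ p) x) * b (d - i) (Tpow T (- i) ((T ^^ p) x)) =
        a i ((T ^^ p) x') * b (d - i) (Tpow T (- i) ((T ^^ p) x'))"
      \<comment> \<open>An intermediate point inside the tower is handled by constancy of both
        factors; one outside contributes 0 because \<open>a\<close> vanishes across a cut.\<close>
      proof (cases "0 \<le> int p - i \<and> int p - i < int (snd v)")
        case True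
        then have l: "nat (int p - i) < snd v" by auto
        show ?thesis using a(2)[OF v, of i] b(2)[OF v(1,2,3) l, of "d - i"] orbit_step[of p i] True by simp
      next
        case False
        then show ?thesis
          using a(1) blocked_exit[OF v(1,2,4) False] blocked_exit[OF v(1,3,4) False] by simp
      qed
    qed
  qed
next
  case (star a)
  note a = localD[OF star.IH]
  show ?case unfolding local_def
  proof (intro conjI allI ballI impI)
    fix z d assume "blocked n z d"
    then show "cp_star T cj a d z = 0" using a(1)[OF blocked_reverse] by (simp add: cp_star_def)
  next
    fix v x x' p d assume v: "v \<in> V n" "x \<in> fst v" "x' \<in> fst v" "p < snd v"
    show "cp_star T cj a d ((T ^^ p) x) = cp_star T cj a d ((T ^^ p) x')"
    proof (cases "0 \<le> int p - d \<and> int p - d < int (snd v)")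
      case True
      then have l: "nat (int p - d) < snd v" by auto
      show ?thesis unfolding cp_star_def using a(2)[OF v(1,2,3) l, of "- d"] orbit_step[of p d] True by simp
    next
      case False
      show ?thesis unfolding cp_star_def
        using a(1)[OF blocked_reverse[OF blocked_exit[OF v(1,2,4) False]]]
          a(1)[OF blocked_reverse[OF blocked_exit[OF v(1,3,4) False]]] by simp
    qed
  qed
qed

text \<open>On \<open>An n\<close> no entry leaves a tower and entries do not depend on the point of
  the base, so truncation at level \<open>n\<close> loses nothing.\<close>

lemma An_repr:
  assumes "a \<in> An n" shows "repr n a (comp n a)"
  unfolding repr_def
proof (intro ballI allI impI)
  note a = localD[OF An_local[OF assms]]
  fix v x p q assume v: "v \<in> V n" "x \<in> fst v" "p < snd v"
  show "a (int p - q) ((T ^^ p) x) = (if 0 \<le> q \<and> q < int (snd v) then comp n a v p (nat q) else 0)"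
  proof (cases "0 \<le> q \<and> q < int (snd v)")
    case True
    then have "nat q < snd v" "int (nat q) = q" by auto
    then show ?thesis using a(2)[OF v(1,2) base_in[OF v(1)] v(3), of "int p - q"] True v
      by (auto simp: comp_def nat_less_iff)
  next
    case False
    then show ?thesis using a(1)[OF blocked_exit[OF v, of "int p - q"]] by auto
  qed
qed

subsection \<open>Matrix units and the maps \<open>\<pi>\<^sub>n\<close>\<close>

lemma s_n_mono: "s_n T E n = (cp_mono (- E n) 1 :: ('x, 'k) cp)"
  by (simp add: s_n_def cp_mono_simps cp_mult_mono Compl_eq)

lemma Tpow_1 [simp]: "Tpow T 1 x = T x" "Tpow T (- 1) (T x) = x" "T (Tpow T (- 1) x) = x"
  using Tpow_of_nat[of T 1] Tpow_cancel[OF bij_T, of 1] by auto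

lemma cp_pow_s: "cp_pow T (s_n T E n) i = (cp_mono {x. \<forall>l<i. Tpow T (- int l) x \<notin> E n} (int i) :: ('x, 'k) cp)"
proof (induction i)
  case 0
  then show ?case by (simp add: cp_mono_simps)
next
  case (Suc i)
  have "{x. (\<forall>l<i. Tpow T (- int l) x \<notin> E n) \<and> Tpow T (- int i) x \<notin> E n} =
      {x. \<forall>l<Suc i. Tpow T (- int l) x \<notin> E n}" by (auto simp: less_Suc_eq)
  then show ?case by (simp only: cp_pow.simps(2) Suc) (simp add: s_n_mono cp_mult_mono add.commute)
qed

lemma cp_pow_s_star:
  "cp_pow T (cp_star T cj (s_n T E n)) j = cp_mono {x. \<forall>l<j. (T ^^ Suc l) x \<notin> E n} (- int j)"
proof (induction j)
  case 0
  then show ?case by (simp add: cp_mono_simps)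
next
  case (Suc j)
  have "{x. (\<forall>l<j. (T ^^ Suc l) x \<notin> E n) \<and> T ((T ^^ j) x) \<notin> E n} =
      {x. \<forall>l<Suc j. (T ^^ Suc l) x \<notin> E n}" by (auto simp: less_Suc_eq)
  moreover have "- int j + - 1 = - int (Suc j)" by simp
  ultimately show ?case
    by (simp only: cp_pow.simps(2) Suc, simp only: s_n_mono cp_star_mono cp_mult_mono) simp
qed

text \<open>The powers of \<open>s_n\<close> and of its adjoint carry conditions of avoiding
  \<open>E n\<close>; on the levels of a tower these hold automatically, since only the two ends lie
  in \<open>E n\<close>.\<close>

lemma e_W_mono:
  assumes "v \<in> V n" "i < snd v" "j < snd v"
  shows "e_W T cj E n v i j = cp_mono (level v i) (int i - int j)"
proof -
  have "{x. (\<forall>l<i. Tpow T (- int l) x \<notin> E n) \<and> Tpow T (- int i) x \<in> fst v \<and>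
      (\<forall>l<j. (T ^^ Suc l) (Tpow T (- int i) x) \<notin> E n)} = level v i" (is "?L = _")
  proof (intro set_eqI iffI)
    fix x assume "x \<in> ?L"
    then show "x \<in> level v i" unfolding funpow_image_eq by blast
  next
    fix x assume "x \<in> level v i"
    then obtain w where w: "w \<in> fst v" "x = (T ^^ i) w" by blast
    have "Tpow T (- int l) x \<notin> E n" if "l < i" for l
    proof -
      have "Tpow T (- int l) x = (T ^^ (i - l)) w"
        using orbit_step[of i "int l" w] that w(2) by (simp add: nat_diff_distrib)
      then show ?thesis using V_level_E[OF assms(1) w(1), of "i - l"] that assms by auto
    qed
    moreover have "Tpow T (- int i) x = w" using orbit_step[of i "int i" w] w by simp
    moreover have "(T ^^ Suc l) w \<notin> E n" if "l < j" for l
      using V_level_E[OF assms(1) w(1), of "Suc l"] that assms by auto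
    ultimately show "x \<in> ?L" using w by simp
  qed
  then show ?thesis
    unfolding e_W_def cp_pow_s cp_pow_s_star cp_mono_simps(1) cp_mult_mono by (simp add: conj_assoc)
qed

lemma mem_level_iff:
  assumes "v \<in> V n" "x \<in> fst v" "p < snd v" "i < snd v"
  shows "(T ^^ p) x \<in> level v i \<longleftrightarrow> i = p"
  using tower_unique(2)[OF assms(1,1,2) _ assms(3,4)] assms(2) by auto

lemma h_W_mono:
  assumes "v \<in> V n"
  shows "h_W T v = (cp_mono (\<Union>l<snd v. level v l) 0 :: ('x, 'k) cp)"
proof (intro ext)
  fix d x
  show "h_W T v d x = (cp_mono (\<Union>l<snd v. level v l) 0 d x :: 'k)"
  proof (cases "\<exists>p<snd v. x \<in> level v p")
    case True
    then obtain p w where p: "p < snd v" "w \<in> fst v" "x = (T ^^ p) w" by blast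
    have "h_W T v d x = (\<Sum>l<snd v. if l = p then (if d = 0 then 1 else 0) else 0 :: 'k)"
      unfolding h_W_def cp_sum_def cp_chi_def
      by (intro sum.cong) (auto simp: p(3) mem_level_iff[OF assms p(2,1)])
    then show ?thesis using True p(1) by (auto simp: cp_mono_def)
  next
    case False
    then have "h_W T v d x = 0" unfolding h_W_def cp_sum_def cp_chi_def by (intro sum.neutral) auto
    then show ?thesis using False by (auto simp: cp_mono_def)
  qed
qed

text \<open>Evaluation on level \<open>p\<close> in degree \<open>d\<close> picks out the unit with
  \<open>i = p\<close> and \<open>j = p - d\<close>: the levels are disjoint and the degree fixes
  the column.\<close>

lemma sum_matrix_units:
  fixes c :: "nat \<Rightarrow> nat \<Rightarrow> 'k"
  assumes v: "v \<in> V n" and x: "x \<in> fst v" "p < snd v"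
  shows "cp_sum (\<lambda>(i, j). cp_smult (c i j) (e_W T cj E n v i j)) ({..<snd v} \<times> {..<snd v}) d ((T ^^ p) x) =
    (if 0 \<le> int p - d \<and> int p - d < int (snd v) then c p (nat (int p - d)) else 0)"
proof -
  let ?k = "snd v"
  have "cp_sum (\<lambda>(i, j). cp_smult (c i j) (e_W T cj E n v i j)) ({..<?k} \<times> {..<?k}) d ((T ^^ p) x) =
      (\<Sum>i<?k. \<Sum>j<?k. c i j * cp_mono (level v i) (int i - int j) d ((T ^^ p) x))"
    unfolding cp_sum_def sum.cartesian_product
    by (intro sum.cong) (auto simp: cp_smult_def e_W_mono[OF v])
  also have "\<dots> = (\<Sum>i<?k. if i = p then (\<Sum>j<?k. if int j = int p - d then c p j else 0) else 0)"
    by (intro sum.cong) (auto simp: cp_mono_def mem_level_iff[OF v x] intro!: sum.cong)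
  also have "\<dots> = (\<Sum>j<?k. if int j = int p - d then c p j else 0)" using x by simp
  also have "\<dots> = (if 0 \<le> int p - d \<and> int p - d < int ?k then c p (nat (int p - d)) else 0)"
  proof (cases "0 \<le> int p - d \<and> int p - d < int ?k")
    case True
    then have "(\<Sum>j<?k. if int j = int p - d then c p j else 0) =
        (\<Sum>j<?k. if j = nat (int p - d) then c p j else 0)" by (intro sum.cong) auto
    also have "\<dots> = c p (nat (int p - d))" using True by (auto simp: nat_less_iff)
    finally show ?thesis using True by simp
  next
    case False
    then show ?thesis by (auto intro!: sum.neutral)
  qed
  finally show ?thesis .
qed

text \<open>The coefficients exist because on the tower both sides read the same kernel and off it
  both vanish; they are unique because each can be read off on the orbit of the base point.\<close>

lemma pi_n_eq:
  assumes a: "repr n a c" and c: "c \<in> R n" shows "pi_n T cj E P n a = c"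
proof (intro ext)
  fix v i j
  show "pi_n T cj E P n a v i j = c v i j"
  proof (cases "v \<in> V n")
    case v: True
    let ?S = "\<lambda>c. cp_sum (\<lambda>(i, j). cp_smult (c i j) (e_W T cj E n v i j)) ({..<snd v} \<times> {..<snd v})"
    have h: "cp_mult T (h_W T v) a = (\<lambda>d x. if x \<in> (\<Union>l<snd v. level v l) then a d x else 0)"
      unfolding h_W_mono[OF v] cp_mult_mono_left by (auto intro!: ext)
    have "(THE c. (\<forall>i j. \<not> (i < snd v \<and> j < snd v) \<longrightarrow> c i j = 0) \<and>
        cp_mult T (h_W T v) a = ?S c) = c v"
    proof (rule the_equality, rule conjI)
      show "\<forall>i j. \<not> (i < snd v \<and> j < snd v) \<longrightarrow> c v i j = 0" using R_zero[OF c] by blast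
      show "cp_mult T (h_W T v) a = ?S (c v)"
      proof (intro ext)
        fix d x
        show "cp_mult T (h_W T v) a d x = ?S (c v) d x"
        proof (cases "\<exists>p<snd v. x \<in> level v p")
          case True
          then obtain p w where p: "p < snd v" "w \<in> fst v" "x = (T ^^ p) w" by blast
          have "cp_mult T (h_W T v) a d x = a d x" unfolding h using p by auto
          also have "\<dots> = ?S (c v) d x"
            using sum_matrix_units[OF v p(2,1), of "c v" d] reprD[OF a v p(2,1), of "int p - d"] p(3) by simp
          finally show ?thesis .
        next
          case False
          then have "?S (c v) d x = 0"
            unfolding cp_sum_def
            by (intro sum.neutral) (auto simp: cp_smult_def e_W_mono[OF v] cp_mono_def)
          then show ?thesis unfolding h using False by auto
        qed
      qed
    next
      fix c' assume c': "(\<forall>i j. \<not> (i < snd v \<and> j < snd v) \<longrightarrow> c' i j = 0) \<and>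
        cp_mult T (h_W T v) a = ?S c'"
      show "c' = c v"
      proof (intro ext)
        fix p q
        show "c' p q = c v p q"
        proof (cases "p < snd v \<and> q < snd v")
          case True
          have x: "base v \<in> fst v" by (rule base_in[OF v])
          let ?d = "int p - int q"
          have "c' p q = ?S c' ?d ((T ^^ p) (base v))"
            using sum_matrix_units[OF v x, of p c' ?d] True by simp
          also have "\<dots> = cp_mult T (h_W T v) a ?d ((T ^^ p) (base v))" using c' by simp
          also have "\<dots> = a ?d ((T ^^ p) (base v))" unfolding h using True x by auto
          also have "\<dots> = c v p q" using reprD[OF a v x, of p "int q"] True by simp
          finally show ?thesis .
        next
          case False
          then show ?thesis using c' R_zero[OF c, of v p q] by auto
        qed
      qed
    qed
    then show ?thesis unfolding pi_n_def using v by simp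
  next
    case False
    then show ?thesis unfolding pi_n_def using R_zero[OF c, of v i j] by simp
  qed
qed

lemma pi_n_An: "a \<in> An n \<Longrightarrow> pi_n T cj E P n a = comp n a"
  by (rule pi_n_eq[OF An_repr comp_R])

subsection \<open>Density\<close>

text \<open>The generators of \<open>An n\<close> add up to \<open>s_n\<close>, because
  \<open>P n\<close> partitions the complement of \<open>E n\<close>.\<close>

lemma s_n_An: "s_n T E n \<in> An n"
proof -
  have "cp_sum (\<lambda>Z. cp_mono Z 1) (P n) = (cp_mono (- E n) 1 :: ('x, 'k) cp)"
  proof (intro ext)
    fix d x
    show "cp_sum (\<lambda>Z. cp_mono Z 1) (P n) d x = (cp_mono (- E n) 1 d x :: 'k)"
    proof (cases "\<exists>Z\<in>P n. x \<in> Z")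
      case True
      then obtain Z where Z: "Z \<in> P n" "x \<in> Z" by blast
      have "x \<in> Z' \<longleftrightarrow> Z' = Z" if "Z' \<in> P n" for Z' using atom_unique[of Z' n Z x] that Z by blast
      then have "cp_sum (\<lambda>Z. cp_mono Z 1) (P n) d x = (\<Sum>Z'\<in>P n. if Z' = Z then (if d = 1 then 1 else 0) else 0 :: 'k)"
        unfolding cp_sum_def cp_mono_def by (intro sum.cong) auto
      also have "\<dots> = (if d = 1 then 1 else 0)" using Z P_part by simp
      finally show ?thesis using Z P_part by (auto simp: cp_mono_def)
    next
      case False
      then have "cp_sum (\<lambda>Z. cp_mono Z 1) (P n) d x = (0 :: 'k)"
        unfolding cp_sum_def cp_mono_def by (intro sum.neutral) auto
      moreover have "x \<in> E n" using False P_part by blast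
      ultimately show ?thesis by (simp add: cp_mono_def)
    qed
  qed
  moreover have "cp_sum (\<lambda>Z. cp_mono Z 1) (P n) \<in> An n"
    by (rule An_sum) (use P_part An_gen in auto)
  ultimately show ?thesis unfolding s_n_mono by simp
qed

lemma An_compl: "cp_mono U 0 \<in> An n \<Longrightarrow> cp_mono (- U) 0 \<in> An n"
proof -
  assume "cp_mono U 0 \<in> An n"
  then have "cp_add cp_one (cp_smult (- 1) (cp_mono U 0)) \<in> An n" by (intro An_closed)
  moreover have "cp_add cp_one (cp_smult (- 1) (cp_mono U 0)) = (cp_mono (- U) 0 :: ('x, 'k) cp)"
    by (auto simp: cp_add_def cp_smult_def cp_one_def cp_mono_def intro!: ext)
  ultimately show ?thesis by simp
qed

text \<open>The products of \<open>s_n\<close> with its adjoint, in the two orders, are the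
  indicators of the complement of \<open>E n\<close> and of the preimage of that complement under
  \<open>T\<close>.\<close>

lemma An_chi_E: "cp_mono (E n) 0 \<in> An n" "cp_mono {x. T x \<in> E n} 0 \<in> An n"
proof -
  note s = s_n_An[of n, unfolded s_n_mono]
  have "cp_mult T (cp_mono (- E n) 1) (cp_star T cj (cp_mono (- E n) 1)) \<in> An n"
    using s by (intro An_closed)
  then have "cp_mono (- E n) 0 \<in> An n" by (simp add: cp_star_mono cp_mult_mono Compl_eq)
  then show "cp_mono (E n) 0 \<in> An n" using An_compl[of "- E n" n] by simp
  have "cp_mult T (cp_star T cj (cp_mono (- E n) 1)) (cp_mono (- E n) 1) \<in> An n"
    using s by (intro An_closed)
  then have "cp_mono {x. T x \<notin> E n} 0 \<in> An n" by (simp add: cp_star_mono cp_mult_mono)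
  then show "cp_mono {x. T x \<in> E n} 0 \<in> An n" using An_compl[of "{x. T x \<notin> E n}" n] by (simp add: Compl_eq)
qed

text \<open>Conjugation of the indicator of \<open>B\<close> by the generator of \<open>Z\<close>,
  which prepends one letter to an itinerary.\<close>

lemma An_pullback:
  assumes "Z \<in> P n" "cp_mono B 0 \<in> An n" shows "cp_mono {x. T x \<in> Z \<and> T x \<in> B} 0 \<in> An n"
proof -
  have "cp_mult T (cp_mult T (cp_star T cj (cp_mono Z 1)) (cp_mono B 0)) (cp_mono Z 1) \<in> An n"
    using assms An_gen by (intro An_closed)
  moreover have "{x. (T x \<in> Z \<and> T x \<in> B) \<and> T x \<in> Z} = {x. T x \<in> Z \<and> T x \<in> B}" by blast
  ultimately show ?thesis by (simp add: cp_star_mono cp_mult_mono)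
qed

text \<open>The word is read backwards: starting from the final return to \<open>E n\<close>, each
  pullback adds the preceding letter, and intersecting with \<open>E n\<close> adds the
  start.\<close>

lemma An_chi_base:
  assumes v: "v \<in> V n" shows "cp_mono (fst v) 0 \<in> An n"
proof -
  obtain x where x: "x \<in> fst v" using V_nonempty_base[OF v] by blast
  let ?k = "snd v"
  \<comment> \<open>Agreement of the next \<open>m\<close> steps of \<open>z\<close> with the last
    \<open>m\<close> letters of the word of \<open>x\<close>; for \<open>m\<close> equal to the
    height the offset is 0.\<close>
  define B where "B m = {z. \<forall>i\<in>{1..m}. atom_eq n ((T ^^ (?k - m + i)) x) ((T ^^ i) z)}" for m
  have "1 \<le> m \<Longrightarrow> m \<le> ?k \<Longrightarrow> cp_mono (B m) 0 \<in> An n" for m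
  proof (induction m rule: nat_induct_at_least[of 1])
    case base
    have "(T ^^ ?k) x \<in> E n" using V_level_E[OF v x, of ?k] by simp
    then have "B 1 = {z. T z \<in> E n}"
      using V_height[OF v] atom_eq_iff_mem[of "E n" n "(T ^^ ?k) x"] by (auto simp: B_def)
    then show ?case using An_chi_E(2) by simp
  next
    case (Suc m)
    have k: "?k - m = Suc (?k - Suc m)" using Suc by simp
    have "(T ^^ (?k - m)) x \<notin> E n" using V_level_E[OF v x, of "?k - m"] Suc by auto
    then obtain Z where Z: "Z \<in> P n" "(T ^^ (?k - m)) x \<in> Z" using atom_exists[of n] by blast
    have "B (Suc m) = {z. T z \<in> Z \<and> T z \<in> B m}"
    proof (intro set_eqI iffI)
      fix z assume z: "z \<in> B (Suc m)"
      have "atom_eq n ((T ^^ (?k - Suc m + 1)) x) ((T ^^ 1) z)" using z unfolding B_def by force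
      then have "T z \<in> Z" using atom_eq_iff_mem[of Z n _ "T z"] Z k by simp
      moreover have "atom_eq n ((T ^^ (?k - m + i)) x) ((T ^^ i) (T z))" if "i \<in> {1..m}" for i
      proof -
        have "atom_eq n ((T ^^ (?k - Suc m + Suc i)) x) ((T ^^ Suc i) z)"
          using z that unfolding B_def by fastforce
        then show ?thesis using k by (simp add: funpow_swap1)
      qed
      ultimately show "z \<in> {z. T z \<in> Z \<and> T z \<in> B m}" by (simp add: B_def)
    next
      fix z assume z: "z \<in> {z. T z \<in> Z \<and> T z \<in> B m}"
      have "atom_eq n ((T ^^ (?k - Suc m + i)) x) ((T ^^ i) z)" if i: "i \<in> {1..Suc m}" for i
      proof (cases "i = 1")
        case True
        then show ?thesis using z Z k atom_eq_iff_mem[of Z n "(T ^^ (?k - m)) x" "T z"] by simp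
      next
        case False
        then obtain l where l: "i = Suc l" "l \<in> {1..m}" using i by (cases i) auto
        have "atom_eq n ((T ^^ (?k - m + l)) x) ((T ^^ l) (T z))" using z l by (simp add: B_def)
        then show ?thesis using k l by (simp add: funpow_swap1)
      qed
      then show "z \<in> B (Suc m)" by (simp add: B_def)
    qed
    moreover have "cp_mono (B m) 0 \<in> An n" using Suc by simp
    ultimately show ?case using An_pullback[OF Z(1)] by simp
  qed
  then have "cp_mono (B ?k) 0 \<in> An n" using V_height[OF v] by simp
  then have "cp_mult T (cp_mono (E n) 0) (cp_mono (B ?k) 0) \<in> An n" using An_chi_E(1) by (intro An_closed)
  moreover have "{z \<in> E n. z \<in> B ?k} = fst v"
  proof -
    have xE: "x \<in> E n" using V_level_E[OF v x, of 0] by simp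
    have "z \<in> cyl n x ?k \<longleftrightarrow> z \<in> E n \<and> z \<in> B ?k" for z
    proof -
      have split: "(\<forall>i\<le>?k. Q i) \<longleftrightarrow> Q 0 \<and> (\<forall>i\<in>{1..?k}. Q i)" for Q :: "nat \<Rightarrow> bool"
      proof (intro iffI allI impI)
        fix i assume "Q 0 \<and> (\<forall>i\<in>{1..?k}. Q i)" "i \<le> ?k"
        then show "Q i" by (cases "i = 0") auto
      qed auto
      have "z \<in> cyl n x ?k \<longleftrightarrow> atom_eq n x z \<and> z \<in> B ?k"
        unfolding cyl_def B_def mem_Collect_eq split by simp
      then show ?thesis using atom_eq_iff_mem[of "E n" n x z] xE by simp
    qed
    then show ?thesis using V_D(2)[OF v x] by blast
  qed
  ultimately show ?thesis by (simp add: cp_mult_mono)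
qed

text \<open>The units of column 0 are obtained by climbing the tower with left multiplication by
  \<open>s_n\<close>; a general unit is one of these times the adjoint of another.\<close>

lemma An_matrix_unit:
  assumes v: "v \<in> V n" and "i < snd v" "j < snd v"
  shows "cp_mono (level v i) (int i - int j) \<in> An n"
proof -
  have col: "cp_mono (level v i) (int i) \<in> An n" if "i < snd v" for i
    using that
  proof (induction i)
    case 0
    then show ?case using An_chi_base[OF v] by simp
  next
    case (Suc i)
    have "{x \<in> - E n. Tpow T (- 1) x \<in> level v i} = level v (Suc i)"
    proof (intro set_eqI iffI)
      fix x assume "x \<in> {x \<in> - E n. Tpow T (- 1) x \<in> level v i}"
      then obtain w where w: "w \<in> fst v" "Tpow T (- 1) x = (T ^^ i) w" by blast
      then have "x = (T ^^ Suc i) w" using Tpow_1(3)[of x] by simp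
      then show "x \<in> level v (Suc i)" using w by blast
    next
      fix x assume "x \<in> level v (Suc i)"
      then obtain w where w: "w \<in> fst v" "x = (T ^^ Suc i) w" by blast
      then have "x \<notin> E n" using V_level_E[OF v w(1), of "Suc i"] Suc by auto
      moreover have "Tpow T (- 1) x = (T ^^ i) w" using w by simp
      ultimately show "x \<in> {x \<in> - E n. Tpow T (- 1) x \<in> level v i}" using w by auto
    qed
    moreover have "cp_mult T (cp_mono (- E n) 1) (cp_mono (level v i) (int i)) \<in> An n"
      using Suc s_n_An[of n, unfolded s_n_mono] by (intro An_closed) auto
    ultimately show ?case by (simp add: cp_mult_mono)
  qed
  have "cp_mult T (cp_mono (level v i) (int i)) (cp_star T cj (cp_mono (level v j) (int j))) \<in> An n"
    using col assms by (intro An_closed) auto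
  moreover have "{x \<in> level v i. Tpow T (- int i) x \<in> {x. Tpow T (int j) x \<in> level v j}} = level v i"
    unfolding funpow_image_eq using Tpow_cancel(2)[OF bij_T, of "int j"] by auto
  ultimately show ?thesis by (simp add: cp_star_mono cp_mult_mono)
qed

text \<open>The witness is the combination of matrix units over the towers in \<open>S\<close>;
  disjointness of towers keeps the other members of \<open>S\<close> from contributing to the block
  of \<open>v\<close>.\<close>

lemma An_truncation:
  fixes c :: "('x, 'k) RR"
  assumes S: "finite S" "S \<subseteq> V n"
  obtains a where "a \<in> An n" "\<And>v p q. v \<in> S \<Longrightarrow> p < snd v \<Longrightarrow> q < snd v \<Longrightarrow> comp n a v p q = c v p q"
proof
  let ?F = "\<lambda>v. cp_sum (\<lambda>(i, j). cp_smult (c v i j) (e_W T cj E n v i j)) ({..<snd v} \<times> {..<snd v})"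
  show "cp_sum ?F S \<in> An n"
  proof (rule An_sum[OF S(1)], rule An_sum)
    fix v s assume "v \<in> S" "s \<in> {..<snd v} \<times> {..<snd v}"
    then show "(case s of (i, j) \<Rightarrow> cp_smult (c v i j) (e_W T cj E n v i j)) \<in> An n"
      using S An_matrix_unit[of v n] e_W_mono[of v n] by (cases s) (auto intro!: An_closed)
  qed simp
  fix v p q assume v: "v \<in> S" "p < snd v" "q < snd v"
  have vV: "v \<in> V n" using v S by blast
  have x: "base v \<in> fst v" by (rule base_in[OF vV])
  have "?F w d ((T ^^ p) (base v)) = 0" if w: "w \<in> S" "w \<noteq> v" for w d
    unfolding cp_sum_def
  proof (intro sum.neutral ballI)
    fix s assume s: "s \<in> {..<snd w} \<times> {..<snd w}"
    obtain i j where ij: "s = (i, j)" "i < snd w" "j < snd w" using s by (cases s) auto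
    have wV: "w \<in> V n" using w S by blast
    have "(T ^^ p) (base v) \<notin> level w i"
    proof
      assume "(T ^^ p) (base v) \<in> level w i"
      then obtain w' where w': "w' \<in> fst w" "(T ^^ p) (base v) = (T ^^ i) w'" by blast
      have "v = w" by (rule tower_unique(1)[OF vV wV x w'(1) v(2) ij(2) w'(2)])
      then show False using w by simp
    qed
    then show "(case s of (i, j) \<Rightarrow> cp_smult (c w i j) (e_W T cj E n w i j)) d ((T ^^ p) (base v)) = 0"
      using ij e_W_mono[OF wV ij(2,3)] by (simp add: cp_smult_def cp_mono_def)
  qed
  then have "cp_sum ?F S (int p - int q) ((T ^^ p) (base v)) = ?F v (int p - int q) ((T ^^ p) (base v))"
    unfolding cp_sum_def[of ?F S] using S(1) v(1)
    by (subst sum.remove[OF S(1) v(1)]) (simp add: sum.neutral)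
  also have "\<dots> = c v p q" using sum_matrix_units[OF vV x v(2), of "c v"] v by simp
  finally show "comp n (cp_sum ?F S) v p q = c v p q" using vV v by (simp add: comp_def)
qed

text \<open>Finitely many towers carry volume above \<open>1 - e\<close>. Matching \<open>c\<close>
  exactly on them leaves blocks of rank at most their height, so the remaining rank is at most the
  tail of the volume sum.\<close>

lemma An_dense:
  fixes c :: "('x, 'k) RR"
  assumes "e > 0"
  shows "\<exists>a\<in>An n. rk n (sub c (comp n a)) < e"
proof -
  have "\<exists>S. finite S \<and> S \<subseteq> V n \<and> sum vol S > 1 - e"
  proof (rule ccontr)
    assume "\<not> ?thesis"
    then have "infsum vol (V n) \<le> 1 - e" by (intro infsum_le_finite_sums[OF summable_vol]) (meson not_le)
    then show False using infsum_vol assms by simp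
  qed
  then obtain S where S: "finite S" "S \<subseteq> V n" "sum vol S > 1 - e" by blast
  obtain a where a: "a \<in> An n"
    "\<And>v p q. v \<in> S \<Longrightarrow> p < snd v \<Longrightarrow> q < snd v \<Longrightarrow> comp n a v p q = c v p q"
    using An_truncation[OF S(1,2)] by metis
  let ?d = "sub c (comp n a)"
  let ?f = "\<lambda>v. measure \<mu> (fst v) * real (mat_rank (snd v) (?d v))"
  have z: "?f v = 0" if "v \<in> S" for v
  proof -
    have "mat_rank (snd v) (?d v) = mat_rank (snd v) (\<lambda>i j. 0 :: 'k)"
      by (rule mat_rank_cong) (use a(2) that in \<open>auto simp: R_add_def R_smult_def\<close>)
    then show ?thesis by simp
  qed
  have "rk n ?d = infsum ?f (V n - S)"
    unfolding rkR_def by (rule infsum_cong_neutral) (use z S in auto)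
  also have "\<dots> \<le> infsum vol (V n - S)"
  proof (rule infsum_mono)
    show "?f summable_on V n - S" using summable_rk by (rule summable_on_subset_banach) blast
    show "vol summable_on V n - S" using summable_vol by (rule summable_on_subset_banach) blast
    show "?f v \<le> vol v" for v unfolding vol_def by (intro mult_left_mono) (simp_all add: mat_rank_le_dim)
  qed
  also have "\<dots> = infsum vol (V n) - infsum vol S"
    by (rule infsum_Diff[OF summable_vol _ S(2)]) (use S(1) in simp)
  also have "\<dots> < e" using S infsum_vol by simp
  finally show ?thesis using a by blast
qed

end

section \<open>The embedding of the crossed product\<close>

context tower_system_star
begin

definition Phi :: "('x, 'k) cp \<Rightarrow> ('x, 'k) zseq set" where "Phi a = cl (ph a)"

lemma CP_t: "cp_mono UNIV d \<in> (CP :: ('x, 'k) cp set)"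
  by (rule CP_mono) auto

lemma Phi_Rrk: "a \<in> CP \<Longrightarrow> Phi a \<in> Rrk \<mu> T E P"
  unfolding Rrk_iff Phi_def using cauchy_ph by blast

text \<open>Truncation is linear, so the distance of the two images is the limit of the ranks of the
  truncated difference, which is 0 only for the zero element.\<close>

lemma Phi_inj: "inj_on Phi CP"
proof (rule inj_onI)
  fix a b :: "('x, 'k) cp" assume ab: "a \<in> CP" "b \<in> CP" "Phi a = Phi b"
  let ?d = "cp_add a (cp_smult (- 1) b)"
  have "(\<lambda>k. dd (ph a k) (ph b k)) \<longlonglongrightarrow> 0"
    using cl_eqD[OF cauchy_ph[OF ab(2)]] ab(3) by (simp add: Phi_def)
  then have "(\<lambda>k. rk k (comp k ?d)) \<longlonglongrightarrow> 0" by (simp add: dd_comp comp_add comp_smult)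
  then have "?d = cp_zero" using rk_comp_limit_pos[of ?d] CP_add CP_smult ab by blast
  then show "a = b" by (simp add: cp_add_def cp_smult_def cp_zero_def fun_eq_iff)
qed

lemma Phi_add:
  assumes "a \<in> CP" "b \<in> CP" shows "Phi (cp_add a b) = Rrk_add \<mu> T E P (Phi a) (Phi b)"
  unfolding Phi_def Rrk_add_cl[OF cauchy_ph[OF assms(1)] cauchy_ph[OF assms(2)]]
  by (simp add: zop_def comp_add)

lemma Phi_smult:
  assumes "a \<in> CP" shows "Phi (cp_smult c a) = Rrk_smult \<mu> T E P c (Phi a)"
  unfolding Phi_def Rrk_smult_cl[OF cauchy_ph[OF assms]] by (simp add: zsmult_def comp_smult)

lemma Phi_mult:
  assumes "a \<in> CP" "b \<in> CP" shows "Phi (cp_mult T a b) = Rrk_mult \<mu> T E P (Phi a) (Phi b)"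
  unfolding Phi_def Rrk_mult_cl[OF cauchy_ph[OF assms(1)] cauchy_ph[OF assms(2)]]
proof (rule cl_eqI[OF cauchy_ph[OF CP_mult[OF assms]] cauchy_mult[OF cauchy_ph[OF assms(1)] cauchy_ph[OF assms(2)]]])
  obtain D N :: nat where D: "\<forall>i x. a i x \<noteq> 0 \<longrightarrow> \<bar>i\<bar> \<le> int D"
    and "\<forall>n\<ge>N. \<forall>i x z. atom_eq n x z \<longrightarrow> a i x = a i z" by (rule CP_bounds[OF assms(1)])
  have le: "dd (ph (cp_mult T a b) k) (zop R_mult (ph a k) (ph b k)) \<le> measure \<mu> (halo k D)" for k
    using comp_mult_close[OF assms(1), of D k b] D by (simp add: dinf_def Let_def zop_def)
  show "(\<lambda>k. dd (ph (cp_mult T a b) k) (zop R_mult (ph a k) (ph b k))) \<longlonglongrightarrow> 0"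
    by (rule tendsto_sandwich[OF _ _ tendsto_const halo_tendsto_0[of D]]) (use le in auto)
qed

lemma Phi_one: "Phi cp_one = Rrk_one \<mu> T E P"
proof -
  have v: "valid (0, R_one T E P 0 :: ('x, 'k) RR)" by (simp add: valid_def R_closed)
  have "lift (0, R_one T E P 0) k = (R_one T E P k :: ('x, 'k) RR)" for k
    unfolding lv_def using jup_one[of 0 k] by simp
  then have "dd (ph cp_one k) (0, R_one T E P 0 :: ('x, 'k) RR) = 0" for k
    by (simp add: dinf_def Let_def comp_one sub_self)
  then show ?thesis unfolding Phi_def Rrk_one_def
    by (intro cl_eqI[OF cauchy_ph[OF CP_t[of 0, folded cp_mono_simps(3)]] cauchy_const[OF v]]) simp
qed

lemma dd_An:
  assumes "a \<in> An n" "n \<le> k" shows "dd (n, comp n a) (k, comp k a) = 0"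
proof -
  have "lift (n, comp n a) k = comp k a"
    unfolding lv_def using jup_eq_comp[OF An_repr[OF assms(1)] comp_R, of "k - n"] assms(2) by simp
  then show ?thesis using assms(2) by (simp add: dinf_def Let_def max_def sub_self)
qed

text \<open>\<open>pi_inf\<close> uses the least level containing \<open>a\<close>; from there on
  the truncations are exact lifts of a single matrix, so the two sequences are eventually at
  distance 0.\<close>

lemma Phi_pi_inf:
  assumes "a \<in> A_inf T cj P" shows "Phi a = pi_inf \<mu> T cj E P a"
proof -
  define n where "n = (LEAST n. a \<in> An n)"
  have n: "a \<in> An n" unfolding n_def using assms by (auto simp: A_inf_def intro: LeastI)
  have "\<forall>\<^sub>F k in sequentially. dd (ph a k) (n, comp n a) = 0"
    unfolding eventually_sequentially using dd_An[OF n] dd_sym by metis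
  then have "(\<lambda>k. dd (ph a k) (n, comp n a)) \<longlonglongrightarrow> 0" by (rule tendsto_eventually)
  then have "cl (ph a) = cl (\<lambda>k. (n, comp n a))"
    by (rule cl_eqI[OF cauchy_ph[OF An_CP[OF n]] cauchy_const[OF valid_comp]])
  then show ?thesis unfolding Phi_def pi_inf_def iota_def n_def[symmetric] Let_def pi_n_An[OF n] .
qed

lemma A_inf_CP: "a \<in> A_inf T cj P \<Longrightarrow> a \<in> CP"
  using An_CP by (auto simp: A_inf_def)

text \<open>At every level from \<open>n\<close> on, the truncations of \<open>s_n\<close> and
  \<open>t\<close> differ only in rows lying in \<open>E n\<close>, so the limit distance is at most
  the measure of \<open>E n\<close>.\<close>

lemma pi_inf_s_n_tendsto:
  "(\<lambda>n. rkC \<mu> T E P (Rrk_sub \<mu> T E P (pi_inf \<mu> T cj E P (s_n T E n)) (Phi cp_t))) \<longlonglongrightarrow> 0"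
proof -
  have "s_n T E n \<in> A_inf T cj P" for n using s_n_An by (auto simp: A_inf_def)
  note pi = Phi_pi_inf[OF this, symmetric]
  have t: "cp_t \<in> (CP :: ('x, 'k) cp set)" unfolding cp_mono_simps by (rule CP_t)
  have s: "s_n T E n \<in> (CP :: ('x, 'k) cp set)" for n using An_CP[OF s_n_An] .
  let ?r = "\<lambda>n. rkC \<mu> T E P (Rrk_sub \<mu> T E P (Phi (s_n T E n)) (Phi cp_t))"
  have lim: "(\<lambda>k. dd (ph (s_n T E n) k) (ph (cp_t :: ('x, 'k) cp) k)) \<longlonglongrightarrow> ?r n" for n
    unfolding Phi_def by (rule rkC_sub_cl[OF cauchy_ph[OF s] cauchy_ph[OF t]])
  have le: "dd (ph (s_n T E n) k) (ph (cp_t :: ('x, 'k) cp) k) \<le> measure \<mu> (E n)" if "n \<le> k" for n k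
    unfolding dd_comp
  proof (rule rk_le_measure[OF _ borel_E])
    fix v p q assume v: "v \<in> V k" "p < snd v" "q < snd v"
      and ne: "sub (comp k (s_n T E n)) (comp k (cp_t :: ('x, 'k) cp)) v p q \<noteq> 0"
    have "(T ^^ p) (base v) \<in> E n"
      using ne v by (auto simp: R_add_def R_smult_def comp_def s_n_mono cp_mono_simps cp_mono_def split: if_splits)
    then have "(T ^^ p) w \<in> E n" if "w \<in> fst v" for w
      using atom_eq_E[OF atom_eq_mono[OF \<open>n \<le> k\<close> V_atom_eq[OF v(1) base_in[OF v(1)] that]], of p] v(2) by simp
    then show "level v p \<subseteq> E n" by blast
  qed
  have "?r n \<le> measure \<mu> (E n)" for n
    by (rule LIMSEQ_le_const2[OF lim]) (use le in blast)
  moreover have "0 \<le> ?r n" for n by (rule LIMSEQ_le_const[OF lim]) simp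
  ultimately show ?thesis unfolding pi
    by (intro tendsto_sandwich[OF _ _ tendsto_const measure_E_tendsto_0]) auto
qed

lemma Phi_t_invertible:
  "\<exists>Y\<in>Rrk \<mu> T E P. Rrk_mult \<mu> T E P (Phi cp_t) Y = Rrk_one \<mu> T E P
     \<and> Rrk_mult \<mu> T E P Y (Phi cp_t) = Rrk_one \<mu> T E P"
proof (intro bexI conjI)
  let ?u = "cp_mono UNIV (- 1) :: ('x, 'k) cp"
  show "Phi ?u \<in> Rrk \<mu> T E P" by (rule Phi_Rrk[OF CP_t])
  show "Rrk_mult \<mu> T E P (Phi cp_t) (Phi ?u) = Rrk_one \<mu> T E P"
    unfolding cp_mono_simps Phi_mult[OF CP_t CP_t, symmetric] Phi_one[symmetric] by (simp add: cp_mult_mono)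
  show "Rrk_mult \<mu> T E P (Phi ?u) (Phi cp_t) = Rrk_one \<mu> T E P"
    unfolding cp_mono_simps Phi_mult[OF CP_t CP_t, symmetric] Phi_one[symmetric] by (simp add: cp_mult_mono)
qed

lemma Phi_faithful: "a \<in> CP \<Longrightarrow> rkC \<mu> T E P (Phi a) = 0 \<Longrightarrow> a = cp_zero"
  using rkC_cl[OF cauchy_ph, of a] rk_comp_limit_pos[of a] by (simp add: Phi_def)

lemma pi_inf_faithful:
  "a \<in> A_inf T cj P \<Longrightarrow> rkC \<mu> T E P (pi_inf \<mu> T cj E P a) = 0 \<Longrightarrow> a = cp_zero"
  using Phi_faithful[OF A_inf_CP] Phi_pi_inf by simp

lemma Phi_dense:
  assumes "Y \<in> Rrk \<mu> T E P" "e > 0"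
  shows "\<exists>a\<in>A_inf T cj P. rkC \<mu> T E P (Rrk_sub \<mu> T E P (Phi a) Y) < e"
proof -
  obtain s where s: "cauchy s" "Y = cl s" using assms(1) unfolding Rrk_iff by blast
  \<comment> \<open>A late term of \<open>s\<close> is within \<open>e / 3\<close> of all later
    ones, and an element of the subalgebra is within \<open>e / 3\<close> of that term. The limit is
    then at most \<open>2 * e / 3\<close>, which leaves room for the strict inequality.\<close>
  have e3: "e / 3 > 0" using assms by simp
  obtain K where K: "\<forall>p\<ge>K. \<forall>q\<ge>K. dd (s p) (s q) < e / 3" using cauchyD[OF s(1) e3] by blast
  obtain n c where nc: "s K = (n, c)" by (cases "s K")
  obtain a where a: "a \<in> An n" "rk n (sub c (comp n a)) < e / 3" using An_dense[OF e3] by blast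
  have val: "valid (s k)" for k by (rule cauchy_valid[OF s(1)])
  have le: "dd (ph a k) (s k) \<le> 2 * e / 3" if "k \<ge> max n K" for k
  proof -
    have "dd (ph a k) (s k) \<le> dd (ph a k) (n, comp n a) + dd (n, comp n a) (s k)"
      by (intro dd_triangle valid_comp val)
    moreover have "dd (ph a k) (n, comp n a) = 0"
      using dd_An[OF a(1), of k] that dd_sym[of "(n, comp n a)" "(k, comp k a)"] by simp
    moreover have "dd (n, comp n a) (s k) \<le> dd (n, comp n a) (s K) + dd (s K) (s k)"
      by (intro dd_triangle valid_comp val)
    moreover have "dd (n, comp n a) (s K) < e / 3"
      using a(2) unfolding nc dd_sym[of "(n, comp n a)"] by (simp add: dinf_def Let_def)
    moreover have "dd (s K) (s k) < e / 3" using K that by simp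
    ultimately show ?thesis by linarith
  qed
  have "(\<lambda>k. dd (ph a k) (s k)) \<longlonglongrightarrow> rkC \<mu> T E P (Rrk_sub \<mu> T E P (Phi a) Y)"
    unfolding Phi_def s(2) by (rule rkC_sub_cl[OF cauchy_ph[OF An_CP[OF a(1)]] s(1)])
  then have "rkC \<mu> T E P (Rrk_sub \<mu> T E P (Phi a) Y) \<le> 2 * e / 3"
    by (rule LIMSEQ_le_const2) (use le in blast)
  then have "rkC \<mu> T E P (Rrk_sub \<mu> T E P (Phi a) Y) < e" using assms(2) by linarith
  moreover have "a \<in> A_inf T cj P" using a(1) by (auto simp: A_inf_def)
  ultimately show ?thesis by blast
qed

end

theorem theorem4p7:
  fixes T :: "'x::metric_space \<Rightarrow> 'x" and cj :: "'k::field \<Rightarrow> 'k" and \<mu> :: "'x measure"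
    and y :: 'x and E :: "nat \<Rightarrow> 'x set" and P :: "nat \<Rightarrow> 'x set set"
  assumes X_infinite: "infinite (UNIV :: 'x set)"
    and X_compact: "compact (UNIV :: 'x set)"
    and X_tot_disc: "\<forall>S :: 'x set. connected S \<longrightarrow> (\<exists>a. S \<subseteq> {a})"
    and T_homeo: "\<exists>T'. homeomorphism UNIV UNIV T T'"
    and cj_invol: "\<forall>a. cj (cj a) = a"
    and cj_add: "\<forall>a b. cj (a + b) = cj a + cj b"
    and cj_mult: "\<forall>a b. cj (a * b) = cj a * cj b"
    and mu_sets: "sets \<mu> = sets borel"
    and mu_prob: "prob_space \<mu>"
    and mu_full: "\<forall>U. open U \<and> U \<noteq> {} \<longrightarrow> measure \<mu> U > 0"
    and mu_inv: "\<forall>A \<in> sets borel. measure \<mu> (T -` A) = measure \<mu> A"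
    and mu_erg: "\<forall>A \<in> sets borel. T -` A = A \<longrightarrow> measure \<mu> A = 0 \<or> measure \<mu> A = 1"
    and E_clopen: "\<forall>n. open (E n) \<and> closed (E n)"
    and E_decr: "\<forall>n. E (Suc n) \<subseteq> E n"
    and E_inter: "(\<Inter>n. E n) = {y}"
    and P_part: "\<forall>n. finite (P n) \<and> (\<forall>Z \<in> P n. Z \<noteq> {} \<and> open Z \<and> closed Z)
                    \<and> pairwise disjnt (P n) \<and> \<Union>(P n) = - E n"
    and P_refine: "\<forall>n. \<forall>B \<in> insert (E (Suc n)) (P (Suc n)). \<exists>C \<in> insert (E n) (P n). B \<subseteq> C"
    and P_gen: "open = generate_topology (\<Union>n. insert (E n) (P n))"
  shows "\<exists>\<Phi>. (\<forall>a \<in> CP. \<Phi> a \<in> Rrk \<mu> T E P)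
          \<and> inj_on \<Phi> CP
          \<and> (\<forall>a \<in> CP. \<forall>b \<in> CP. \<Phi> (cp_add a b) = Rrk_add \<mu> T E P (\<Phi> a) (\<Phi> b))
          \<and> (\<forall>a \<in> CP. \<forall>b \<in> CP. \<Phi> (cp_mult T a b) = Rrk_mult \<mu> T E P (\<Phi> a) (\<Phi> b))
          \<and> (\<forall>c. \<forall>a \<in> CP. \<Phi> (cp_smult c a) = Rrk_smult \<mu> T E P c (\<Phi> a))
          \<and> \<Phi> cp_one = Rrk_one \<mu> T E P
          \<and> (\<forall>a \<in> A_inf T cj P. \<Phi> a = pi_inf \<mu> T cj E P a)
          \<and> (\<lambda>n. rkC \<mu> T E P (Rrk_sub \<mu> T E P (pi_inf \<mu> T cj E P (s_n T E n)) (\<Phi> cp_t))) \<longlonglongrightarrow> 0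
          \<and> (\<exists>Y \<in> Rrk \<mu> T E P. Rrk_mult \<mu> T E P (\<Phi> cp_t) Y = Rrk_one \<mu> T E P
                              \<and> Rrk_mult \<mu> T E P Y (\<Phi> cp_t) = Rrk_one \<mu> T E P)
          \<and> (\<forall>a \<in> CP. rkC \<mu> T E P (\<Phi> a) = 0 \<longrightarrow> a = cp_zero)
          \<and> (\<forall>a \<in> A_inf T cj P. rkC \<mu> T E P (pi_inf \<mu> T cj E P a) = 0 \<longrightarrow> a = cp_zero)
          \<and> (\<forall>Y \<in> Rrk \<mu> T E P. \<forall>\<epsilon> > 0. \<exists>a \<in> A_inf T cj P.
               rkC \<mu> T E P (Rrk_sub \<mu> T E P (\<Phi> a) Y) < \<epsilon>)"
proof -
  interpret tower_system_star T \<mu> y E P cj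
    by (intro tower_system_star.intro tower_system.intro tower_system_star_axioms.intro) (fact assms)+
  show ?thesis
    by (intro exI[of _ Phi] conjI ballI allI impI;
        (rule Phi_Rrk Phi_inj Phi_add Phi_mult Phi_smult Phi_one Phi_pi_inf pi_inf_s_n_tendsto
          Phi_t_invertible Phi_faithful pi_inf_faithful Phi_dense; assumption?))
qed

end
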